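(* Let $N\ge1$ and $u_0,\ldots,u_N\in\mathbb{C}$ with $u_j\notin\Lambda_\tau$ and $u_j/\tau\notin\Lambda_{-1/\tau}$, and let $u=u_0+\cdots+u_N$. Then (i) $M_N(u_0,\ldots,u_N;\tau)=e^{\pi iN/4}\big[\delta_{jk}(-1)^k\zeta_{2N}^{k^2}\big]_{j,k=0}^{N-1}M_N(u_0,\ldots,u_N;\tau+1)$; (ii) $$M_N(u_0,\ldots,u_N;\tau)=\frac{(-i)^{N+1}e^{\pi iu^2/(N\tau)}}{\sqrt N\sqrt{-i\tau}}\big[\zeta_N^{-jk}\big]_{j,k=0}^{N-1}M_N\!\left(\tfrac{u_0}{\tau},\ldots,\tfrac{u_N}{\tau};-\tfrac1\tau\right)-\frac{(-1)^Ni}{2}\Big[(-1)^ke^{-2\pi iku/N}q^{-k^2/(2N)}h\!\left(u+k\tau-\tfrac{N-1}{2};N\tau\right)\Big]_{k=0}^{N-1},$$ where $\sqrt{-i\tau}$ is the principal branch.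
   Context: Fix $\tau$ with $\operatorname{Im}\tau>0$, $q=e^{2\pi i\tau}$, $q^c:=e^{2\pi ic\tau}$, $\Lambda_\tau=\mathbb{Z}+\tau\mathbb{Z}$, $\zeta_M=e^{2\pi i/M}$. $\vartheta(u;\tau)=\sum_{\nu\in\mathbb{Z}+1/2}e^{2\pi i\nu(u+1/2)}q^{\nu^2/2}$. Zwegers' multivariable $\mu$-function: $\mu_N(u_0,\ldots,u_N;\tau)=\sum_{n\in\mathbb{Z}^N}\frac{e^{\pi iu_0}}{1-e^{2\pi iu_0}q^{|n|}}\prod_{j=1}^N\frac{(-1)^{n_j}e^{-2\pi in_ju_j}q^{n_j(n_j+1)/2}}{\vartheta(u_j;\tau)}$, $|n|=n_1+\cdots+n_N$. $M_N(u_0,\ldots,u_N;\tau)=\big[(-1)^ke^{-2\pi iku/N-\pi ik^2\tau/N}\mu_N(u_0+k\tau,u_1,\ldots,u_N;\tau)\big]_{k=0}^{N-1}$ (column vector; in a matrix $[A_{jk}]$ the index $j$ is the row). The Mordell integral is $h(w;\tau)=\int_{-\infty}^{\infty}\frac{e^{\pi ix^2\tau-2\pi xw}}{\cosh(\pi x)}dx$. *)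

theory Defs
  imports "HOL-Analysis.Analysis"
begin

definition qpow :: "complex \<Rightarrow> real \<Rightarrow> complex" where
  "qpow \<tau> c = exp (2 * pi * \<i> * of_real c * \<tau>)"

definition lattice :: "complex \<Rightarrow> complex set" where
  "lattice \<tau> = {of_int a + of_int b * \<tau> | a b. True}"

definition zeta :: "nat \<Rightarrow> complex" where
  "zeta M = exp (2 * pi * \<i> / of_nat M)"

definition vtheta :: "complex \<Rightarrow> complex \<Rightarrow> complex" where
  "vtheta u \<tau> = (\<Sum>\<^sub>\<infinity>\<nu>\<in>{of_int n + 1/2 | n. True}.
      exp (2 * pi * \<i> * of_real \<nu> * (u + 1/2)) * qpow \<tau> (\<nu>^2 / 2))"

definition ZN :: "nat \<Rightarrow> (nat \<Rightarrow> int) set" where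
  "ZN N = {n. \<forall>j. j \<notin> {1..N} \<longrightarrow> n j = 0}"

text \<open>Zwegers' multivariable mu-function; u j for j = 0..N\<close>
definition muN :: "nat \<Rightarrow> (nat \<Rightarrow> complex) \<Rightarrow> complex \<Rightarrow> complex" where
  "muN N u \<tau> = (\<Sum>\<^sub>\<infinity>n\<in>ZN N.
      exp (pi * \<i> * u 0) / (1 - exp (2 * pi * \<i> * u 0) * qpow \<tau> (of_int (\<Sum>j\<in>{1..N}. n j)))
      * (\<Prod>j\<in>{1..N}. (-1) powi (n j) * exp (- 2 * pi * \<i> * of_int (n j) * u j)
            * qpow \<tau> (of_int (n j * (n j + 1)) / 2) / vtheta (u j) \<tau>))"

text \<open>The vector M_N; component k (0 \<le> k < N)\<close>
definition MN :: "nat \<Rightarrow> (nat \<Rightarrow> complex) \<Rightarrow> complex \<Rightarrow> nat \<Rightarrow> complex" where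
  "MN N u \<tau> k = (let U = (\<Sum>j\<in>{0..N}. u j) in
      (-1)^k * exp (- 2 * pi * \<i> * of_nat k * U / of_nat N - pi * \<i> * of_nat (k^2) * \<tau> / of_nat N)
      * muN N (u(0 := u 0 + of_nat k * \<tau>)) \<tau>)"

definition mordell_h :: "complex \<Rightarrow> complex \<Rightarrow> complex" where
  "mordell_h w \<tau> = integral UNIV (\<lambda>x::real.
      exp (pi * \<i> * of_real (x^2) * \<tau> - 2 * pi * complex_of_real x * w) / complex_of_real (cosh (pi * x)))"

end

theory Submission
  imports Defs "HOL-Complex_Analysis.Complex_Analysis" "HOL-Probability.Distributions"
    "HOL-Real_Asymp.Real_Asymp"
begin

text \<open>
  Write $e(z) = e^{2\pi i z}$ and $S = u_1 + \dots + u_N$. Grouping the sum over $n \in Z^N$ by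
  $m = |n|$ turns $\mu_N$, as a function of $z = u_0$, into a one-dimensional Appell sum
  $\sum_m b_m / (1 - e(z) q^m)$ up to an exponential factor, where the $b_m$ are the Fourier
  coefficients of $\prod_j \vartheta(x - u_j) / \vartheta(u_j)$.
  The component $j$ of (ii) is the component $0$ at $u_0 + j\tau$, so only the latter is needed.
  The difference $D(z)$ of its two sides satisfies $D(z+1) = -D(z)$ and
  $D(z + N\tau) = (-1)^N q^{N/2} e(z+S) D(z)$: the inhomogeneous terms cancel because of the two
  functional equations of the Mordell integral. The poles of $D$ at the lattice points cancel
  because unfolding the integral for $b_m$ with the inversion formula of the theta quotient yields
  a sum of $N$ complex Gaussian integrals that expresses $b_m$ through the coefficients for
  $-1/\tau$. Hence $D$ extends to a bounded entire function and vanishes by Liouville's theorem.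

  The facts on $\vartheta$ come from the same principle: the Appell sum $a$ built from the
  coefficients of $\vartheta$ itself is such that $a \vartheta$ is elliptic without poles, hence a
  nonzero constant. So $\vartheta$ vanishes on the lattice only, and comparing with
  $a(z) e^{-\pi i z^2/\tau} \vartheta(z/\tau; -1/\tau)$, which is constant too, gives the
  inversion formula up to a constant, which drops out of quotients.
\<close>

subsection \<open>Rapidly decreasing Fourier series\<close>

text \<open>Two features of the functional equations carry the argument. The multiplier over N\<tau>
  has modulus exp(const - 2 pi Im z), at most 1 far up and at least 1 far down, so any point can be
  moved into a fixed strip without decreasing |D|; hence D is bounded and therefore constant. The
  minus sign in D(z + 1) = -D(z) then makes the constant 0. The constants of the formula are forced
  twice: by the cancellation of the inhomogeneous Gaussians under z + 1, and by the residues at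
  -m\<tau>. There the k-th shifted dual term contributes its coefficient with index -k and a
  Jacobian \<tau>, which turns -i/sqrt(-i\<tau>) into the factor sqrt(-i\<tau>) of the Gaussian
  integral. The obstacle that shapes the formal text is that division by zero yields 0: values at
  poles carry no information. Functional equations involving poles are therefore used off the
  lattice, and singularities are described on punctured neighbourhoods only. The Appell sums are
  treated for abstract coefficients, known through their decay, a recursion and their total, so that
  \<tau> and -1/\<tau> are covered by the same lemmas.\<close>

definition expi :: "complex \<Rightarrow> complex" where
  "expi z = exp (2 * pi * \<i> * z)"

lemma expi_add: "expi (a + b) = expi a * expi b"
  by (simp add: expi_def ring_distribs exp_add)

lemma expi_diff: "expi (a - b) = expi a / expi b"
  by (simp add: expi_def ring_distribs exp_diff)

lemma expi_minus: "expi (- a) = inverse (expi a)"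
  by (simp add: expi_def exp_minus)

lemma expi_0 [simp]: "expi 0 = 1"
  by (simp add: expi_def)

lemma expi_nonzero [simp]: "expi a \<noteq> 0"
  by (simp add: expi_def)

lemma expi_eq_1_iff: "expi z = 1 \<longleftrightarrow> z \<in> \<int>"
proof -
  have "expi z = 1 \<longleftrightarrow> (\<exists>n::int. Re z = of_int n \<and> Im z = 0)"
    by (auto simp: expi_def exp_eq_1 field_simps)
  also have "\<dots> \<longleftrightarrow> z \<in> \<int>"
    by (auto simp: complex_eq_iff Ints_def)
  finally show ?thesis .
qed

lemma expi_of_int [simp]: "expi (of_int n) = 1"
  by (simp add: expi_eq_1_iff)

lemma expi_half: "expi (1/2) = -1"
  by (simp add: expi_def)

lemma expi_quarter: "expi (1/4) = \<i>"
proof -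
  have "expi (1/4) = exp (\<i> * of_real (pi / 2))"
    by (simp add: expi_def mult.commute)
  also have "\<dots> = \<i>" by (simp only: cis_conv_exp [symmetric] cis_pi_half)
  finally show ?thesis .
qed

lemma expi_add_of_int [simp]: "expi (z + of_int n) = expi z"
  by (simp add: expi_add)

lemma expi_eqI: "a - b \<in> \<int> \<Longrightarrow> expi a = expi b"
  by (metis expi_add expi_eq_1_iff diff_add_cancel mult_1)

lemma expi_eq_of_int: "a - b = of_int n \<Longrightarrow> expi a = expi b"
  by (rule expi_eqI) simp

lemma expi_cong: "a = b \<Longrightarrow> expi a = expi b"
  by simp

lemma expi_power: "expi z ^ n = expi (of_nat n * z)"
  by (simp add: expi_def exp_of_nat_mult[symmetric] algebra_simps)

lemma norm_expi: "norm (expi z) = exp (- 2 * pi * Im z)"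
  by (simp add: expi_def norm_exp_eq_Re)

lemma expi_holomorphic [holomorphic_intros]: "f holomorphic_on A \<Longrightarrow> (\<lambda>z. expi (f z)) holomorphic_on A"
  unfolding expi_def by (intro holomorphic_intros)

lemma expi_analytic [analytic_intros]: "f analytic_on A \<Longrightarrow> (\<lambda>z. expi (f z)) analytic_on A"
  unfolding expi_def by (intro analytic_intros)

lemma expi_continuous [continuous_intros]: "continuous_on A f \<Longrightarrow> continuous_on A (\<lambda>z. expi (f z))"
  unfolding expi_def by (intro continuous_intros)

lemma qpow_eq_expi: "qpow \<tau> c = expi (of_real c * \<tau>)"
  by (simp add: qpow_def expi_def mult.assoc)

definition rapid :: "(int \<Rightarrow> complex) \<Rightarrow> bool" where
  "rapid c \<longleftrightarrow> (\<forall>t::real. (\<lambda>m. norm (c m) * exp (t * of_int m)) summable_on UNIV)"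

lemma summable_on_exp_abs: "(\<lambda>m::int. exp (- \<bar>of_int m\<bar>) :: real) summable_on UNIV"
proof -
  have s: "summable (\<lambda>n::nat. exp (- real n))"
  proof -
    have "summable (\<lambda>n::nat. (exp (-1::real)) ^ n)"
      by (intro summable_geometric) auto
    thus ?thesis by (simp add: exp_of_nat_mult[symmetric])
  qed
  have s': "(\<lambda>n::nat. exp (- real n)) summable_on UNIV"
    using s by (subst summable_on_UNIV_nonneg_real_iff) auto
  have 1: "(\<lambda>m::int. exp (- \<bar>of_int m\<bar>) :: real) summable_on (range int)"
    by (subst summable_on_reindex) (auto simp: o_def s')
  have 2: "(\<lambda>m::int. exp (- \<bar>of_int m\<bar>) :: real) summable_on (range (\<lambda>n. - int n))"
    by (subst summable_on_reindex) (auto simp: o_def s' inj_on_def)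
  have "range int \<union> range (\<lambda>n. - int n) = UNIV"
  proof -
    have "x \<in> range int \<union> range (\<lambda>n. - int n)" for x
      by (cases x rule: int_cases2) auto
    thus ?thesis by blast
  qed
  thus ?thesis using summable_on_union[OF 1 2] by simp
qed

lemma rapid_gaussian:
  assumes "Im \<tau> > 0"
  shows "rapid (\<lambda>m. C * expi (of_int m ^ 2 * \<tau> / 2 + of_int m * w))"
  unfolding rapid_def
proof
  let ?e = "\<lambda>m::int. expi (of_int m ^ 2 * \<tau> / 2 + of_int m * w)"
  fix t :: real
  define A where "A = pi * Im \<tau>"
  \<comment> \<open>The extra 1 is spent on the factor exp(-|m|), which supplies the summable
    majorant.\<close>
  define B where "B = \<bar>t - 2 * pi * Im w\<bar> + 1"
  have A: "A > 0" using assms by (simp add: A_def)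
  have *: "norm (?e m) * exp (t * of_int m)
          \<le> exp (B\<^sup>2 / (4 * A)) * exp (- \<bar>of_int m\<bar>)" for m :: int
  proof -
    have "norm (?e m) * exp (t * of_int m)
       = exp (- A * of_int m ^ 2 + (t - 2 * pi * Im w) * of_int m)"
      by (simp add: norm_expi A_def exp_add[symmetric] algebra_simps power2_eq_square)
    also have "\<dots> \<le> exp (B\<^sup>2 / (4 * A) - \<bar>of_int m\<bar>)"
    proof -
      have "(t - 2 * pi * Im w) * of_int m \<le> \<bar>(t - 2 * pi * Im w) * of_int m\<bar>"
        by linarith
      also have "\<dots> = (B - 1) * \<bar>of_int m\<bar>"
        by (simp add: B_def abs_mult)
      finally have 1: "(t - 2 * pi * Im w) * of_int m \<le> (B - 1) * \<bar>of_int m\<bar>" .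
      have "0 \<le> (2 * A * \<bar>of_int m\<bar> - B)\<^sup>2 / (4 * A)"
        using A by simp
      also have "\<dots> = A * \<bar>of_int m\<bar>^2 - B * \<bar>of_int m\<bar> + B\<^sup>2 / (4 * A)"
        using A by (simp add: field_simps power2_eq_square)
      finally have "B * \<bar>of_int m\<bar> - A * of_int m^2 \<le> B\<^sup>2 / (4 * A)" by simp
      with 1 show ?thesis by (simp add: algebra_simps)
    qed
    finally show ?thesis by (simp add: exp_diff exp_minus field_simps)
  qed
  have "(\<lambda>m::int. norm C * exp (B\<^sup>2 / (4 * A)) * exp (- \<bar>of_int m\<bar>)) summable_on UNIV"
    by (intro summable_on_cmult_right summable_on_exp_abs)
  thus "(\<lambda>m. norm (C * ?e m) * exp (t * of_int m)) summable_on UNIV"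
  proof (rule summable_on_comparison_test)
    fix m :: int
    show "norm (C * ?e m) * exp (t * of_int m) \<le> norm C * exp (B\<^sup>2 / (4 * A)) * exp (- \<bar>of_int m\<bar>)"
      using mult_left_mono[OF *[of m], of "norm C"] by (simp add: norm_mult mult.assoc)
  qed auto
qed

lemma rapid_abs_summable:
  assumes "rapid c"
  shows "(\<lambda>m. norm (c m)) summable_on UNIV"
  using assms[unfolded rapid_def, rule_format, of 0] by simp

lemma rapid_summable_dominated:
  assumes "rapid c" "\<And>m. norm (f m) \<le> norm (c m) * K"
  shows "(\<lambda>m. norm (f m)) summable_on UNIV"
proof (rule summable_on_comparison_test)
  show "(\<lambda>m. norm (c m) * K) summable_on UNIV"
    by (intro summable_on_cmult_left rapid_abs_summable assms(1))
qed (use assms(2) in auto)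

text \<open>The shift \<open>s\<close> keeps integer indices for half-integral frequencies: it is
  1/2 for theta and N/2 for a product of N theta quotients.\<close>

definition fseries :: "(int \<Rightarrow> complex) \<Rightarrow> complex \<Rightarrow> complex \<Rightarrow> complex" where
  "fseries c s z = (\<Sum>\<^sub>\<infinity>m. c m * expi ((of_int m + s) * z))"

text \<open>As \<open>s\<close> may be non-real, |e(sz)| is not controlled by Im z, hence the
  separate bound \<open>K\<close>. The remaining factor is at most exp(2 pi B |m|), dominated by the
  sum of the exponentials with both signs; each of these is an instance of
  \<open>rapid\<close>.\<close>

lemma fseries_uniform:
  assumes "rapid c" "\<And>z. z \<in> A \<Longrightarrow> \<bar>Im z\<bar> \<le> B" "\<And>z. z \<in> A \<Longrightarrow> norm (expi (s * z)) \<le> K"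
  obtains M where "M summable_on UNIV"
    "\<And>m z. z \<in> A \<Longrightarrow> norm (c m * expi ((of_int m + s) * z)) \<le> M m"
proof
  show "(\<lambda>m. (norm (c m) * exp (2 * pi * B * of_int m) + norm (c m) * exp (- 2 * pi * B * of_int m)) * K) summable_on UNIV"
    using assms(1) unfolding rapid_def by (intro summable_on_cmult_left summable_on_add) blast+
  fix m z assume z: "z \<in> A"
  have "- 2 * pi * (of_int m * Im z) \<le> \<bar>2 * pi * B * of_int m\<bar>"
  proof -
    have "- 2 * pi * (of_int m * Im z) \<le> \<bar>2 * pi * (of_int m * Im z)\<bar>" by simp
    also have "\<dots> = 2 * pi * \<bar>of_int m\<bar> * \<bar>Im z\<bar>" by (simp add: abs_mult)
    also have "\<dots> \<le> 2 * pi * \<bar>of_int m\<bar> * B" using assms(2)[OF z] by (intro mult_left_mono) auto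
    also have "\<dots> \<le> \<bar>2 * pi * B * of_int m\<bar>" using assms(2)[OF z] by (simp add: abs_mult)
    finally show ?thesis .
  qed
  hence "exp (- 2 * pi * (of_int m * Im z)) \<le> exp \<bar>2 * pi * B * of_int m\<bar>" by simp
  also have "\<dots> \<le> exp (2 * pi * B * of_int m) + exp (- 2 * pi * B * of_int m)"
    by (cases "2 * pi * B * of_int m \<ge> 0") (auto simp: abs_if)
  finally have 1: "norm (expi (of_int m * z)) \<le> exp (2 * pi * B * of_int m) + exp (- 2 * pi * B * of_int m)"
    by (simp add: norm_expi)
  have "norm (c m * expi ((of_int m + s) * z)) = norm (c m) * (norm (expi (of_int m * z)) * norm (expi (s * z)))"
    by (simp add: norm_mult ring_distribs expi_add)
  also have "\<dots> \<le> norm (c m) * ((exp (2 * pi * B * of_int m) + exp (- 2 * pi * B * of_int m)) * K)"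
    by (intro mult_left_mono mult_mono 1 assms(3) z) auto
  finally show "norm (c m * expi ((of_int m + s) * z)) \<le> (norm (c m) * exp (2 * pi * B * of_int m) + norm (c m) * exp (- 2 * pi * B * of_int m)) * K"
    by (simp add: algebra_simps)
qed

lemma fseries_abs_summable:
  assumes "rapid c"
  shows "(\<lambda>m. norm (c m * expi ((of_int m + s) * z))) summable_on UNIV"
proof -
  have B: "\<bar>Im w\<bar> \<le> \<bar>Im z\<bar>" and K: "norm (expi (s * w)) \<le> norm (expi (s * z))" if "w \<in> {z}" for w
    using that by simp_all
  obtain M where M: "M summable_on UNIV" "\<And>m w. w \<in> {z} \<Longrightarrow> norm (c m * expi ((of_int m + s) * w)) \<le> M m"
    using fseries_uniform[OF assms B K] by blast
  have "norm (c m * expi ((of_int m + s) * z)) \<le> M m" for m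
    by (rule M(2)) simp
  thus ?thesis by (rule summable_on_comparison_test[OF M(1)]) simp
qed

lemma expi_mult_bounded:
  assumes "compact A"
  obtains K where "\<And>z. z \<in> A \<Longrightarrow> norm (expi (s * z)) \<le> K"
proof -
  have "compact ((\<lambda>z. expi (s * z)) ` A)"
    by (intro compact_continuous_image continuous_intros assms)
  from compact_imp_bounded[OF this] obtain K where "\<forall>x\<in>(\<lambda>z. expi (s * z)) ` A. norm x \<le> K"
    unfolding bounded_iff by blast
  thus ?thesis by (intro that[of K]) blast
qed

lemma fseries_uniform_limit:
  assumes "rapid c" "compact A"
  shows "uniform_limit A (\<lambda>X z. \<Sum>m\<in>X. c m * expi ((of_int m + s) * z)) (fseries c s) (finite_subsets_at_top UNIV)"
proof -
  have "bounded (Im ` A)"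
    by (intro compact_imp_bounded compact_continuous_image continuous_intros assms)
  then obtain B where B: "\<And>z. z \<in> A \<Longrightarrow> \<bar>Im z\<bar> \<le> B" by (auto simp: bounded_iff)
  obtain K where K: "\<And>z. z \<in> A \<Longrightarrow> norm (expi (s * z)) \<le> K" using expi_mult_bounded[OF assms(2)] by blast
  obtain M where M: "M summable_on UNIV"
    "\<And>m z. z \<in> A \<Longrightarrow> norm (c m * expi ((of_int m + s) * z)) \<le> M m"
    using fseries_uniform[OF assms(1) B K] by blast
  show ?thesis
    unfolding fseries_def by (rule Weierstrass_m_test_general[OF M(2) M(1)]) auto
qed

lemma fseries_holomorphic:
  assumes "rapid c"
  shows "fseries c s holomorphic_on A"
proof -
  have "fseries c s analytic_on {z}" for z
  proof -
    have "fseries c s holomorphic_on ball z 1"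
      by (rule holomorphic_uniform_limit[OF _ fseries_uniform_limit[OF assms, of "cball z 1" s]])
        (auto intro!: always_eventually continuous_intros holomorphic_intros)
    thus ?thesis by (auto simp: analytic_at intro!: exI[of _ "ball z 1"])
  qed
  thus ?thesis
    by (meson analytic_imp_holomorphic analytic_on_analytic_at)
qed

section \<open>Termwise integration and Fourier coefficients\<close>

lemma has_sum_integral:
  fixes f :: "'a \<Rightarrow> real \<Rightarrow> complex"
  assumes u: "uniform_limit {a..b} (\<lambda>X x. \<Sum>m\<in>X. f m x) g (finite_subsets_at_top UNIV)"
    and c: "\<And>m. continuous_on {a..b} (f m)"
  shows "((\<lambda>m. integral {a..b} (f m)) has_sum integral {a..b} g) UNIV"
proof -
  obtain I J where IJ: "\<And>X. ((\<lambda>x. \<Sum>m\<in>X. f m x) has_integral I X) {a..b}" "(g has_integral J) {a..b}"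
    "(I \<longlongrightarrow> J) (finite_subsets_at_top UNIV)"
    by (rule uniform_limit_integral[OF u]) (auto intro!: continuous_on_sum c)
  have "\<forall>\<^sub>F X in finite_subsets_at_top UNIV. I X = (\<Sum>m\<in>X. integral {a..b} (f m))"
  proof (rule eventually_finite_subsets_at_top_weakI)
    fix X :: "'a set" assume "finite X"
    hence "((\<lambda>x. \<Sum>m\<in>X. f m x) has_integral (\<Sum>m\<in>X. integral {a..b} (f m))) {a..b}"
      by (intro has_integral_sum integrable_integral integrable_continuous_interval c) auto
    thus "I X = (\<Sum>m\<in>X. integral {a..b} (f m))" using IJ(1) has_integral_unique by blast
  qed
  hence "((\<lambda>X. \<Sum>m\<in>X. integral {a..b} (f m)) \<longlongrightarrow> J) (finite_subsets_at_top UNIV)"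
    using IJ(3) tendsto_cong by blast
  moreover have "J = integral {a..b} g" using IJ(2) by (simp add: integral_unique)
  ultimately show ?thesis by (simp add: has_sum_def)
qed

text \<open>The series is evaluated along the segment from 0 to \<open>w\<close>: w = 1 extracts
  Fourier coefficients, w = 1/\<tau> serves the unfolding of the dual series at x/\<tau>.\<close>

lemma fseries_times_has_sum_integral:
  assumes "rapid c" "continuous_on {0..1::real} g"
  shows "((\<lambda>m. integral {0..1} (\<lambda>x. c m * expi ((of_int m + s) * (of_real x * w)) * g x)) has_sum
          integral {0..1} (\<lambda>x. fseries c s (of_real x * w) * g x)) UNIV"
proof (rule has_sum_integral)
  have "compact ((\<lambda>x::real. of_real x * w) ` {0..1})"
    by (intro compact_continuous_image continuous_intros) auto
  from fseries_uniform_limit[OF assms(1) this, of s]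
  have u: "uniform_limit {0..1} (\<lambda>X x::real. \<Sum>m\<in>X. c m * expi ((of_int m + s) * (of_real x * w))) 
     (\<lambda>x. fseries c s (of_real x * w)) (finite_subsets_at_top UNIV)"
    by (auto simp: uniform_limit_iff)
  have hol: "fseries c s holomorphic_on UNIV" by (rule fseries_holomorphic[OF assms(1)])
  have cont: "continuous_on {0..1::real} (\<lambda>x. fseries c s (of_real x * w))"
    by (rule continuous_on_compose2[OF holomorphic_on_imp_continuous_on[OF hol]])
       (auto intro!: continuous_intros)
  have "bounded (g ` {0..1})" "bounded ((\<lambda>x. fseries c s (of_real x * w)) ` {0..1::real})"
    by (intro compact_imp_bounded compact_continuous_image assms cont; simp)+
  note bd = this
  have v: "uniform_limit {0..1} (\<lambda>X::int set. g) g (finite_subsets_at_top UNIV)"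
    by (auto simp: uniform_limit_iff)
  from uniform_lim_mult[OF u v bd(2,1)]
  show "uniform_limit {0..1} (\<lambda>X x::real. \<Sum>m\<in>X. c m * expi ((of_int m + s) * (of_real x * w)) * g x) 
     (\<lambda>x. fseries c s (of_real x * w) * g x) (finite_subsets_at_top UNIV)"
    by (simp add: sum_distrib_right)
qed (auto intro!: continuous_intros assms)

lemma integral_expi_of_int: "integral {0..1} (\<lambda>x::real. expi (of_int m * of_real x)) = (if m = 0 then 1 else 0)"
proof (cases "m = 0")
  case False
  define F where "F = (\<lambda>z::complex. expi (of_int m * z) / (2 * pi * \<i> * of_int m))"
  have "((\<lambda>x::real. expi (of_int m * of_real x)) has_integral (F (of_real 1) - F (of_real 0))) {0..1}"
  proof (rule fundamental_theorem_of_calculus)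
    fix x :: real
    have "(F has_field_derivative expi (of_int m * of_real x)) (at (of_real x))"
      using False unfolding F_def expi_def by (auto intro!: derivative_eq_intros)
    thus "((\<lambda>x. F (of_real x)) has_vector_derivative expi (of_int m * of_real x)) (at x within {0..1})"
      by (intro has_vector_derivative_real_field) 
  qed auto
  moreover have "F (of_real 1) = F (of_real 0)" by (simp add: F_def)
  ultimately show ?thesis using False by (simp add: integral_unique)
qed auto

lemma fseries_coeff:
  assumes "rapid c"
  shows "integral {0..1} (\<lambda>x::real. fseries c s (of_real x) * expi (- (of_int k + s) * of_real x)) = c k"
proof -
  let ?f = "\<lambda>m (x::real). c m * expi ((of_int m + s) * (of_real x * 1)) * expi (- (of_int k + s) * of_real x)"
  have "((\<lambda>m. integral {0..1} (?f m)) has_sum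
          integral {0..1} (\<lambda>x::real. fseries c s (of_real x * 1) * expi (- (of_int k + s) * of_real x))) UNIV"
    by (rule fseries_times_has_sum_integral[OF assms]) (auto intro!: continuous_intros)
  moreover have "integral {0..1} (?f m) 
     = (if m = k then c k else 0)" for m
  proof -
    have "integral {0..1} (?f m)
      = integral {0..1} (\<lambda>x::real. c m * expi (of_int (m - k) * of_real x))"
      by (intro integral_cong) (simp add: mult.assoc expi_add[symmetric] ring_distribs)
    also have "\<dots> = c m * integral {0..1} (\<lambda>x::real. expi (of_int (m - k) * of_real x))" by simp
    also have "\<dots> = (if m = k then c k else 0)" by (subst integral_expi_of_int) auto
    finally show ?thesis .
  qed
  ultimately have "((\<lambda>m. if m = k then c k else 0) has_sum
          integral {0..1} (\<lambda>x::real. fseries c s (of_real x) * expi (- (of_int k + s) * of_real x))) UNIV"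
    by simp
  moreover have "((\<lambda>m. if m = k then c k else 0) has_sum c k) UNIV"
    by (rule has_sum_finite_neutralI[of "{k}"]) auto
  ultimately show ?thesis by (rule has_sum_unique)
qed

subsection \<open>Simple poles and quasi-periodic functions\<close>

text \<open>At most a simple pole with residue \<open>\<rho>\<close>; the value of \<open>f\<close> at \<open>z\<close> itself, which is junk for quotients, is ignored.\<close>

definition polar :: "(complex \<Rightarrow> complex) \<Rightarrow> complex \<Rightarrow> complex \<Rightarrow> bool" where
  "polar f z \<rho> \<longleftrightarrow> (\<exists>F. F analytic_on {z} \<and> F z = \<rho> \<and> (\<forall>\<^sub>F w in at z. f w = F w / (w - z)))"

lemma polar_analytic:
  assumes "f analytic_on {z}"
  shows "polar f z 0"
  unfolding polar_def
proof (intro exI[of _ "\<lambda>w. (w - z) * f w"] conjI)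
  show "\<forall>\<^sub>F w in at z. f w = (w - z) * f w / (w - z)"
    by (auto simp: eventually_at_filter)
qed (auto intro!: analytic_intros assms)

lemma polar_cong:
  assumes "polar f z \<rho>" "\<forall>\<^sub>F w in at z. f w = g w"
  shows "polar g z \<rho>"
proof -
  obtain F where F: "F analytic_on {z}" "F z = \<rho>" "\<forall>\<^sub>F w in at z. f w = F w / (w - z)"
    using assms(1) unfolding polar_def by blast
  have "\<forall>\<^sub>F w in at z. g w = F w / (w - z)"
    using F(3) assms(2) by eventually_elim simp
  thus ?thesis unfolding polar_def using F by blast
qed

lemma polar_add:
  assumes "polar f z \<rho>" "polar g z \<sigma>"
  shows "polar (\<lambda>w. f w + g w) z (\<rho> + \<sigma>)"
proof -
  obtain F where F: "F analytic_on {z}" "F z = \<rho>" "\<forall>\<^sub>F w in at z. f w = F w / (w - z)"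
    using assms(1) unfolding polar_def by blast
  obtain G where G: "G analytic_on {z}" "G z = \<sigma>" "\<forall>\<^sub>F w in at z. g w = G w / (w - z)"
    using assms(2) unfolding polar_def by blast
  have "\<forall>\<^sub>F w in at z. f w + g w = (F w + G w) / (w - z)"
    using F(3) G(3) by eventually_elim (simp add: add_divide_distrib)
  moreover have "(\<lambda>w. F w + G w) analytic_on {z}" by (intro analytic_intros F G)
  ultimately show ?thesis unfolding polar_def using F(2) G(2) by blast
qed

text \<open>A zero of \<open>g\<close> at the point cancels the pole; this is how theta removes the
  poles of its Appell sum.\<close>

lemma polar_mult:
  assumes "polar f z \<rho>" "g analytic_on {z}"
  shows "polar (\<lambda>w. g w * f w) z (g z * \<rho>)"
proof -
  obtain F where F: "F analytic_on {z}" "F z = \<rho>" "\<forall>\<^sub>F w in at z. f w = F w / (w - z)"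
    using assms(1) unfolding polar_def by blast
  have "\<forall>\<^sub>F w in at z. g w * f w = (g w * F w) / (w - z)"
    using F(3) by eventually_elim simp
  moreover have "(\<lambda>w. g w * F w) analytic_on {z}" by (intro analytic_intros F assms)
  ultimately show ?thesis unfolding polar_def using F(2) by blast
qed

lemma polar_sum:
  assumes "finite A" "\<And>k. k \<in> A \<Longrightarrow> polar (f k) z (\<rho> k)"
  shows "polar (\<lambda>w. \<Sum>k\<in>A. f k w) z (\<Sum>k\<in>A. \<rho> k)"
  using assms by (induction A rule: finite_induct) (auto intro: polar_add polar_analytic)

lemma eventually_at_affine:
  fixes a b z :: complex
  assumes "a \<noteq> 0" "\<forall>\<^sub>F w in at (a * z + b). P w"
  shows "\<forall>\<^sub>F w in at z. P (a * w + b)"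
proof -
  have "filterlim (\<lambda>w. a * w + b) (at (a * z + b)) (at z)"
    unfolding filterlim_at using assms(1)
    by (auto intro!: tendsto_eq_intros simp: eventually_at_filter)
  thus ?thesis using assms(2) unfolding filterlim_iff by blast
qed

lemma eventually_at_shift:
  fixes b z :: complex
  assumes "\<forall>\<^sub>F w in at (z + b). P w"
  shows "\<forall>\<^sub>F w in at z. P (w + b)"
  using eventually_at_affine[where a = 1 and b = b and z = z and P = P] assms by simp

text \<open>The division by \<open>a\<close> comes from (a w + b) - (a z + b) = a (w - z). With a =
  1/\<tau> it yields the factor \<tau> in the residues on the dual side.\<close>

lemma polar_affine:
  assumes "polar f (a * z + b) \<rho>" "a \<noteq> 0"
  shows "polar (\<lambda>w. f (a * w + b)) z (\<rho> / a)"
proof -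
  obtain F where F: "F analytic_on {a * z + b}" "F (a * z + b) = \<rho>"
      "\<forall>\<^sub>F w in at (a * z + b). f w = F w / (w - (a * z + b))"
    using assms(1) unfolding polar_def by blast
  have "(F \<circ> (\<lambda>w. a * w + b)) analytic_on {z}"
    by (intro analytic_on_compose) (use F(1) in \<open>auto intro!: analytic_intros\<close>)
  hence "(\<lambda>w. F (a * w + b) / a) analytic_on {z}"
    unfolding o_def using assms(2) by (intro analytic_intros) auto
  moreover have "\<forall>\<^sub>F w in at z. f (a * w + b) = F (a * w + b) / a / (w - z)"
    using eventually_at_affine[OF assms(2) F(3)]
    by eventually_elim (use assms(2) in \<open>simp add: right_diff_distrib[symmetric]\<close>)
  ultimately show ?thesis unfolding polar_def using F(2) by blast
qed

text \<open>With residue 0 the numerator vanishes at \<open>z\<close>, so the quotient is a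
  difference quotient and extends by the derivative.\<close>

lemma polar_zero_extend:
  assumes "polar f z 0"
  obtains r g where "r > 0" "g holomorphic_on ball z r" "\<And>w. w \<in> ball z r - {z} \<Longrightarrow> f w = g w"
proof -
  obtain F where F: "F analytic_on {z}" "F z = 0" "\<forall>\<^sub>F w in at z. f w = F w / (w - z)"
    using assms(1) unfolding polar_def by blast
  obtain r1 where r1: "r1 > 0" "F holomorphic_on ball z r1"
    using F(1) unfolding analytic_on_def by blast
  obtain r2 where r2: "r2 > 0" "\<And>w. w \<noteq> z \<Longrightarrow> dist w z < r2 \<Longrightarrow> f w = F w / (w - z)"
    using F(3) unfolding eventually_at by blast
  let ?g = "\<lambda>w. if w = z then deriv F z else (F w - F z) / (w - z)"
  show ?thesis
  proof
    have "F holomorphic_on ball z (min r1 r2)"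
      by (rule holomorphic_on_subset[OF r1(2)]) auto
    thus "?g holomorphic_on ball z (min r1 r2)" by (rule pole_lemma_open) auto
  qed (use r1 r2 F in \<open>auto simp: dist_commute\<close>)
qed

section \<open>Removable singularities and the Liouville argument\<close>

lemma entire_extension:
  assumes "\<And>z. polar f z 0"
  obtains F where "F holomorphic_on UNIV" "\<And>z. isCont f z \<Longrightarrow> F z = f z"
    "\<And>z. \<forall>\<^sub>F w in at z. F w = f w"
proof -
  \<comment> \<open>Taking limits gives one global extension without gluing local ones, and it
    ignores the values of \<open>f\<close> at exceptional points.\<close>
  define F where "F = (\<lambda>z. Lim (at z) f)"
  have 1: "F z = f z" if "isCont f z" for z
    using that unfolding F_def isCont_def by (intro tendsto_Lim) auto
  have *: "\<exists>r>0. F holomorphic_on ball z r \<and> (\<forall>w \<in> ball z r - {z}. F w = f w)" for z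
  proof -
    obtain r g where r: "r > 0" "g holomorphic_on ball z r" "\<And>w. w \<in> ball z r - {z} \<Longrightarrow> f w = g w"
      using polar_zero_extend[OF assms] by blast
    have cg: "isCont g w" if "w \<in> ball z r" for w
      using holomorphic_on_imp_continuous_on[OF r(2)] that by (simp add: continuous_on_eq_continuous_at)
    have eq: "F w = f w" if w: "w \<in> ball z r - {z}" for w
    proof (rule 1)
      have "open (ball z r - {z})" by auto
      hence "\<forall>\<^sub>F v in nhds w. v \<in> ball z r - {z}" using w by (rule eventually_nhds_in_open)
      hence "\<forall>\<^sub>F v in nhds w. f v = g v" by eventually_elim (rule r(3))
      thus "isCont f w" using cg[of w] w by (subst isCont_cong) auto
    qed
    have "F z = g z"
    proof -
      have "\<forall>\<^sub>F v in nhds z. v \<in> ball z r" using r(1) by (intro eventually_nhds_in_open) auto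
      hence "\<forall>\<^sub>F v in at z. g v = f v"
        unfolding eventually_at_filter by eventually_elim (use r(3) in auto)
      moreover have "(g \<longlongrightarrow> g z) (at z)" using cg[of z] r(1) by (simp add: isCont_def)
      ultimately have "(f \<longlongrightarrow> g z) (at z)" by (rule Lim_transform_eventually[rotated])
      thus ?thesis unfolding F_def by (intro tendsto_Lim) auto
    qed
    hence "F w = g w" if "w \<in> ball z r" for w using that eq[of w] r(3)[of w] by (cases "w = z") auto
    hence "F holomorphic_on ball z r" using r(2) by (metis holomorphic_transform)
    thus ?thesis using r(1) eq by blast
  qed
  show ?thesis
  proof (rule that[OF _ 1])
    show "F holomorphic_on UNIV"
      using * by (intro analytic_imp_holomorphic) (auto simp: analytic_on_def)
    show "\<forall>\<^sub>F w in at z. F w = f w" for z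
    proof -
      obtain r where "r > 0" "\<forall>w \<in> ball z r - {z}. F w = f w" using * by blast
      thus ?thesis by (auto simp: eventually_at dist_commute intro!: exI[of _ r])
    qed
  qed
qed

text \<open>Carries identities from a punctured neighbourhood to its centre. The general target type
  admits real-valued moduli.\<close>

lemma eq_of_eventually_eq:
  fixes F G :: "complex \<Rightarrow> 'a::t2_space"
  assumes "isCont F z" "isCont G z" "\<forall>\<^sub>F w in at z. F w = G w"
  shows "F z = G z"
proof -
  have "(G \<longlongrightarrow> F z) (at z)"
    using assms(1,3) unfolding isCont_def by (rule Lim_transform_eventually)
  thus ?thesis using assms(2) unfolding isCont_def by (intro tendsto_unique[of "at z"]) auto
qed

text \<open>A point above the strip |Im z| \<le> Y + Im \<omega> can be moved by -\<omega>, one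
  below it by \<omega>, without decreasing |f|. Finitely many moves reach the strip, where the
  period 1 leaves a compact rectangle.\<close>

lemma bounded_of_quasi_periodic:
  assumes hol: "f holomorphic_on UNIV" and per: "\<And>z. norm (f (z + 1)) = norm (f z)"
    and \<omega>: "Im \<omega> > 0" and Y: "Y \<ge> 0"
    and up: "\<And>z. Im z \<ge> Y \<Longrightarrow> norm (f (z + \<omega>)) \<le> norm (f z)"
    and down: "\<And>z. Im z \<le> - Y \<Longrightarrow> norm (f z) \<le> norm (f (z + \<omega>))"
  shows "\<exists>M. \<forall>z. norm (f z) \<le> M"
proof -
  define K where "K = cbox (Complex 0 (- Y - Im \<omega>)) (Complex 1 (Y + Im \<omega>))"
  have "bounded (f ` K)"
    using hol by (intro compact_imp_bounded compact_continuous_image)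
      (auto simp: K_def intro: holomorphic_on_imp_continuous_on holomorphic_on_subset)
  then obtain M where M: "\<And>z. z \<in> K \<Longrightarrow> norm (f z) \<le> M" by (auto simp: bounded_iff)
  have per': "norm (f (z + of_int n)) = norm (f z)" for z n
  proof (induction n rule: int_induct[of _ 0])
    case (step1 i)
    thus ?case using per[of "z + of_int i"] by (simp add: add.assoc)
  next
    case (step2 i)
    thus ?case using per[of "z + of_int (i - 1)"] by (simp add: add.assoc)
  qed auto
  have strip: "norm (f z) \<le> M" if "\<bar>Im z\<bar> \<le> Y + Im \<omega>" for z
  proof -
    have "z + of_int (- \<lfloor>Re z\<rfloor>) \<in> K"
      using that by (auto simp: K_def in_cbox_complex_iff) linarith
    from M[OF this] show ?thesis by (simp only: per')
  qed
  \<comment> \<open>Induction on the number of layers of height Im \<omega>. The margin Im \<omega>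
    beyond \<open>Y\<close> ensures that a single step never leaves the region where
    \<open>up\<close> or \<open>down\<close> applies.\<close>
  have *: "norm (f z) \<le> M" if "\<bar>Im z\<bar> \<le> Y + of_nat (Suc n) * Im \<omega>" for n z
    using that
  proof (induction n arbitrary: z)
    case 0
    thus ?case using strip by simp
  next
    case (Suc n)
    consider "Im z > Y + of_nat (Suc n) * Im \<omega>" | "Im z < - (Y + of_nat (Suc n) * Im \<omega>)"
      | "\<bar>Im z\<bar> \<le> Y + of_nat (Suc n) * Im \<omega>" by linarith
    thus ?case
    proof cases
      case 1
      define t where "t = Im \<omega> * real n"
      have a: "of_nat (Suc n) * Im \<omega> \<ge> Im \<omega>" and t: "t \<ge> 0" "Im \<omega> * real n = t"
        using \<omega> by (simp_all add: algebra_simps t_def)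
      have "norm (f z) \<le> norm (f (z - \<omega>))" using up[of "z - \<omega>"] 1 a by simp
      also have "\<dots> \<le> M"
        using Suc.prems 1 \<omega> Y t(1) by (intro Suc.IH) (simp add: algebra_simps abs_le_iff t(2))
      finally show ?thesis .
    next
      case 2
      define t where "t = Im \<omega> * real n"
      have a: "of_nat (Suc n) * Im \<omega> \<ge> Im \<omega>" and t: "t \<ge> 0" "Im \<omega> * real n = t"
        using \<omega> by (simp_all add: algebra_simps t_def)
      have "norm (f z) \<le> norm (f (z + \<omega>))" using down[of z] 2 a \<omega> by simp
      also have "\<dots> \<le> M"
        using Suc.prems 2 \<omega> Y t(1) by (intro Suc.IH) (simp add: algebra_simps abs_le_iff t(2))
      finally show ?thesis .
    qed (use Suc.IH in blast)
  qed
  have "norm (f z) \<le> M" for z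
  proof -
    obtain n :: nat where "\<bar>Im z\<bar> / Im \<omega> \<le> real n" using real_arch_simple by blast
    hence "\<bar>Im z\<bar> \<le> Y + of_nat (Suc n) * Im \<omega>" using \<omega> Y by (simp add: field_simps)
    thus ?thesis by (rule *)
  qed
  thus ?thesis by blast
qed

text \<open>The multiplier has modulus at most 1 for Im w \<ge> |a|/b and at least 1 for Im w \<le>
  -|a|/b, which bounds the extension of \<open>f\<close>. The case a = b = 0 is that of elliptic
  functions; b = 2 pi occurs for the inversion formula.\<close>

lemma quasi_periodic_constant:
  fixes f :: "complex \<Rightarrow> complex"
  assumes pol: "\<And>z. polar f z 0"
    and per: "\<And>z. \<forall>\<^sub>F w in at z. norm (f (w + 1)) = norm (f w)"
    and \<omega>: "Im \<omega> > 0" and b: "b \<ge> 0" "b = 0 \<Longrightarrow> a = 0"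
    and quasi: "\<And>z. \<forall>\<^sub>F w in at z. norm (f (w + \<omega>)) = exp (a - b * Im w) * norm (f w)"
  obtains C where "\<And>z. isCont f z \<Longrightarrow> f z = C" "\<And>z. \<forall>\<^sub>F w in at z. f w = C"
proof -
  obtain F where F: "F holomorphic_on UNIV" "\<And>z. isCont f z \<Longrightarrow> F z = f z"
    "\<And>z. \<forall>\<^sub>F w in at z. F w = f w"
    using entire_extension[OF pol] by blast
  have cont: "isCont F z" for z
    using holomorphic_on_imp_continuous_on[OF F(1)] by (simp add: continuous_on_eq_continuous_at)
  have cont': "isCont (\<lambda>w. F (w + u)) z" for z u
    by (rule isCont_o2[OF _ cont]) auto
  have cIm: "isCont Im z" for z
    by (rule bounded_linear.isCont[OF bounded_linear_Im]) auto
  have per': "norm (F (z + 1)) = norm (F z)" for z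
  proof (rule eq_of_eventually_eq[where F = "\<lambda>w. norm (F (w + 1))" and G = "\<lambda>w. norm (F w)"])
    show "\<forall>\<^sub>F w in at z. norm (F (w + 1)) = norm (F w)"
      using F(3)[of z] eventually_at_shift[OF F(3)[of "z + 1"]] per[of z]
      by eventually_elim simp
  qed (intro continuous_intros cont cont' cIm)+
  have quasi': "norm (F (z + \<omega>)) = exp (a - b * Im z) * norm (F z)" for z
  proof (rule eq_of_eventually_eq[where F = "\<lambda>w. norm (F (w + \<omega>))" and G = "\<lambda>w. exp (a - b * Im w) * norm (F w)"])
    show "\<forall>\<^sub>F w in at z. norm (F (w + \<omega>)) = exp (a - b * Im w) * norm (F w)"
      using F(3)[of z] eventually_at_shift[OF F(3)[of "z + \<omega>"]] quasi[of z]
      by eventually_elim simp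
  qed (intro continuous_intros cont cont' cIm)+
  \<comment> \<open>For b = 0 the division gives Y = 0, which is right: then a = 0 and the
    multiplier has modulus 1 everywhere.\<close>
  define Y where "Y = \<bar>a\<bar> / b"
  have Y: "Y \<ge> 0" using b by (simp add: Y_def)
  have "\<exists>M. \<forall>z. norm (F z) \<le> M"
  proof (rule bounded_of_quasi_periodic[OF F(1) per' \<omega> Y])
    fix z :: complex assume "Im z \<ge> Y"
    hence "a - b * Im z \<le> 0" using b by (cases "b = 0") (auto simp: Y_def field_simps)
    hence "exp (a - b * Im z) \<le> 1" by simp
    thus "norm (F (z + \<omega>)) \<le> norm (F z)"
      unfolding quasi' by (intro mult_left_le_one_le) auto
  next
    fix z :: complex assume "Im z \<le> - Y"
    hence "a - b * Im z \<ge> 0" using b by (cases "b = 0") (auto simp: Y_def field_simps)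
    hence "exp (a - b * Im z) \<ge> 1" by simp
    thus "norm (F z) \<le> norm (F (z + \<omega>))"
      unfolding quasi' by (simp add: mult_le_cancel_right1)
  qed
  hence "bounded (range F)" by (auto simp: bounded_iff)
  then obtain C where C: "\<And>z. F z = C"
    using Liouville_theorem[OF F(1)] unfolding constant_on_def by blast
  show ?thesis
  proof (rule that[of C])
    show "f z = C" if "isCont f z" for z using F(2)[OF that] C by simp
    show "\<forall>\<^sub>F w in at z. f w = C" for z using F(3)[of z] by eventually_elim (simp add: C)
  qed
qed

subsection \<open>Appell sums\<close>

text \<open>At a pole the offending term is \<open>x / 0 = 0\<close>; this is why the functional equation in \<open>\<tau>\<close> below needs the
  denominators to be nonzero, while periodicity does not.\<close>

definition appell :: "(int \<Rightarrow> complex) \<Rightarrow> complex \<Rightarrow> complex \<Rightarrow> complex" where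
  "appell c \<tau> z = (\<Sum>\<^sub>\<infinity>m. c m / (1 - expi (z + of_int m * \<tau>)))"

lemma expi_eq_1_unique:
  assumes "Im \<tau> > 0" "expi (z + of_int k * \<tau>) = 1" "expi (z + of_int m * \<tau>) = 1"
  shows "m = k"
proof -
  obtain a b :: int where "z + of_int k * \<tau> = of_int a" "z + of_int m * \<tau> = of_int b"
    using assms unfolding expi_eq_1_iff Ints_def by auto
  hence "Im z + of_int k * Im \<tau> = 0" "Im z + of_int m * Im \<tau> = 0"
    by (simp_all add: complex_eq_iff)
  hence "of_int k * Im \<tau> = of_int m * Im \<tau>" by linarith
  thus ?thesis using assms(1) by simp
qed

lemma exceptional_index:
  assumes "Im \<tau> > 0"
  obtains k where "\<And>m. m \<noteq> k \<Longrightarrow> expi (z + of_int m * \<tau>) \<noteq> 1"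
  using expi_eq_1_unique[OF assms, of z] by metis

text \<open>Once |Im (z + m\<tau>)| \<ge> 1, the exponential has modulus at most 1/2 or at least 2.
  Only finitely many indices remain, and continuity at \<open>z0\<close> handles them.\<close>

lemma denominators_bounded_below:
  assumes \<tau>: "Im \<tau> > 0" and k: "\<And>m. m \<noteq> k \<Longrightarrow> expi (z0 + of_int m * \<tau>) \<noteq> 1"
  obtains r \<delta> where "r > 0" "\<delta> > 0"
    "\<And>z m. z \<in> ball z0 r \<Longrightarrow> m \<noteq> k \<Longrightarrow> norm (1 - expi (z + of_int m * \<tau>)) \<ge> \<delta>"
proof -
  \<comment> \<open>The 2 pays for the radius 1 of the ball around \<open>z0\<close> and for the
    margin |Im (z + m\<tau>)| \<ge> 1.\<close>
  define L where "L = (\<bar>Im z0\<bar> + 2) / Im \<tau>"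
  have far: "norm (1 - expi (z + of_int m * \<tau>)) \<ge> 1/2" if z: "z \<in> ball z0 1" and m: "\<bar>real_of_int m\<bar> > L" for z m
  proof -
    have "\<bar>Im z - Im z0\<bar> \<le> 1"
      using z abs_Im_le_cmod[of "z - z0"] by (simp add: dist_norm norm_minus_commute)
    moreover have "\<bar>Im z0\<bar> + 2 < \<bar>real_of_int m\<bar> * Im \<tau>" using m \<tau> by (simp add: L_def field_simps)
    hence "\<bar>Im z0\<bar> + 2 < \<bar>real_of_int m * Im \<tau>\<bar>" using \<tau> by (simp add: abs_mult)
    ultimately have 1: "\<bar>Im z + of_int m * Im \<tau>\<bar> \<ge> 1" by linarith
    have e1: "exp (1::real) \<ge> 2" using exp_ge_add_one_self[of 1] by simp
    have pi1: "2 * pi \<ge> 1" using pi_gt3 by linarith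
    show ?thesis
    proof (cases "Im z + of_int m * Im \<tau> \<ge> 0")
      case True
      hence "2 * pi * (Im z + of_int m * Im \<tau>) \<ge> 1 * 1" using 1 pi1 by (intro mult_mono) auto
      hence "norm (expi (z + of_int m * \<tau>)) \<le> exp (- 1)" by (simp add: norm_expi)
      also have "\<dots> \<le> 1/2" using e1 by (simp add: exp_minus field_simps)
      finally show ?thesis using norm_triangle_ineq2[of 1 "expi (z + of_int m * \<tau>)"] by simp
    next
      case False
      hence "2 * pi * - (Im z + of_int m * Im \<tau>) \<ge> 1 * 1" using 1 pi1 by (intro mult_mono) auto
      hence "- (2 * pi * (Im z + of_int m * Im \<tau>)) \<ge> 1" by (simp only: mult_minus_right mult_1)
      hence "norm (expi (z + of_int m * \<tau>)) \<ge> exp 1" by (simp add: norm_expi)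
      hence "norm (expi (z + of_int m * \<tau>)) \<ge> 2" using e1 by simp
      thus ?thesis using norm_triangle_ineq3[of 1 "expi (z + of_int m * \<tau>)"] by simp
    qed
  qed
  define M where "M = {m. m \<noteq> k \<and> \<bar>real_of_int m\<bar> \<le> L}"
  have "M \<subseteq> {\<lfloor>- L\<rfloor>..\<lceil>L\<rceil>}" by (auto simp: M_def) linarith+
  hence fin: "finite M" using finite_subset by blast
  define f where "f = (\<lambda>m z. norm (1 - expi (z + of_int m * \<tau>)))"
  have f0: "f m z0 > 0" if "m \<in> M" for m using k[of m] that by (auto simp: f_def M_def)
  have "\<forall>\<^sub>F z in nhds z0. \<forall>m\<in>M. f m z > f m z0 / 2"
  proof (intro eventually_ball_finite fin ballI)
    fix m assume m: "m \<in> M"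
    have "continuous_on UNIV (f m)" unfolding f_def by (intro continuous_intros)
    hence "(f m \<longlongrightarrow> f m z0) (nhds z0)"
      by (simp add: continuous_on_eq_continuous_at isCont_def tendsto_at_iff_tendsto_nhds)
    thus "\<forall>\<^sub>F z in nhds z0. f m z > f m z0 / 2" by (rule order_tendstoD) (use f0[OF m] in simp)
  qed
  then obtain r where r: "r > 0" "\<And>z m. dist z z0 < r \<Longrightarrow> m \<in> M \<Longrightarrow> f m z > f m z0 / 2"
    unfolding eventually_nhds_metric by blast
  define \<delta> where "\<delta> = Min (insert (1/2) ((\<lambda>m. f m z0 / 2) ` M))"
  show ?thesis
  proof (rule that[of "min r 1" \<delta>])
    show "\<delta> > 0" using fin f0 by (auto simp: \<delta>_def)
    fix z m assume z: "z \<in> ball z0 (min r 1)" and m: "m \<noteq> k"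
    show "norm (1 - expi (z + of_int m * \<tau>)) \<ge> \<delta>"
    proof (cases "m \<in> M")
      case True
      hence "\<delta> \<le> f m z0 / 2" unfolding \<delta>_def using fin by (intro Min_le) auto
      also have "\<dots> \<le> f m z" using r(2)[of z m] True z by (simp add: dist_commute)
      finally show ?thesis by (simp add: f_def)
    next
      case False
      hence "norm (1 - expi (z + of_int m * \<tau>)) \<ge> 1/2" using m z by (intro far) (auto simp: M_def)
      moreover have "\<delta> \<le> 1/2" unfolding \<delta>_def using fin by (intro Min_le) auto
      ultimately show ?thesis by simp
    qed
  qed (use r in auto)
qed

text \<open>Valid at poles too: the one exceptional index contributes a single finite value, 0 at a
  pole. Hence the Appell series converges absolutely at every point.\<close>

lemma appell_bound:
  assumes "Im \<tau> > 0"
  obtains K where "\<And>m. norm (inverse (1 - expi (z + of_int m * \<tau>))) \<le> K"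
proof -
  obtain k where k: "\<And>m. m \<noteq> k \<Longrightarrow> expi (z + of_int m * \<tau>) \<noteq> 1" using exceptional_index[OF assms] by blast
  obtain r \<delta> where r: "r > 0" "\<delta> > 0"
    "\<And>w m. w \<in> ball z r \<Longrightarrow> m \<noteq> k \<Longrightarrow> norm (1 - expi (w + of_int m * \<tau>)) \<ge> \<delta>"
    using denominators_bounded_below[OF assms k] by blast
  show ?thesis
  proof (rule that)
    fix m
    show "norm (inverse (1 - expi (z + of_int m * \<tau>))) \<le> max (inverse \<delta>) (norm (inverse (1 - expi (z + of_int k * \<tau>))))"
    proof (cases "m = k")
      case False
      have "norm (inverse (1 - expi (z + of_int m * \<tau>))) \<le> inverse \<delta>"
        unfolding norm_inverse using r(1) by (intro le_imp_inverse_le r(2) r(3) False) auto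
      thus ?thesis by simp
    qed auto
  qed
qed

lemma appell_abs_summable:
  assumes "Im \<tau> > 0" "rapid c"
  shows "(\<lambda>m. norm (c m / (1 - expi (z + of_int m * \<tau>)))) summable_on UNIV"
proof -
  obtain K where K: "\<And>m. norm (inverse (1 - expi (z + of_int m * \<tau>))) \<le> K"
    using appell_bound[OF assms(1)] by blast
  show ?thesis
    by (rule rapid_summable_dominated[OF assms(2), of _ K])
      (use mult_left_mono[OF K] in \<open>simp add: norm_mult divide_inverse del: norm_inverse\<close>)
qed

lemma appell_has_sum:
  assumes "Im \<tau> > 0" "rapid c"
  shows "((\<lambda>m. c m / (1 - expi (z + of_int m * \<tau>))) has_sum appell c \<tau> z) UNIV"
  unfolding appell_def
  by (rule has_sum_infsum[OF abs_summable_summable[OF appell_abs_summable[OF assms]]])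

lemma rapid_upd: "rapid c \<Longrightarrow> rapid (c(k := 0))"
  unfolding rapid_def
proof
  fix t :: real assume "\<forall>t. (\<lambda>m. norm (c m) * exp (t * of_int m)) summable_on UNIV"
  hence "(\<lambda>m. norm (c m) * exp (t * of_int m)) summable_on UNIV" by blast
  thus "(\<lambda>m. norm ((c(k := 0)) m) * exp (t * of_int m)) summable_on UNIV"
    by (rule summable_on_comparison_test) auto
qed

lemma appell_split:
  assumes "Im \<tau> > 0" "rapid c"
  shows "appell c \<tau> z = c k / (1 - expi (z + of_int k * \<tau>)) + appell (c(k := 0)) \<tau> z"
proof -
  have "((\<lambda>m. if m = k then c k / (1 - expi (z + of_int k * \<tau>)) else 0) has_sum c k / (1 - expi (z + of_int k * \<tau>))) UNIV"
    by (rule has_sum_finite_neutralI[of "{k}"]) auto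
  from has_sum_add[OF this appell_has_sum[OF assms(1) rapid_upd[OF assms(2)]]]
  have "((\<lambda>m. c m / (1 - expi (z + of_int m * \<tau>))) has_sum (c k / (1 - expi (z + of_int k * \<tau>)) + appell (c(k := 0)) \<tau> z)) UNIV"
    by (rule has_sum_cong[THEN iffD1, rotated]) auto
  with appell_has_sum[OF assms] show ?thesis by (rule has_sum_unique)
qed

text \<open>Setting the coefficient at \<open>k\<close> to 0 removes the only term that can be
  singular near \<open>z0\<close>; the others have denominators bounded away from 0 and converge
  uniformly.\<close>

lemma appell_upd_analytic:
  assumes \<tau>: "Im \<tau> > 0" and c: "rapid c" and k: "\<And>m. m \<noteq> k \<Longrightarrow> expi (z0 + of_int m * \<tau>) \<noteq> 1"
  shows "appell (c(k := 0)) \<tau> analytic_on {z0}"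
proof -
  obtain r \<delta> where r: "r > 0" "\<delta> > 0"
    "\<And>z m. z \<in> ball z0 r \<Longrightarrow> m \<noteq> k \<Longrightarrow> norm (1 - expi (z + of_int m * \<tau>)) \<ge> \<delta>"
    using denominators_bounded_below[OF \<tau> k] by blast
  define f where "f = (\<lambda>m z. (c(k := 0)) m / (1 - expi (z + of_int m * \<tau>)))"
  have hol: "f m holomorphic_on ball z0 r" for m
  proof (cases "m = k")
    case False
    have "1 - expi (z + of_int m * \<tau>) \<noteq> 0" if "z \<in> ball z0 r" for z
      using r(3)[OF that False] r(2) by auto
    thus ?thesis unfolding f_def by (intro holomorphic_intros) auto
  qed (simp add: f_def)
  have sub: "cball z0 (r/2) \<subseteq> ball z0 r" using r(1) by auto
  have "norm (f m z) \<le> norm (c m) * inverse \<delta>" if "z \<in> cball z0 (r/2)" for m z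
  proof (cases "m = k")
    case False
    have "norm (inverse (1 - expi (z + of_int m * \<tau>))) \<le> inverse \<delta>"
      unfolding norm_inverse using sub that by (intro le_imp_inverse_le r(2) r(3) False) auto
    from mult_left_mono[OF this, of "norm (c m)"] False show ?thesis
      by (simp add: f_def norm_mult divide_inverse del: norm_inverse)
  qed (use r in \<open>simp add: f_def\<close>)
  moreover have "(\<lambda>m. norm (c m) * inverse \<delta>) summable_on UNIV"
    by (intro summable_on_cmult_left rapid_abs_summable c)
  ultimately have "uniform_limit (cball z0 (r/2)) (\<lambda>X z. \<Sum>m\<in>X. f m z) (\<lambda>z. \<Sum>\<^sub>\<infinity>m. f m z) (finite_subsets_at_top UNIV)"
    by (rule Weierstrass_m_test_general)
  hence "uniform_limit (cball z0 (r/2)) (\<lambda>X z. \<Sum>m\<in>X. f m z) (appell (c(k := 0)) \<tau>) (finite_subsets_at_top UNIV)"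
    by (simp add: f_def appell_def[abs_def])
  note lim = this
  have *: "continuous_on (cball z0 (r/2)) (\<lambda>z. \<Sum>m\<in>X. f m z) \<and> (\<lambda>z. \<Sum>m\<in>X. f m z) holomorphic_on ball z0 (r/2)" for X
  proof -
    have h: "(\<lambda>z. \<Sum>m\<in>X. f m z) holomorphic_on ball z0 r" by (intro holomorphic_intros hol)
    have "ball z0 (r/2) \<subseteq> ball z0 r" using r(1) by auto
    from holomorphic_on_subset[OF h this] holomorphic_on_imp_continuous_on[OF holomorphic_on_subset[OF h sub]]
    show ?thesis by blast
  qed
  have "appell (c(k := 0)) \<tau> holomorphic_on ball z0 (r/2)"
    by (rule holomorphic_uniform_limit[OF always_eventually[OF allI[OF *]] lim]) simp_all
  thus ?thesis using r(1) by (auto simp: analytic_at intro!: exI[of _ "ball z0 (r/2)"])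
qed

lemma appell_analytic:
  assumes \<tau>: "Im \<tau> > 0" and c: "rapid c" and z0: "\<And>m. expi (z0 + of_int m * \<tau>) \<noteq> 1"
  shows "appell c \<tau> analytic_on {z0}"
proof -
  have "(\<lambda>z. c 0 / (1 - expi (z + of_int 0 * \<tau>)) + appell (c(0 := 0)) \<tau> z) analytic_on {z0}"
    using z0[of 0] by (intro analytic_intros appell_upd_analytic assms) auto
  thus ?thesis using appell_split[OF \<tau> c, of _ 0] by presburger
qed

lemma polar_inverse_expi:
  assumes "expi (z0 + a) = 1"
  shows "polar (\<lambda>z. 1 / (1 - expi (z + a))) z0 (- 1 / (2 * pi * \<i>))"
proof -
  \<comment> \<open>The difference quotient of e(z + a) with its value at \<open>z0\<close> filled
    in. That value is 2 pi i, so -1/G is an analytic numerator.\<close>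
  define G where "G = (\<lambda>z. if z = z0 then deriv (\<lambda>z. expi (z + a)) z0 else (expi (z + a) - expi (z0 + a)) / (z - z0))"
  have "G holomorphic_on UNIV" unfolding G_def
    by (intro pole_lemma_open holomorphic_intros) auto
  hence G: "G analytic_on {z0}" by (auto simp: analytic_at)
  have "((\<lambda>z. expi (z + a)) has_field_derivative (2 * pi * \<i> * expi (z0 + a))) (at z0)"
    unfolding expi_def by (auto intro!: derivative_eq_intros)
  hence "G z0 = 2 * pi * \<i>" by (simp add: G_def DERIV_imp_deriv assms)
  moreover have "1 / (1 - expi (z + a)) = (- 1 / G z) / (z - z0)" if "z \<noteq> z0" for z
    using that by (simp add: G_def assms divide_simps) (simp add: algebra_simps)
  ultimately show ?thesis unfolding polar_def
    by (intro exI[of _ "\<lambda>z. - 1 / G z"]) (auto intro!: analytic_intros G simp: eventually_at_filter)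
qed

lemma appell_polar:
  assumes \<tau>: "Im \<tau> > 0" and c: "rapid c" and z0: "expi (z0 + of_int k * \<tau>) = 1"
  shows "polar (appell c \<tau>) z0 (- c k / (2 * pi * \<i>))"
proof -
  have k: "expi (z0 + of_int m * \<tau>) \<noteq> 1" if "m \<noteq> k" for m
    using expi_eq_1_unique[OF \<tau> z0, of m] that by blast
  have "polar (\<lambda>z. c k * (1 / (1 - expi (z + of_int k * \<tau>))) + appell (c(k := 0)) \<tau> z) z0
     (c k * (- 1 / (2 * pi * \<i>)) + 0)"
    by (intro polar_add polar_mult[where g = "\<lambda>_. c k"] polar_inverse_expi z0 polar_analytic
        appell_upd_analytic assms k analytic_intros)
  moreover have "appell c \<tau> = (\<lambda>z. c k * (1 / (1 - expi (z + of_int k * \<tau>))) + appell (c(k := 0)) \<tau> z)"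
    using appell_split[OF \<tau> c, of _ k] by auto
  ultimately show ?thesis by simp
qed

lemma appell_regular_near:
  assumes "Im \<tau> > 0"
  shows "\<forall>\<^sub>F z in at z0. \<forall>m. expi (z + of_int m * \<tau>) \<noteq> 1"
proof -
  obtain k where k: "\<And>m. m \<noteq> k \<Longrightarrow> expi (z0 + of_int m * \<tau>) \<noteq> 1"
    using exceptional_index[OF assms] by blast
  obtain r \<delta> where r: "r > 0" "\<delta> > 0"
    "\<And>z m. z \<in> ball z0 r \<Longrightarrow> m \<noteq> k \<Longrightarrow> norm (1 - expi (z + of_int m * \<tau>)) \<ge> \<delta>"
    using denominators_bounded_below[OF assms k] by blast
  have "\<forall>\<^sub>F z in at z0. z \<in> ball z0 r - {z0}" using r(1) by (intro eventually_at_in_open) auto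
  moreover have "\<forall>\<^sub>F z in at z0. expi (z + of_int k * \<tau>) \<noteq> 1"
  proof -
    define f where "f = (\<lambda>z. expi (z + of_int k * \<tau>) - 1)"
    \<comment> \<open>At this point the exponential is -1, so \<open>f\<close> is not identically
      zero and its zeros are isolated.\<close>
    have "f (1/2 - of_int k * \<tau>) \<noteq> 0" by (simp add: f_def expi_half)
    moreover have "f holomorphic_on UNIV" unfolding f_def by (intro holomorphic_intros)
    ultimately have "\<forall>\<^sub>F z in at z0. f z \<noteq> 0"
      by (intro non_zero_neighbour_alt[of f UNIV z0 "1/2 - of_int k * \<tau>", THEN eventually_mono]) auto
    thus ?thesis by (simp add: f_def)
  qed
  ultimately show ?thesis
  proof eventually_elim
    case (elim z)
    show ?case
    proof
      fix m show "expi (z + of_int m * \<tau>) \<noteq> 1"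
        using elim r(2) r(3)[of z m] by (cases "m = k") auto
    qed
  qed
qed

lemma appell_add_1: "appell c \<tau> (z + 1) = appell c \<tau> z"
proof -
  have "expi (z + 1 + of_int m * \<tau>) = expi (z + of_int m * \<tau>)" for m
    by (rule expi_eqI) simp
  thus ?thesis by (simp add: appell_def)
qed

text \<open>Reindexing by N absorbs the shift of z in the denominators. Then 1/(1 - x) = 1 + x/(1 -
  x) with x = e(z + m\<tau>) splits off the sum of all coefficients, and the recursion turns
  \<open>c (m - N)\<close> times x into e(z) \<open>c m\<close> divided by \<kappa>.\<close>

lemma appell_quasi_periodic:
  assumes \<tau>: "Im \<tau> > 0" and c: "rapid c" and z: "\<And>m. expi (z + of_int m * \<tau>) \<noteq> 1"
    and \<kappa>: "\<kappa> \<noteq> 0" "\<And>m. c (m + N) = \<kappa> * expi (of_int (m + N) * \<tau>) * c m"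
  shows "appell c \<tau> (z + of_int N * \<tau>) = (\<Sum>\<^sub>\<infinity>m. c m) + inverse \<kappa> * expi z * appell c \<tau> z"
proof -
  have bij: "bij_betw (\<lambda>m. m - N) UNIV UNIV"
    by (rule bij_betwI[of _ _ _ "\<lambda>m. m + N"]) auto
  have "((\<lambda>m. c (m - N) / (1 - expi (z + of_int N * \<tau> + of_int (m - N) * \<tau>))) has_sum appell c \<tau> (z + of_int N * \<tau>)) UNIV"
    using has_sum_reindex_bij_betw[OF bij, of "\<lambda>m. c m / (1 - expi (z + of_int N * \<tau> + of_int m * \<tau>))"]
      appell_has_sum[OF \<tau> c] by simp
  moreover have "c (m - N) / (1 - expi (z + of_int N * \<tau> + of_int (m - N) * \<tau>))
      = c (m - N) + inverse \<kappa> * expi z * (c m / (1 - expi (z + of_int m * \<tau>)))" for m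
  proof -
    have 1: "expi (z + of_int N * \<tau> + of_int (m - N) * \<tau>) = expi (z + of_int m * \<tau>)"
      by (simp add: algebra_simps)
    have 2: "inverse \<kappa> * expi z * c m = c (m - N) * expi (z + of_int m * \<tau>)"
      using \<kappa>(2)[of "m - N"] \<kappa>(1) by (simp add: expi_add)
    have "1 - expi (z + of_int m * \<tau>) \<noteq> 0" using z[of m] by simp
    hence "c (m - N) / (1 - expi (z + of_int m * \<tau>)) = c (m - N) + c (m - N) * expi (z + of_int m * \<tau>) / (1 - expi (z + of_int m * \<tau>))"
      by (simp add: divide_simps) (simp add: algebra_simps)
    thus ?thesis unfolding 1 2[symmetric] by simp
  qed
  ultimately have A: "((\<lambda>m. c (m - N) + inverse \<kappa> * expi z * (c m / (1 - expi (z + of_int m * \<tau>)))) has_sum appell c \<tau> (z + of_int N * \<tau>)) UNIV"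
    by simp
  have "(c has_sum (\<Sum>\<^sub>\<infinity>m. c m)) UNIV"
    by (rule has_sum_infsum[OF abs_summable_summable[OF rapid_abs_summable[OF c]]])
  hence "((\<lambda>m. c (m - N)) has_sum (\<Sum>\<^sub>\<infinity>m. c m)) UNIV"
    using has_sum_reindex_bij_betw[OF bij, of c] by simp
  from has_sum_add[OF this has_sum_cmult_right[OF appell_has_sum[OF \<tau> c], of "inverse \<kappa> * expi z"]]
  show ?thesis using A has_sum_unique by blast
qed

subsection \<open>Complex Gaussian integrals\<close>

lemma continuous_dominated_integrable:
  fixes f :: "real \<Rightarrow> complex"
  assumes "continuous_on UNIV f" "g integrable_on UNIV" "\<And>x. norm (f x) \<le> g x"
  shows "f integrable_on UNIV"
  by (rule integrable_on_all_intervals_integrable_bound[of UNIV f g])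
     (use assms in \<open>auto intro!: integrable_continuous_interval continuous_on_subset[OF assms(1)]\<close>)

text \<open>Dominated convergence for the truncated integrand. General endpoints are allowed because
  unfolding produces the asymmetric intervals [-n, n + 1].\<close>

lemma integral_UNIV_limit:
  fixes f :: "real \<Rightarrow> 'a::euclidean_space"
  assumes f: "f integrable_on UNIV" and g: "g integrable_on UNIV" "\<And>x. norm (f x) \<le> g x"
    and lim: "filterlim a at_bot sequentially" "filterlim b at_top sequentially"
  shows "(\<lambda>n. integral {a n..b n} f) \<longlonglongrightarrow> integral UNIV f"
proof -
  have "(\<lambda>n. integral UNIV (\<lambda>x. if x \<in> {a n..b n} then f x else 0)) \<longlonglongrightarrow> integral UNIV f"
  proof (rule dominated_convergence(2)[OF _ g(1)])
    show "(\<lambda>x. if x \<in> {a n..b n} then f x else 0) integrable_on UNIV" for n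
      unfolding integrable_restrict_UNIV by (rule integrable_on_subinterval[OF f, of "a n" "b n"]) simp
    show "norm (if x \<in> {a n..b n} then f x else 0) \<le> g x" for n x
      using g(2)[of x] norm_ge_zero[of "f x"] by (auto simp del: norm_ge_zero)
    show "(\<lambda>n. if x \<in> {a n..b n} then f x else 0) \<longlonglongrightarrow> f x" for x
    proof (rule tendsto_eventually)
      have "\<forall>\<^sub>F n in sequentially. a n \<le> x" "\<forall>\<^sub>F n in sequentially. x \<le> b n"
        using lim by (auto simp: filterlim_at_bot filterlim_at_top)
      thus "\<forall>\<^sub>F n in sequentially. (if x \<in> {a n..b n} then f x else 0) = f x"
        by eventually_elim auto
    qed
  qed
  thus ?thesis unfolding integral_restrict_UNIV .
qed

lemma integral_UNIV_limit_symmetric: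
  fixes f :: "real \<Rightarrow> 'a::euclidean_space"
  assumes "f integrable_on UNIV" "g integrable_on UNIV" "\<And>x. norm (f x) \<le> g x"
  shows "(\<lambda>n. integral {- real n..real n} f) \<longlonglongrightarrow> integral UNIV f"
  by (rule integral_UNIV_limit[OF assms])
     (auto intro: filterlim_real_sequentially simp: filterlim_uminus_at_bot)

text \<open>Truncated integrals are holomorphic by the Leibniz rule, and they differ from the full
  integral by at most a tail of the integral of \<open>g\<close>, uniformly on the disc. Only the
  integrand is dominated; its derivative enters through compact intervals.\<close>

lemma holomorphic_integral_UNIV:
  fixes f :: "complex \<Rightarrow> real \<Rightarrow> complex"
  assumes deriv: "\<And>z x. z \<in> S \<Longrightarrow> ((\<lambda>z. f z x) has_field_derivative f' z x) (at z)"
    and cont: "continuous_on (S \<times> UNIV) (\<lambda>(z, x). f' z x)"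
    and cont0: "\<And>z. z \<in> S \<Longrightarrow> continuous_on UNIV (f z)"
    and dom: "\<And>z. z \<in> S \<Longrightarrow> \<exists>r>0. \<exists>g. cball z r \<subseteq> S \<and> g integrable_on UNIV \<and> (\<forall>w\<in>cball z r. \<forall>x. norm (f w x) \<le> g x)"
  shows "(\<lambda>z. integral UNIV (f z)) holomorphic_on S"
proof -
  have "(\<lambda>z. integral UNIV (f z)) analytic_on {z0}" if z0: "z0 \<in> S" for z0
  proof -
    obtain r g where r: "r > 0" "cball z0 r \<subseteq> S" "g integrable_on UNIV"
      "\<And>w x. w \<in> cball z0 r \<Longrightarrow> norm (f w x) \<le> g x" using dom[OF z0] by blast
    have g0: "g x \<ge> 0" for x using r(4)[of z0 x] r(1) norm_ge_zero[of "f z0 x"] by (simp del: norm_ge_zero)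
    define F where "F = (\<lambda>n z. integral {- real n..real n} (f z))"
    have hol: "F n holomorphic_on cball z0 r" for n
      unfolding F_def cbox_interval[symmetric]
    proof (rule leibniz_rule_holomorphic)
      show "((\<lambda>z. f z x) has_field_derivative f' z x) (at z within cball z0 r)" if "z \<in> cball z0 r" for z x
        by (rule has_field_derivative_at_within[OF deriv]) (use that r(2) in blast)
      show "f z integrable_on cbox (- real n) (real n)" if "z \<in> cball z0 r" for z
        by (rule integrable_continuous[OF continuous_on_subset[OF cont0]]) (use that r(2) in auto)
      show "continuous_on (cball z0 r \<times> cbox (- real n) (real n)) (\<lambda>(z, x). f' z x)"
        using r(2) by (intro continuous_on_subset[OF cont]) auto
    qed auto
    have bd: "norm (F n z - integral UNIV (f z)) \<le> integral UNIV g - integral {- real n..real n} g"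
      if z: "z \<in> cball z0 r" for n z
    proof -
      have fi: "f z integrable_on UNIV"
        by (rule continuous_dominated_integrable[OF cont0 r(3) r(4)]) (use z r(2) in auto)
      let ?I = "{- real n..real n}"
      have i1: "(\<lambda>x. if x \<in> ?I then f z x else 0) integrable_on UNIV"
        unfolding integrable_restrict_UNIV by (rule integrable_on_subinterval[OF fi, of "- real n" "real n"]) simp
      have i2: "(\<lambda>x. if x \<in> ?I then g x else 0) integrable_on UNIV"
        unfolding integrable_restrict_UNIV by (rule integrable_on_subinterval[OF r(3), of "- real n" "real n"]) simp
      have "norm (integral UNIV (\<lambda>x. f z x - (if x \<in> ?I then f z x else 0))) \<le> integral UNIV (\<lambda>x. g x - (if x \<in> ?I then g x else 0))"
        by (intro integral_norm_bound_integral integrable_diff fi r(3) i1 i2) (use r(4)[OF z] in auto)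
      also have "integral UNIV (\<lambda>x. f z x - (if x \<in> ?I then f z x else 0)) = integral UNIV (f z) - F n z"
        by (subst integral_diff[OF fi i1]) (simp only: integral_restrict_UNIV F_def)
      also have "integral UNIV (\<lambda>x. g x - (if x \<in> ?I then g x else 0)) = integral UNIV g - integral ?I g"
        by (subst integral_diff[OF r(3) i2]) (simp only: integral_restrict_UNIV)
      finally show ?thesis by (simp add: norm_minus_commute)
    qed
    have lim: "(\<lambda>n. integral {- real n..real n} g) \<longlonglongrightarrow> integral UNIV g"
      by (rule integral_UNIV_limit_symmetric[OF r(3) r(3)]) (use g0 in auto)
    have "uniform_limit (cball z0 r) F (\<lambda>z. integral UNIV (f z)) sequentially"
    proof (rule uniform_limitI)
      fix e :: real assume "e > 0"
      with lim have "\<forall>\<^sub>F n in sequentially. dist (integral {- real n..real n} g) (integral UNIV g) < e"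
        by (rule tendstoD)
      thus "\<forall>\<^sub>F n in sequentially. \<forall>z\<in>cball z0 r. dist (F n z) (integral UNIV (f z)) < e"
      proof eventually_elim
        case (elim n)
        thus ?case using bd[of _ n] by (force simp: dist_norm)
      qed
    qed
    note lim_F = this
    have "continuous_on (cball z0 r) (F n) \<and> F n holomorphic_on ball z0 r" for n
      using holomorphic_on_imp_continuous_on[OF hol] holomorphic_on_subset[OF hol ball_subset_cball] by blast
    note * = this
    have "(\<lambda>z. integral UNIV (f z)) holomorphic_on ball z0 r"
      by (rule holomorphic_uniform_limit[OF always_eventually[OF allI[OF *]] lim_F]) simp_all
    thus ?thesis using r(1) by (auto simp: analytic_at intro!: exI[of _ "ball z0 r"])
  qed
  hence "(\<lambda>z. integral UNIV (f z)) analytic_on S" using analytic_on_analytic_at by blast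
  thus ?thesis by (rule analytic_imp_holomorphic)
qed

text \<open>One family for two purposes: a = -i\<tau> gives the numerator of the Mordell integrand,
  a = iN/\<tau> the Gaussians produced by unfolding. Both have Re a > 0 for Im \<tau> > 0 and N >
  0.\<close>

definition gauss :: "complex \<Rightarrow> complex \<Rightarrow> real \<Rightarrow> complex" where
  "gauss a s x = exp (- complex_of_real pi * a * complex_of_real x ^ 2 + 2 * complex_of_real pi * s * complex_of_real x)"

lemma real_gaussian_integral:
  fixes \<alpha> \<sigma> :: real
  assumes "\<alpha> > 0"
  shows "((\<lambda>x. exp (- pi * \<alpha> * x ^ 2 + 2 * pi * \<sigma> * x)) has_integral exp (pi * \<sigma> ^ 2 / \<alpha>) / sqrt \<alpha>) UNIV"
proof -
  \<comment> \<open>The standard deviation: the integrand is a multiple of the normal density with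
    mean \<sigma>/\<alpha> and variance 1/(2 pi \<alpha>).\<close>
  define d where "d = 1 / sqrt (2 * pi * \<alpha>)"
  have d: "d > 0" "d ^ 2 = 1 / (2 * pi * \<alpha>)" using assms by (simp_all add: d_def power_divide)
  have "(normal_density (\<sigma> / \<alpha>) d has_integral 1) UNIV"
    using has_integral_integral_lborel[OF integrable_normal_density[OF d(1)], of "\<sigma> / \<alpha>"]
      integral_normal_density[OF d(1)] by simp
  from has_integral_mult_right[OF this, of "exp (pi * \<sigma> ^ 2 / \<alpha>) / sqrt \<alpha>"]
  have "((\<lambda>x. exp (pi * \<sigma> ^ 2 / \<alpha>) / sqrt \<alpha> * normal_density (\<sigma> / \<alpha>) d x) has_integral exp (pi * \<sigma> ^ 2 / \<alpha>) / sqrt \<alpha>) UNIV"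
    by simp
  moreover have "exp (pi * \<sigma> ^ 2 / \<alpha>) / sqrt \<alpha> * normal_density (\<sigma> / \<alpha>) d x = exp (- pi * \<alpha> * x ^ 2 + 2 * pi * \<sigma> * x)" for x
  proof -
    have "2 * pi * d\<^sup>2 = 1 / \<alpha>" using assms by (simp add: d(2))
    hence "normal_density (\<sigma> / \<alpha>) d x = sqrt \<alpha> * exp (- ((x - \<sigma> / \<alpha>)\<^sup>2) * (pi * \<alpha>))"
      using assms by (simp add: normal_density_def d(2) real_sqrt_divide)
    hence "exp (pi * \<sigma> ^ 2 / \<alpha>) / sqrt \<alpha> * normal_density (\<sigma> / \<alpha>) d x
        = exp (pi * \<sigma> ^ 2 / \<alpha> + - ((x - \<sigma> / \<alpha>)\<^sup>2) * (pi * \<alpha>))"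
      unfolding exp_add using assms by simp
    also have "pi * \<sigma> ^ 2 / \<alpha> + - ((x - \<sigma> / \<alpha>)\<^sup>2) * (pi * \<alpha>) = - pi * \<alpha> * x ^ 2 + 2 * pi * \<sigma> * x"
      using assms by (simp add: field_simps power2_eq_square)
    finally show ?thesis .
  qed
  ultimately show ?thesis by simp
qed

lemma norm_gauss: "norm (gauss a s x) = exp (- pi * Re a * x ^ 2 + 2 * pi * Re s * x)"
  by (simp add: gauss_def norm_exp_eq_Re power2_eq_square)

lemma continuous_gauss: "continuous_on A (gauss a s)"
  unfolding gauss_def by (intro continuous_intros)

text \<open>A majorant of exp(-pi \<alpha> x^2 + 2 pi \<sigma> |x|), written as a sum of two
  Gaussians so that its integrability is immediate.\<close>

definition gauss_bound :: "real \<Rightarrow> real \<Rightarrow> real \<Rightarrow> real" where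
  "gauss_bound \<alpha> \<sigma> x = exp (- pi * \<alpha> * x ^ 2 + 2 * pi * \<sigma> * x) + exp (- pi * \<alpha> * x ^ 2 + 2 * pi * (- \<sigma>) * x)"

lemma norm_gauss_le:
  assumes "Re a \<ge> \<alpha>" "\<bar>Re s\<bar> \<le> \<sigma>"
  shows "norm (gauss a s x) \<le> gauss_bound \<alpha> \<sigma> x"
proof -
  have "\<alpha> * x ^ 2 \<le> Re a * x ^ 2" by (intro mult_right_mono assms) auto
  hence 1: "- pi * Re a * x ^ 2 \<le> - pi * \<alpha> * x ^ 2" by (simp add: mult.assoc)
  have "Re s * x \<le> \<bar>Re s * x\<bar>" by simp
  also have "\<dots> \<le> \<sigma> * \<bar>x\<bar>" unfolding abs_mult by (intro mult_right_mono assms) auto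
  finally have 2: "2 * pi * Re s * x \<le> 2 * pi * (\<sigma> * \<bar>x\<bar>)" by (simp add: mult.assoc)
  have "norm (gauss a s x) \<le> exp (- pi * \<alpha> * x ^ 2 + 2 * pi * (\<sigma> * \<bar>x\<bar>))"
    unfolding norm_gauss exp_le_cancel_iff using 1 2 by linarith
  thus ?thesis unfolding gauss_bound_def by (cases "x \<ge> 0") (auto simp: mult.assoc intro: order_trans)
qed

lemma gauss_bound_integrable:
  fixes \<alpha> \<sigma> :: real
  assumes "\<alpha> > 0"
  shows "gauss_bound \<alpha> \<sigma> integrable_on UNIV"
  unfolding gauss_bound_def[abs_def] using real_gaussian_integral[OF assms] by (intro integrable_add) blast+

lemma gauss_norm_integrable: "Re a > 0 \<Longrightarrow> (\<lambda>x. norm (gauss a s x)) integrable_on UNIV"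
  unfolding norm_gauss using real_gaussian_integral by blast

lemma gauss_integral_holomorphic_s:
  assumes "Re a > 0"
  shows "(\<lambda>s. integral UNIV (gauss a s)) holomorphic_on UNIV"
proof (rule holomorphic_integral_UNIV[where f' = "\<lambda>s x. 2 * pi * of_real x * gauss a s x"])
  fix s :: complex
  show "\<exists>r>0. \<exists>g. cball s r \<subseteq> UNIV \<and> g integrable_on UNIV \<and> (\<forall>w\<in>cball s r. \<forall>x. norm (gauss a w x) \<le> g x)"
  proof (intro exI conjI)
    show "\<forall>w\<in>cball s 1. \<forall>x. norm (gauss a w x) \<le> gauss_bound (Re a) (\<bar>Re s\<bar> + 1) x"
    proof (intro ballI allI norm_gauss_le)
      fix w assume "w \<in> cball s 1"
      thus "\<bar>Re w\<bar> \<le> \<bar>Re s\<bar> + 1" using abs_Re_le_cmod[of "s - w"] by (simp add: dist_norm)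
    qed auto
    show "gauss_bound (Re a) (\<bar>Re s\<bar> + 1) integrable_on UNIV"
      by (rule gauss_bound_integrable[OF assms])
  qed auto
qed (auto simp: gauss_def case_prod_unfold intro!: derivative_eq_intros continuous_intros)

lemma gauss_integral_holomorphic_a:
  "(\<lambda>a. integral UNIV (gauss a s)) holomorphic_on {a. Re a > 0}"
proof (rule holomorphic_integral_UNIV[where f' = "\<lambda>a x. - pi * of_real x ^ 2 * gauss a s x"])
  fix a :: complex assume "a \<in> {a. Re a > 0}"
  hence a: "Re a > 0" by simp
  have *: "Re w \<ge> Re a / 2" if "w \<in> cball a (Re a / 2)" for w
    using that abs_Re_le_cmod[of "a - w"] by (simp add: dist_norm)
  show "\<exists>r>0. \<exists>g. cball a r \<subseteq> {a. Re a > 0} \<and> g integrable_on UNIV \<and> (\<forall>w\<in>cball a r. \<forall>x. norm (gauss w s x) \<le> g x)"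
  proof (intro exI conjI)
    show "\<forall>w\<in>cball a (Re a / 2). \<forall>x. norm (gauss w s x) \<le> gauss_bound (Re a / 2) (\<bar>Re s\<bar>) x"
      by (intro ballI allI norm_gauss_le *) auto
    show "gauss_bound (Re a / 2) (\<bar>Re s\<bar>) integrable_on UNIV"
      by (rule gauss_bound_integrable) (use a in simp)
    show "cball a (Re a / 2) \<subseteq> {a. Re a > 0}" using * a by force
  qed (use a in auto)
qed (auto simp: gauss_def case_prod_unfold intro!: derivative_eq_intros continuous_intros)

section \<open>The Gaussian integral by analytic continuation in both parameters\<close>

lemma islimpt_reals: "complex_of_real x islimpt complex_of_real ` {0<..}" if "x > 0"
proof -
  have "x islimpt {0<..}" using that by (intro interior_limit_point) (simp add: interior_open)
  then obtain f where f: "\<And>n. f n \<in> {0<..} - {x}" "f \<longlonglongrightarrow> x"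
    unfolding islimpt_sequential by blast
  have "(\<lambda>n. complex_of_real (f n)) \<longlonglongrightarrow> complex_of_real x" by (intro tendsto_of_real f)
  thus ?thesis unfolding islimpt_sequential
    using f(1) by (intro exI[of _ "\<lambda>n. complex_of_real (f n)"]) auto
qed

text \<open>Both sides are entire in \<open>s\<close> and agree for positive real
  \<open>s\<close>.\<close>

lemma gauss_integral_real:
  fixes s :: complex
  assumes "\<alpha> > 0"
  shows "integral UNIV (gauss (of_real \<alpha>) s) = exp (pi * s ^ 2 / of_real \<alpha>) / csqrt (of_real \<alpha>)"
proof -
  define D where "D = (\<lambda>s::complex. integral UNIV (gauss (of_real \<alpha>) s) - exp (pi * s ^ 2 / of_real \<alpha>) / csqrt (of_real \<alpha>))"
  have "D s = 0"
  proof (rule analytic_continuation[of D UNIV "complex_of_real ` {0<..}" "of_real 1"])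
    show "D holomorphic_on UNIV" unfolding D_def
      by (intro holomorphic_intros gauss_integral_holomorphic_s) (use assms in auto)
    fix z assume "z \<in> complex_of_real ` {0<..}"
    then obtain \<sigma> where z: "z = of_real \<sigma>" by auto
    have "((\<lambda>x. complex_of_real (exp (- pi * \<alpha> * x ^ 2 + 2 * pi * \<sigma> * x))) has_integral of_real (exp (pi * \<sigma> ^ 2 / \<alpha>) / sqrt \<alpha>)) UNIV"
      by (rule has_integral_of_real[OF real_gaussian_integral[OF assms]])
    also have "(\<lambda>x. complex_of_real (exp (- pi * \<alpha> * x ^ 2 + 2 * pi * \<sigma> * x))) = gauss (of_real \<alpha>) z"
      by (simp add: fun_eq_iff gauss_def z exp_of_real[symmetric])
    finally have "integral UNIV (gauss (of_real \<alpha>) z) = of_real (exp (pi * \<sigma> ^ 2 / \<alpha>) / sqrt \<alpha>)"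
      by (rule integral_unique)
    thus "D z = 0" using assms by (simp add: D_def z csqrt_of_real exp_of_real[symmetric])
  qed (use islimpt_reals[of 1] in auto)
  thus ?thesis by (simp add: D_def)
qed

text \<open>Continuation in \<open>a\<close>, with \<open>s\<close> fixed, from the positive reals
  to the right half-plane. The principal root is holomorphic there, which settles the
  branch.\<close>

lemma gauss_integral:
  fixes a s :: complex
  assumes "Re a > 0"
  shows "integral UNIV (gauss a s) = exp (pi * s ^ 2 / a) / csqrt a"
proof -
  define D where "D = (\<lambda>a::complex. integral UNIV (gauss a s) - exp (pi * s ^ 2 / a) / csqrt a)"
  have "D a = 0"
  proof (rule analytic_continuation[of D "{a. Re a > 0}" "complex_of_real ` {0<..}" "of_real 1"])
    show "D holomorphic_on {a. Re a > 0}" unfolding D_def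
      by (intro holomorphic_intros gauss_integral_holomorphic_a) (auto simp: complex_nonpos_Reals_iff)
    show "open {a. Re a > 0}" by (rule open_halfspace_Re_gt)
    show "connected {a. Re a > 0}" by (rule convex_connected[OF convex_halfspace_Re_gt])
    fix z assume "z \<in> complex_of_real ` {0<..}"
    thus "D z = 0" by (auto simp: D_def gauss_integral_real)
  qed (use islimpt_reals[of 1] assms in auto)
  thus ?thesis by (simp add: D_def)
qed

subsection \<open>The Mordell integral\<close>

definition mordell_kernel :: "complex \<Rightarrow> complex \<Rightarrow> real \<Rightarrow> complex" where
  "mordell_kernel \<tau> w x = gauss (- \<i> * \<tau>) (- w) x / complex_of_real (cosh (pi * x))"

lemma mordell_h_eq: "mordell_h w \<tau> = integral UNIV (mordell_kernel \<tau> w)"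
proof -
  have "- complex_of_real pi * (- \<i> * \<tau>) * of_real x ^ 2 + 2 * of_real pi * (- w) * of_real x
      = of_real pi * \<i> * of_real (x\<^sup>2) * \<tau> - of_real (2 * pi) * of_real x * w" for x
    by (simp add: algebra_simps)
  thus ?thesis unfolding mordell_h_def mordell_kernel_def gauss_def by (simp only:)
qed

lemma norm_mordell_kernel_le: "norm (mordell_kernel \<tau> w x) \<le> norm (gauss (- \<i> * \<tau>) (- w) x)"
proof -
  have "norm (gauss (- \<i> * \<tau>) (- w) x) * 1 \<le> norm (gauss (- \<i> * \<tau>) (- w) x) * cosh (pi * x)"
    by (intro mult_left_mono cosh_real_ge_1) auto
  thus ?thesis
    by (simp add: mordell_kernel_def norm_divide divide_le_eq cosh_real_pos)
qed

lemma continuous_mordell_kernel: "continuous_on A (mordell_kernel \<tau> w)"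
  unfolding mordell_kernel_def gauss_def by (intro continuous_intros) auto

lemma mordell_kernel_integrable:
  assumes "Im \<tau> > 0"
  shows "mordell_kernel \<tau> w integrable_on UNIV"
  by (rule continuous_dominated_integrable[OF continuous_mordell_kernel gauss_norm_integrable norm_mordell_kernel_le])
     (use assms in simp)

lemma mordell_h_holomorphic:
  assumes "Im \<tau> > 0"
  shows "(\<lambda>w. mordell_h w \<tau>) holomorphic_on UNIV"
  unfolding mordell_h_eq
proof (rule holomorphic_integral_UNIV[where f' = "\<lambda>w x. - 2 * pi * of_real x * mordell_kernel \<tau> w x"])
  fix s :: complex
  let ?a = "- \<i> * \<tau>"
  have a: "Re ?a > 0" using assms by simp
  show "\<exists>r>0. \<exists>g. cball s r \<subseteq> UNIV \<and> g integrable_on UNIV \<and> (\<forall>w\<in>cball s r. \<forall>x. norm (mordell_kernel \<tau> w x) \<le> g x)"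
  proof (intro exI conjI)
    show "\<forall>w\<in>cball s 1. \<forall>x. norm (mordell_kernel \<tau> w x) \<le> gauss_bound (Re ?a) (\<bar>Re s\<bar> + 1) x"
    proof (intro ballI allI order_trans[OF norm_mordell_kernel_le norm_gauss_le])
      fix w assume "w \<in> cball s 1"
      thus "\<bar>Re (- w)\<bar> \<le> \<bar>Re s\<bar> + 1" using abs_Re_le_cmod[of "s - w"] by (simp add: dist_norm)
    qed auto
    show "gauss_bound (Re ?a) (\<bar>Re s\<bar> + 1) integrable_on UNIV"
      by (rule gauss_bound_integrable[OF a])
  qed auto
qed (auto simp: mordell_kernel_def gauss_def case_prod_unfold cosh_real_nonzero intro!: derivative_eq_intros continuous_intros)

text \<open>The factors exp(-2 pi x w) and exp(-2 pi x (w + 1)) add up to 2 exp(-2 pi x (w + 1/2))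
  cosh(pi x), so the denominator cancels and a pure Gaussian integral remains.\<close>

lemma mordell_h_add_1:
  assumes "Im \<tau> > 0"
  shows "mordell_h w \<tau> + mordell_h (w + 1) \<tau> = 2 * exp (pi * \<i> * (w + 1/2) ^ 2 / \<tau>) / csqrt (- \<i> * \<tau>)"
proof -
  have a: "Re (- \<i> * \<tau>) > 0" and nz: "\<tau> \<noteq> 0" using assms by auto
  have ker: "mordell_kernel \<tau> w x + mordell_kernel \<tau> (w + 1) x = 2 * gauss (- \<i> * \<tau>) (- (w + 1/2)) x" for x
  proof -
    let ?p = "exp (complex_of_real (pi * x))" and ?G = "gauss (- \<i> * \<tau>) (- (w + 1/2)) x"
    have 1: "gauss (- \<i> * \<tau>) (- w) x = ?G * ?p" "gauss (- \<i> * \<tau>) (- (w + 1)) x = ?G * inverse ?p"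
      unfolding gauss_def exp_minus[symmetric] exp_add[symmetric] by (simp_all add: algebra_simps)
    have 2: "complex_of_real (cosh (pi * x)) = (?p + inverse ?p) / 2"
      by (simp add: cosh_field_def exp_of_real[symmetric] exp_minus)
    have "complex_of_real (cosh (pi * x)) \<noteq> 0" by simp
    hence 3: "?p + inverse ?p \<noteq> 0" unfolding 2 by simp
    have "G * p / ((p + q) / 2) + G * q / ((p + q) / 2) = 2 * G" if "p + q \<noteq> 0" for G p q :: complex
      using that by (simp add: divide_simps) (simp add: algebra_simps)
    from this[OF 3] show ?thesis unfolding mordell_kernel_def 1 2 .
  qed
  have exponent: "pi * (- (w + 1/2)) ^ 2 / (- \<i> * \<tau>) = pi * \<i> * (w + 1/2) ^ 2 / \<tau>"
    using nz by (simp add: field_simps)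
  have "mordell_h w \<tau> + mordell_h (w + 1) \<tau> = integral UNIV (\<lambda>x. mordell_kernel \<tau> w x + mordell_kernel \<tau> (w + 1) x)"
    unfolding mordell_h_eq
    by (rule integral_add[OF mordell_kernel_integrable[OF assms] mordell_kernel_integrable[OF assms], symmetric])
  also have "\<dots> = 2 * integral UNIV (gauss (- \<i> * \<tau>) (- (w + 1/2)))"
    unfolding ker by (rule integral_mult_right)
  also have "\<dots> = 2 * exp (pi * \<i> * (w + 1/2) ^ 2 / \<tau>) / csqrt (- \<i> * \<tau>)"
    unfolding gauss_integral[OF a] exponent by simp
  finally show ?thesis .
qed

section \<open>Shifting the contour of the Mordell integral\<close>

definition mordell_fun :: "complex \<Rightarrow> complex \<Rightarrow> complex \<Rightarrow> complex" where
  "mordell_fun \<tau> w z = 2 * exp (of_real pi * \<i> * \<tau> * z ^ 2 - 2 * of_real pi * w * z) / (exp (of_real pi * z) + exp (- of_real pi * z))"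

lemma mordell_fun_of_real: "mordell_fun \<tau> w (of_real x) = mordell_kernel \<tau> w x"
proof -
  have 2: "complex_of_real (cosh (pi * x)) = (exp (pi * complex_of_real x) + exp (- pi * complex_of_real x)) / 2"
  proof -
    have "exp (pi * complex_of_real x) = of_real (exp (pi * x))" "exp (- pi * complex_of_real x) = of_real (exp (- pi * x))"
      by (metis exp_of_real of_real_mult, metis exp_of_real of_real_mult of_real_minus)
    thus ?thesis by (simp add: cosh_field_def)
  qed
  have 1: "gauss (- \<i> * \<tau>) (- w) x = exp (pi * \<i> * \<tau> * of_real x ^ 2 - 2 * pi * w * of_real x)"
    unfolding gauss_def by (simp add: algebra_simps)
  show ?thesis unfolding mordell_fun_def mordell_kernel_def 1 2 by simp
qed

lemma exp_pi_i_times: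
  fixes z :: complex
  shows "exp (of_real pi * (z + \<i>)) = - exp (of_real pi * z)"
    "exp (- of_real pi * (z + \<i>)) = - exp (- of_real pi * z)"
  by (simp_all add: ring_distribs exp_add exp_diff exp_minus)

text \<open>Expanding (x + i)^2 adds -2 pi \<tau> x to the exponent, which replaces w by w + \<tau>.
  The minus sign is that of cosh under a shift by pi i.\<close>

lemma mordell_fun_add_i: 
  "mordell_fun \<tau> w (of_real x + \<i>) = - exp (- 2 * pi * \<i> * w - pi * \<i> * \<tau>) * mordell_kernel \<tau> (w + \<tau>) x"
proof -
  have 1: "exp (of_real pi * \<i> * \<tau> * (of_real x + \<i>) ^ 2 - 2 * of_real pi * w * (of_real x + \<i>))
      = exp (- 2 * pi * \<i> * w - pi * \<i> * \<tau>) * exp (of_real pi * \<i> * \<tau> * of_real x ^ 2 - 2 * of_real pi * (w + \<tau>) * of_real x)"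
    unfolding exp_add[symmetric] by (simp add: power2_eq_square algebra_simps)
  have 2: "exp (of_real pi * (of_real x + \<i>)) + exp (- of_real pi * (of_real x + \<i>)) = - (exp (of_real pi * complex_of_real x) + exp (- of_real pi * complex_of_real x))"
    unfolding exp_pi_i_times by simp
  have 3: "2 * (E * M) / (- D) = - E * (2 * M / D)" for E M D :: complex by simp
  show ?thesis unfolding mordell_fun_of_real[symmetric] mordell_fun_def 1 2 by (rule 3)
qed

text \<open>The zeros of cosh(pi z) are i/2 + i n. This open strip contains only i/2 and leaves room
  around the closed strip 0 \<le> Im z \<le> 1 in which the contour lies.\<close>

lemma mordell_denominator_zero:
  fixes z :: complex
  assumes "exp (of_real pi * z) + exp (- of_real pi * z) = 0" "- (1/2) < Im z" "Im z < 3/2"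
  shows "z = \<i> / 2"
proof -
  have "exp (pi * z) * exp (pi * z) = - (exp (- pi * z) * exp (pi * z))"
    using assms(1) by (simp add: add_eq_0_iff)
  hence "exp (2 * pi * z) = exp (pi * \<i>)"
    by (simp add: exp_add[symmetric] mult_ac)
  then obtain n :: int where n: "2 * pi * z = pi * \<i> + 2 * of_int n * pi * \<i>"
    unfolding exp_eq by (auto simp: mult_ac)
  hence "pi * (2 * z) = pi * (\<i> + 2 * of_int n * \<i>)" by (simp add: algebra_simps)
  hence z: "2 * z = \<i> + 2 * of_int n * \<i>" by simp
  hence "2 * Im z = 1 + 2 * of_int n" by (simp add: complex_eq_iff)
  hence "- 1 < 1 + 2 * real_of_int n" "1 + 2 * real_of_int n < 3" using assms by auto
  hence "n = 0" by linarith
  hence "z + z = \<i>" using z by simp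
  thus ?thesis by (simp add: field_simps)
qed

lemma mordell_denominator_nonzero:
  fixes z :: complex
  assumes "z \<noteq> \<i> / 2" "- (1/2) < Im z" "Im z < 3/2"
  shows "exp (of_real pi * z) + exp (- of_real pi * z) \<noteq> 0"
  using mordell_denominator_zero assms by metis

text \<open>The only pole inside is i/2. It is simple, and the denominator has derivative 2 pi i
  there, which cancels the factor of the residue theorem.\<close>

lemma mordell_rectangle:
  fixes \<tau> w :: complex
  assumes R: "R > 0"
  shows "contour_integral (rectpath (of_real (- R)) (of_real R + \<i>)) (mordell_fun \<tau> w) = 2 * exp (- pi * \<i> * \<tau> / 4 - pi * \<i> * w)"
proof -
  define S where "S = {z. Im z > - (1/2)} \<inter> {z. Im z < 3/2}"
  have S: "open S" "connected S" unfolding S_def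
    by (intro open_Int open_halfspace_Im_gt open_halfspace_Im_lt convex_connected convex_Int convex_halfspace_Im_gt convex_halfspace_Im_lt)+
  have i2: "\<i> / 2 \<in> S" by (simp add: S_def)
  have hol: "mordell_fun \<tau> w holomorphic_on S - {\<i> / 2}"
    unfolding mordell_fun_def
    by (intro holomorphic_intros mordell_denominator_nonzero) (auto simp: S_def)
  define g where "g = (\<lambda>z::complex. 2 * exp (pi * \<i> * \<tau> * z ^ 2 - 2 * pi * w * z))"
  let ?d = "\<lambda>z::complex. exp (of_real pi * z) + exp (- of_real pi * z)"
  have e: "exp (pi * (\<i> / 2)) = \<i>" "exp (- pi * (\<i> / 2)) = - \<i>"
    using cis_pi_half cis_conv_exp[of "pi/2"] cis_conv_exp[of "- pi/2"] by (simp_all add: mult_ac)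
  have "(?d has_field_derivative (2 * pi * \<i>)) (at (\<i> / 2))"
    by (rule derivative_eq_intros refl)+ (use e in \<open>simp add: field_simps\<close>)
  hence "((\<lambda>z. (?d z - ?d (\<i>/2)) / (z - \<i>/2)) \<longlongrightarrow> 2 * pi * \<i>) (at (\<i>/2))"
    by (simp add: has_field_derivative_iff)
  hence "((\<lambda>z. ?d z / (z - \<i>/2)) \<longlongrightarrow> 2 * pi * \<i>) (at (\<i>/2))" using e by simp
  moreover have "(g \<longlongrightarrow> g (\<i>/2)) (at (\<i>/2))" unfolding g_def by (intro tendsto_intros)
  ultimately have "((\<lambda>z. g z / (?d z / (z - \<i>/2))) \<longlongrightarrow> g (\<i>/2) / (2 * pi * \<i>)) (at (\<i>/2))"
    by (intro tendsto_divide) auto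
  also have "(\<lambda>z. g z / (?d z / (z - \<i>/2))) = (\<lambda>z. mordell_fun \<tau> w z * (z - \<i>/2))"
    by (simp add: mordell_fun_def g_def fun_eq_iff)
  finally have res: "residue (mordell_fun \<tau> w) (\<i>/2) = g (\<i>/2) / (2 * pi * \<i>)"
    by (intro residue_simple'[OF S(1) i2 hol])
  have exponent: "of_real pi * \<i> * \<tau> * (\<i>/2) ^ 2 - of_real (2 * pi) * w * (\<i>/2) = of_real (- pi) * \<i> * \<tau> / 4 - of_real pi * \<i> * w"
    by (simp add: power_divide)
  have img: "path_image (rectpath (of_real (- R)) (of_real R + \<i>)) \<subseteq> S - {\<i> / 2}"
    using R by (subst path_image_rectpath_cbox_minus_box) (auto simp: S_def in_cbox_complex_iff in_box_complex_iff)
  define \<gamma> where "\<gamma> = rectpath (of_real (- R)) (of_real R + \<i>)"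
  have wn: "winding_number \<gamma> (\<i>/2) = 1"
    unfolding \<gamma>_def by (rule winding_number_rectpath) (use R in \<open>simp add: in_box_complex_iff\<close>)
  have "contour_integral \<gamma> (mordell_fun \<tau> w)
      = 2 * pi * \<i> * (\<Sum>p\<in>{\<i>/2}. winding_number \<gamma> p * residue (mordell_fun \<tau> w) p)"
  proof (rule Residue_theorem[OF S _ hol])
    show "path_image \<gamma> \<subseteq> S - {\<i>/2}" unfolding \<gamma>_def by (rule img)
    show "\<forall>z. z \<notin> S \<longrightarrow> winding_number \<gamma> z = 0"
      unfolding \<gamma>_def using R by (auto intro!: winding_number_rectpath_outside simp: S_def in_cbox_complex_iff)
  qed (auto simp: \<gamma>_def)
  also have "\<dots> = 2 * pi * \<i> * (g (\<i>/2) / (2 * pi * \<i>))" by (simp add: wn res)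
  also have "\<dots> = g (\<i>/2)" by simp
  also have "\<dots> = 2 * exp (- pi * \<i> * \<tau> / 4 - pi * \<i> * w)" unfolding g_def exponent ..
  finally show ?thesis unfolding \<gamma>_def .
qed

text \<open>The top and left edges are reversed so that they are parallel to the opposite edges;
  hence the two minus signs.\<close>

lemma contour_integral_rectpath:
  assumes "continuous_on (path_image (rectpath a b)) f"
  shows "contour_integral (rectpath a b) f =
     contour_integral (linepath a (Complex (Re b) (Im a))) f + contour_integral (linepath (Complex (Re b) (Im a)) b) f
     - contour_integral (linepath (Complex (Re a) (Im b)) b) f - contour_integral (linepath a (Complex (Re a) (Im b))) f"
proof -
  let ?a2 = "Complex (Re b) (Im a)" and ?a4 = "Complex (Re a) (Im b)"
  have img: "path_image (rectpath a b) = closed_segment a ?a2 \<union> closed_segment ?a2 b \<union> closed_segment b ?a4 \<union> closed_segment ?a4 a"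
    by (simp add: rectpath_def Let_def path_image_join Un_assoc)
  have int: "f contour_integrable_on linepath a ?a2" "f contour_integrable_on linepath ?a2 b"
    "f contour_integrable_on linepath b ?a4" "f contour_integrable_on linepath ?a4 a"
    by (auto intro!: contour_integrable_continuous_linepath continuous_on_subset[OF assms] simp: img)
  have "contour_integral (rectpath a b) f = contour_integral (linepath a ?a2) f + contour_integral (linepath ?a2 b) f
     + contour_integral (linepath b ?a4) f + contour_integral (linepath ?a4 a) f"
    unfolding rectpath_def Let_def using int by (simp add: contour_integrable_joinI valid_path_join)
  moreover have "contour_integral (linepath b ?a4) f = - contour_integral (linepath ?a4 b) f"
    "contour_integral (linepath ?a4 a) f = - contour_integral (linepath a ?a4) f"
    using contour_integral_reversepath[of "linepath ?a4 b" f] contour_integral_reversepath[of "linepath a ?a4" f] by simp_all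
  ultimately show ?thesis by simp
qed

text \<open>Since 0 \<le> Im z \<le> 1 on a vertical edge, the real part of the exponent exceeds -pi
  Im \<tau> x^2 by at most a linear function of |x|, and for |x| \<ge> 1 the denominator has modulus
  at least 1.\<close>

lemma mordell_fun_vertical_bound:
  assumes "z \<in> closed_segment (of_real x) (of_real x + \<i>)" "\<bar>x\<bar> \<ge> 1"
  shows "norm (mordell_fun \<tau> w z) \<le> 2 * exp (- pi * Im \<tau> * x ^ 2 + pi * (2 * \<bar>Re \<tau>\<bar> + 2 * \<bar>Re w\<bar>) * \<bar>x\<bar> + pi * (\<bar>Im \<tau>\<bar> + 2 * \<bar>Im w\<bar>))"
proof -
  let ?K = "2 * \<bar>Re \<tau>\<bar> + 2 * \<bar>Re w\<bar>"
  let ?L = "\<bar>Im \<tau>\<bar> + 2 * \<bar>Im w\<bar>"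
  let ?e = "of_real pi * \<i> * \<tau> * z ^ 2 - 2 * of_real pi * w * z"
  define y where "y = Im z"
  have "Re z = x" "Im z \<in> {0..1}"
    using assms(1) closed_segment_same_Re[of "complex_of_real x" "of_real x + \<i>"]
    by (auto simp: closed_segment_eq_real_ivl)
  hence z: "z = Complex x y" "0 \<le> y" "y \<le> 1" by (auto simp: y_def complex_eq_iff)
  have n1: "norm (exp (pi * z)) = exp (pi * x)" "norm (exp (- pi * z)) = exp (- pi * x)"
    by (simp_all add: norm_exp_eq_Re z)
  have big: "exp (pi * t) - exp (- pi * t) \<ge> 1" if "t \<ge> 1" for t :: real
  proof -
    have 1: "pi * t \<ge> 1 * 1" using that pi_gt3 by (intro mult_mono) auto
    have 2: "exp (pi * t) \<ge> 1 + pi * t" by (rule exp_ge_add_one_self)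
    have "exp (- pi * t) \<le> 1" using 1 by (subst exp_le_one_iff) simp
    thus ?thesis using 1 2 by linarith
  qed
  have den: "norm (exp (of_real pi * z) + exp (- of_real pi * z)) \<ge> 1"
  proof (cases "x \<ge> 0")
    case True
    thus ?thesis using norm_triangle_ineq2[of "exp (pi * z)" "- exp (- pi * z)"] big[of x] n1 assms(2) by simp
  next
    case False
    thus ?thesis using norm_triangle_ineq2[of "exp (- pi * z)" "- exp (pi * z)"] big[of "- x"] n1 assms(2)
      by (simp add: add.commute)
  qed
  have "Re (?e)
     = - pi * Im \<tau> * x ^ 2 + pi * (Im \<tau> * y ^ 2 - 2 * Re \<tau> * y * x - 2 * Re w * x + 2 * Im w * y)"
    by (simp add: z power2_eq_square algebra_simps)
  also have "\<dots> \<le> - pi * Im \<tau> * x ^ 2 + pi * (?K * \<bar>x\<bar> + ?L)"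
  proof (intro add_left_mono mult_left_mono)
    have bnd: "a * t \<le> \<bar>a\<bar> * s" if "\<bar>t\<bar> \<le> s" for a t s :: real
    proof -
      have "a * t \<le> \<bar>a\<bar> * \<bar>t\<bar>" using abs_ge_self[of "a * t"] by (simp add: abs_mult)
      also have "\<dots> \<le> \<bar>a\<bar> * s" using that by (intro mult_left_mono) auto
      finally show ?thesis .
    qed
    have y2: "\<bar>y ^ 2\<bar> \<le> 1" using z by (simp add: power_le_one)
    have "\<bar>y * x\<bar> \<le> 1 * \<bar>x\<bar>" unfolding abs_mult using z by (intro mult_right_mono) auto
    hence yx: "\<bar>y * x\<bar> \<le> \<bar>x\<bar>" by simp
    have "Im \<tau> * y ^ 2 \<le> \<bar>Im \<tau>\<bar> * 1" by (rule bnd[OF y2])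
    moreover have "- Re \<tau> * (y * x) \<le> \<bar>- Re \<tau>\<bar> * \<bar>x\<bar>" by (rule bnd[OF yx])
    moreover have "- Re w * x \<le> \<bar>- Re w\<bar> * \<bar>x\<bar>" by (rule bnd) simp
    moreover have "Im w * y \<le> \<bar>Im w\<bar> * 1" by (rule bnd) (use z in simp)
    ultimately show "Im \<tau> * y ^ 2 - 2 * Re \<tau> * y * x - 2 * Re w * x + 2 * Im w * y
       \<le> ?K * \<bar>x\<bar> + ?L"
      by (simp add: algebra_simps)
  qed auto
  finally have num: "norm (exp (?e))
     \<le> exp (- pi * Im \<tau> * x ^ 2 + pi * ?K * \<bar>x\<bar> + pi * ?L)"
    by (simp add: norm_exp_eq_Re algebra_simps)
  have "norm (mordell_fun \<tau> w z) = 2 * norm (exp (?e)) / norm (exp (of_real pi * z) + exp (- of_real pi * z))"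
    by (simp add: mordell_fun_def norm_divide norm_mult)
  also have "\<dots> \<le> 2 * norm (exp (?e)) / 1"
    using den by (intro divide_left_mono) auto
  also have "\<dots> = 2 * norm (exp (?e))" by (rule div_by_1)
  finally show ?thesis using num by linarith
qed

text \<open>The integral over the real line minus that over the line shifted by i equals 2 pi i
  times the residue at i/2, and the shifted integral is a multiple of h at w + \<tau>. The vertical
  edges of the rectangle vanish in the limit.\<close>

lemma mordell_h_add_tau:
  assumes \<tau>: "Im \<tau> > 0"
  shows "mordell_h w \<tau> + exp (- 2 * pi * \<i> * w - pi * \<i> * \<tau>) * mordell_h (w + \<tau>) \<tau> = 2 * exp (- pi * \<i> * \<tau> / 4 - pi * \<i> * w)"
proof -
  let ?E = "2 * exp (- pi * \<i> * \<tau> / 4 - pi * \<i> * w)"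
  let ?K = "2 * \<bar>Re \<tau>\<bar> + 2 * \<bar>Re w\<bar>"
  let ?L = "\<bar>Im \<tau>\<bar> + 2 * \<bar>Im w\<bar>"
  let ?k = "mordell_kernel \<tau> w"
  let ?k' = "mordell_kernel \<tau> (w + \<tau>)"
  define q where "q = exp (- 2 * pi * \<i> * w - pi * \<i> * \<tau>)"
  define f where "f = mordell_fun \<tau> w"
  define B where "B = (\<lambda>x::real. 2 * exp (- pi * Im \<tau> * x ^ 2 + pi * ?K * \<bar>x\<bar> + pi * ?L))"
  define V where "V = (\<lambda>x::real. contour_integral (linepath (of_real x) (of_real x + \<i>)) f)"
  define I where "I = (\<lambda>n. integral {- real n..real n} ?k + q * integral {- real n..real n} ?k')"
  have cont: "continuous_on A f" if "\<And>z. z \<in> A \<Longrightarrow> exp (of_real pi * z) + exp (- of_real pi * z) \<noteq> 0" for A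
    unfolding f_def mordell_fun_def by (intro continuous_intros ballI) (rule that)
  have V: "norm (V x) \<le> B x" if "\<bar>x\<bar> \<ge> 1" for x
  proof -
    have "norm (V x) \<le> B x * norm (of_real x + \<i> - of_real x)" unfolding V_def
    proof (rule contour_integral_bound_linepath)
      show "f contour_integrable_on linepath (of_real x) (of_real x + \<i>)"
      proof (intro contour_integrable_continuous_linepath cont)
        fix z assume z: "z \<in> closed_segment (of_real x) (of_real x + \<i>)"
        hence "Re z = x" "Im z \<in> {0..1}"
          using closed_segment_same_Re[of "complex_of_real x" "of_real x + \<i>"] by (auto simp: closed_segment_eq_real_ivl)
        thus "exp (of_real pi * z) + exp (- of_real pi * z) \<noteq> 0" using that by (intro mordell_denominator_nonzero) (auto simp: complex_eq_iff)
      qed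
      show "norm (f z) \<le> B x" if "z \<in> closed_segment (of_real x) (of_real x + \<i>)" for z
        unfolding f_def B_def by (rule mordell_fun_vertical_bound[OF that \<open>\<bar>x\<bar> \<ge> 1\<close>])
    qed (simp add: B_def)
    thus ?thesis by simp
  qed
  have rect: "I n + V (real n) - V (- real n) = ?E" if n: "n > 0" for n
  proof -
    let ?a = "complex_of_real (- real n)" and ?b = "complex_of_real (real n) + \<i>"
    have c: "continuous_on (path_image (rectpath ?a ?b)) f"
    proof (rule cont)
      fix z assume z: "z \<in> path_image (rectpath ?a ?b)"
      have "z \<noteq> \<i> / 2 \<and> Im z \<ge> 0 \<and> Im z \<le> 1"
        using z n by (subst (asm) path_image_rectpath_cbox_minus_box) (auto simp: in_cbox_complex_iff in_box_complex_iff complex_eq_iff)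
      thus "exp (of_real pi * z) + exp (- of_real pi * z) \<noteq> 0" by (intro mordell_denominator_nonzero) auto
    qed
    have corners: "Complex (Re ?b) (Im ?a) = of_real (real n)" "Complex (Re ?a) (Im ?b) = of_real (- real n) + \<i>"
      by (simp_all add: complex_eq_iff)
    have bottom: "contour_integral (linepath ?a (of_real (real n))) f = integral {- real n..real n} ?k"
      using contour_integral_linepath_Reals_eq[of ?a "of_real (real n)" f] n by (simp add: f_def mordell_fun_of_real)
    have "contour_integral (linepath (of_real (- real n) + \<i>) ?b) f = contour_integral (linepath ?a (of_real (real n))) (\<lambda>z. f (z + \<i>))"
      by (simp add: contour_integral_integral linepath_def scaleR_conv_of_real algebra_simps)
    also have "\<dots> = integral {- real n..real n} (\<lambda>x. - q * mordell_kernel \<tau> (w + \<tau>) x)"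
      using contour_integral_linepath_Reals_eq[of ?a "of_real (real n)" "\<lambda>z. f (z + \<i>)"] n
      by (simp add: f_def mordell_fun_add_i q_def)
    also have "\<dots> = - q * integral {- real n..real n} ?k'"
      by (rule integral_mult_right)
    finally have top: "contour_integral (linepath (of_real (- real n) + \<i>) ?b) f = - q * integral {- real n..real n} ?k'" .
    show ?thesis
      using mordell_rectangle[of "real n" \<tau> w] n contour_integral_rectpath[OF c]
      unfolding corners bottom top by (simp add: f_def[symmetric] I_def V_def)
  qed
  have lim: "I \<longlonglongrightarrow> mordell_h w \<tau> + q * mordell_h (w + \<tau>) \<tau>"
    unfolding I_def mordell_h_eq
    by (intro tendsto_intros integral_UNIV_limit_symmetric[OF mordell_kernel_integrable[OF \<tau>] gauss_norm_integrable norm_mordell_kernel_le])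
      (use \<tau> in simp_all)
  have B0: "(\<lambda>n. B (real n)) \<longlonglongrightarrow> 0"
  proof -
    define a b c where "a = pi * Im \<tau>" "b = pi * ?K" "c = pi * ?L"
    have "a > 0" using \<tau> by (simp add: a_b_c_def)
    hence "(\<lambda>n. 2 * exp (- a * real n ^ 2 + b * real n + c)) \<longlonglongrightarrow> 0" by real_asymp
    thus ?thesis by (simp add: B_def a_b_c_def)
  qed
  have "(\<lambda>n. V (real n)) \<longlonglongrightarrow> 0" "(\<lambda>n. V (- real n)) \<longlonglongrightarrow> 0"
  proof -
    show "(\<lambda>n. V (real n)) \<longlonglongrightarrow> 0"
      by (rule Lim_null_comparison[OF _ B0]) (auto intro!: V eventually_sequentiallyI[of 1])
    have "B (- real n) = B (real n)" for n by (simp add: B_def)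
    thus "(\<lambda>n. V (- real n)) \<longlonglongrightarrow> 0"
      using V[of "- real _"] by (intro Lim_null_comparison[OF _ B0]) (auto intro!: eventually_sequentiallyI[of 1])
  qed
  from tendsto_diff[OF tendsto_add[OF lim this(1)] this(2)]
  have "(\<lambda>n. I n + V (real n) - V (- real n)) \<longlonglongrightarrow> mordell_h w \<tau> + q * mordell_h (w + \<tau>) \<tau>" by simp
  moreover have "\<forall>\<^sub>F n in sequentially. I n + V (real n) - V (- real n) = ?E"
    using eventually_gt_at_top[of 0] by eventually_elim (rule rect)
  hence "(\<lambda>n. I n + V (real n) - V (- real n)) \<longlonglongrightarrow> ?E"
    by (rule tendsto_eventually)
  ultimately show ?thesis unfolding q_def using LIMSEQ_unique by blast
qed

subsection \<open>The Jacobi theta function\<close>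

definition theta_coeff :: "complex \<Rightarrow> int \<Rightarrow> complex" where
  "theta_coeff \<tau> n = expi ((of_int n + 1/2) / 2 + (of_int n + 1/2) ^ 2 / 2 * \<tau>)"

lemma theta_coeff_nonzero [simp]: "theta_coeff \<tau> n \<noteq> 0"
  by (simp add: theta_coeff_def)

lemma rapid_theta_coeff: "Im \<tau> > 0 \<Longrightarrow> rapid (theta_coeff \<tau>)"
proof -
  assume "Im \<tau> > 0"
  hence "rapid (\<lambda>n. expi (1/4 + \<tau>/8) * expi (of_int n ^ 2 * \<tau> / 2 + of_int n * ((\<tau> + 1) / 2)))"
    by (rule rapid_gaussian)
  moreover have "theta_coeff \<tau> n = expi (1/4 + \<tau>/8) * expi (of_int n ^ 2 * \<tau> / 2 + of_int n * ((\<tau> + 1) / 2))" for n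
    unfolding theta_coeff_def expi_add[symmetric] by (rule expi_cong) (simp add: field_simps power2_eq_square)
  ultimately show ?thesis by (subst ext[of "theta_coeff \<tau>"]) auto
qed

text \<open>The recursion demanded by \<open>appell_quasi_periodic\<close>, with N = 1 and \<kappa>
  = -1.\<close>

lemma theta_coeff_Suc: "theta_coeff \<tau> (n + 1) = - expi (of_int (n + 1) * \<tau>) * theta_coeff \<tau> n"
proof -
  have "theta_coeff \<tau> (n + 1) = expi (1/2) * expi (of_int (n + 1) * \<tau>) * theta_coeff \<tau> n"
    unfolding theta_coeff_def expi_add[symmetric] by (rule expi_cong) (simp add: field_simps power2_eq_square)
  thus ?thesis by (simp add: expi_half)
qed

lemma vtheta_eq_fseries: "vtheta u \<tau> = fseries (theta_coeff \<tau>) (1/2) u"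
proof -
  have inj: "inj (\<lambda>n::int. of_int n + 1/2 :: real)" by (auto simp: inj_on_def)
  have set: "{of_int n + 1/2 :: real | n::int. True} = range (\<lambda>n::int. of_int n + 1/2)" by auto
  have "exp (2 * pi * \<i> * of_real (of_int n + 1/2) * (u + 1/2)) * qpow \<tau> ((of_int n + 1/2)^2 / 2)
      = theta_coeff \<tau> n * expi ((of_int n + 1/2) * u)" for n :: int
    unfolding theta_coeff_def qpow_def expi_def exp_add[symmetric]
    by (rule arg_cong[where f = exp]) (simp add: field_simps power2_eq_square)
  thus ?thesis
    unfolding vtheta_def fseries_def set by (simp add: infsum_reindex[OF inj] o_def)
qed

lemma vtheta_holomorphic: "Im \<tau> > 0 \<Longrightarrow> (\<lambda>u. vtheta u \<tau>) holomorphic_on A"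
  unfolding vtheta_eq_fseries by (rule fseries_holomorphic[OF rapid_theta_coeff])

lemma vtheta_add_1: "vtheta (u + 1) \<tau> = - vtheta u \<tau>"
proof -
  have "theta_coeff \<tau> n * expi ((of_int n + 1/2) * (u + 1)) = - 1 * (theta_coeff \<tau> n * expi ((of_int n + 1/2) * u))" for n
  proof -
    have "expi ((of_int n + 1/2) * (u + 1)) = expi ((of_int n + 1/2) * u + 1/2)"
      by (rule expi_eq_of_int[of _ _ n]) (simp add: field_simps)
    thus ?thesis by (simp add: expi_add expi_half)
  qed
  thus ?thesis unfolding vtheta_eq_fseries fseries_def by (simp only: infsum_cmult_right') simp
qed

lemma vtheta_add_tau: "vtheta (u + \<tau>) \<tau> = - expi (- u - \<tau> / 2) * vtheta u \<tau>"
proof -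
  have bij: "bij_betw (\<lambda>m. m - 1) UNIV (UNIV :: int set)"
    by (rule bij_betwI[of _ _ _ "\<lambda>m. m + 1"]) auto
  have "theta_coeff \<tau> (n - 1) * expi ((of_int (n - 1) + 1/2) * (u + \<tau>))
      = - expi (- u - \<tau> / 2) * (theta_coeff \<tau> n * expi ((of_int n + 1/2) * u))" for n
  proof -
    have "theta_coeff \<tau> (n - 1) * expi ((of_int (n - 1) + 1/2) * (u + \<tau>))
      = expi (- (1/2) + (- u - \<tau> / 2) + ((of_int n + 1/2) / 2 + (of_int n + 1/2) ^ 2 / 2 * \<tau>) + (of_int n + 1/2) * u)"
      unfolding theta_coeff_def expi_add[symmetric]
      by (rule expi_cong) (simp add: field_simps power2_eq_square)
    thus ?thesis
      unfolding theta_coeff_def expi_add[of _ "(of_int n + 1/2) * u"] expi_add[of "- (1/2) + (- u - \<tau> / 2)"]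
        expi_add[of "- (1/2)"] expi_minus[of "1/2"] expi_half by simp
  qed
  thus ?thesis unfolding vtheta_eq_fseries fseries_def
    by (subst infsum_reindex_bij_betw[OF bij, symmetric]) (simp only: infsum_cmult_right')
qed

text \<open>The reindexing realizes \<nu> to -\<nu> for \<nu> = n + 1/2. The factor e(\<nu>/2)
  changes sign because e(\<nu>) = -1.\<close>

lemma vtheta_minus: "vtheta (- u) \<tau> = - vtheta u \<tau>"
proof -
  have bij: "bij_betw (\<lambda>m. - m - 1) UNIV (UNIV :: int set)"
    by (rule bij_betwI[of _ _ _ "\<lambda>m. - m - 1"]) auto
  have "theta_coeff \<tau> (- n - 1) * expi ((of_int (- n - 1) + 1/2) * (- u))
      = - 1 * (theta_coeff \<tau> n * expi ((of_int n + 1/2) * u))" for n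
  proof -
    have "theta_coeff \<tau> (- n - 1) = expi (((of_int n + 1/2) / 2 + (of_int n + 1/2) ^ 2 / 2 * \<tau>) - 1/2)"
      unfolding theta_coeff_def by (rule expi_eq_of_int[of _ _ "- n"]) (simp add: field_simps power2_eq_square)
    hence "theta_coeff \<tau> (- n - 1) = - theta_coeff \<tau> n"
      unfolding expi_diff[of _ "1/2"] expi_half by (simp add: theta_coeff_def)
    moreover have "(of_int (- n - 1) + 1/2) * (- u) = (of_int n + 1/2) * u" by (simp add: algebra_simps)
    ultimately show ?thesis by simp
  qed
  thus ?thesis unfolding vtheta_eq_fseries fseries_def
    by (subst infsum_reindex_bij_betw[OF bij, symmetric]) (simp only: infsum_cmult_right', simp)
qed

lemma vtheta_0: "vtheta 0 \<tau> = 0"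
  using vtheta_minus[of 0 \<tau>] by (simp add: eq_neg_iff_add_eq_0)

section \<open>Lattice points, the reciprocal of theta and its inversion formula\<close>

lemma lattice_iff: "z \<in> lattice \<tau> \<longleftrightarrow> (\<exists>m. expi (z + of_int m * \<tau>) = 1)"
proof
  assume "z \<in> lattice \<tau>"
  then obtain a b where "z = of_int a + of_int b * \<tau>" unfolding lattice_def by blast
  thus "\<exists>m. expi (z + of_int m * \<tau>) = 1" by (intro exI[of _ "- b"]) simp
next
  assume "\<exists>m. expi (z + of_int m * \<tau>) = 1"
  then obtain m a where "z + of_int m * \<tau> = of_int a" by (auto simp: expi_eq_1_iff Ints_def)
  hence "z = of_int a + of_int (- m) * \<tau>" by (simp add: algebra_simps)
  thus "z \<in> lattice \<tau>" unfolding lattice_def by blast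
qed

lemma lattice_add:
  assumes "z \<in> lattice \<tau>"
  shows "z + (of_int a + of_int b * \<tau>) \<in> lattice \<tau>"
proof -
  obtain c d where z: "z = of_int c + of_int d * \<tau>" using assms unfolding lattice_def by blast
  have "z + (of_int a + of_int b * \<tau>) = of_int (c + a) + of_int (d + b) * \<tau>"
    by (simp add: z algebra_simps)
  thus ?thesis unfolding lattice_def by blast
qed

lemma lattice_add_iff: "z + (of_int a + of_int b * \<tau>) \<in> lattice \<tau> \<longleftrightarrow> z \<in> lattice \<tau>"
  using lattice_add[of z \<tau> a b] lattice_add[of "z + (of_int a + of_int b * \<tau>)" \<tau> "- a" "- b"]
  by (auto simp: algebra_simps)

lemma lattice_scaled_iff:
  assumes "\<tau> \<noteq> 0"
  shows "z / \<tau> \<in> lattice (- 1 / \<tau>) \<longleftrightarrow> z \<in> lattice \<tau>"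
proof
  assume "z / \<tau> \<in> lattice (- 1 / \<tau>)"
  then obtain a b :: int where "z / \<tau> = of_int a + of_int b * (- 1 / \<tau>)" unfolding lattice_def by blast
  hence "z = of_int (- b) + of_int a * \<tau>" using assms by (simp add: field_simps)
  thus "z \<in> lattice \<tau>" unfolding lattice_def by blast
next
  assume "z \<in> lattice \<tau>"
  then obtain a b :: int where "z = of_int a + of_int b * \<tau>" unfolding lattice_def by blast
  hence "z / \<tau> = of_int b + of_int (- a) * (- 1 / \<tau>)" using assms by (simp add: field_simps)
  thus "z / \<tau> \<in> lattice (- 1 / \<tau>)" unfolding lattice_def by blast
qed

lemma vtheta_zero_on_lattice:
  assumes z: "z \<in> lattice \<tau>"
  shows "vtheta z \<tau> = 0"
proof -
  have 1: "vtheta (u + 1) \<tau> = 0 \<longleftrightarrow> vtheta u \<tau> = 0" for u by (simp add: vtheta_add_1)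
  have 2: "vtheta (u + \<tau>) \<tau> = 0 \<longleftrightarrow> vtheta u \<tau> = 0" for u by (simp add: vtheta_add_tau)
  have 3: "vtheta (of_int a) \<tau> = 0" for a
  proof (induction a rule: int_induct[of _ 0])
    case (step1 i) thus ?case using 1[of "of_int i"] by simp
  next
    case (step2 i) thus ?case using 1[of "of_int (i - 1)"] by simp
  qed (simp add: vtheta_0)
  have "vtheta (of_int a + of_int b * \<tau>) \<tau> = 0" for a b
  proof (induction b rule: int_induct[of _ 0])
    case (step1 i) thus ?case using 2[of "of_int a + of_int i * \<tau>"] by (simp add: algebra_simps)
  next
    case (step2 i) thus ?case using 2[of "of_int a + of_int (i - 1) * \<tau>"] by (simp add: algebra_simps)
  qed (simp add: 3)
  thus ?thesis using z unfolding lattice_def by auto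
qed

text \<open>Up to a constant, the partial fraction expansion of 1/theta. The factor e(z/2) gives it
  the inverse multipliers of theta.\<close>

definition appell_theta :: "complex \<Rightarrow> complex \<Rightarrow> complex" where
  "appell_theta \<tau> z = expi (z / 2) * appell (theta_coeff \<tau>) \<tau> z"

lemma appell_theta_add_1: "appell_theta \<tau> (z + 1) = - appell_theta \<tau> z"
  unfolding appell_theta_def appell_add_1 add_divide_distrib expi_add expi_half by simp

text \<open>The inhomogeneous term is the sum of all theta coefficients, that is theta at 0, and
  vanishes by oddness.\<close>

lemma appell_theta_add_tau:
  assumes \<tau>: "Im \<tau> > 0" and z: "z \<notin> lattice \<tau>"
  shows "appell_theta \<tau> (z + \<tau>) = - expi (z + \<tau> / 2) * appell_theta \<tau> z"
proof -
  have "(\<Sum>\<^sub>\<infinity>m. theta_coeff \<tau> m) = 0"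
    using vtheta_0 by (simp add: vtheta_eq_fseries fseries_def)
  moreover have "appell (theta_coeff \<tau>) \<tau> (z + of_int 1 * \<tau>) = (\<Sum>\<^sub>\<infinity>m. theta_coeff \<tau> m) + inverse (- 1) * expi z * appell (theta_coeff \<tau>) \<tau> z"
    by (rule appell_quasi_periodic[OF \<tau> rapid_theta_coeff[OF \<tau>]])
      (use z in \<open>auto simp: lattice_iff theta_coeff_Suc\<close>)
  ultimately show ?thesis
    unfolding appell_theta_def by (simp add: add_divide_distrib expi_add)
qed

text \<open>The multipliers cancel and the zeros of \<open>g\<close> remove the simple poles, so the
  product is elliptic without poles. General \<open>g\<close> is needed because theta and its
  transform under \<tau> to -1/\<tau> are both inserted.\<close>

lemma appell_theta_times_constant:
  assumes \<tau>: "Im \<tau> > 0" and hol: "g holomorphic_on UNIV"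
    and g1: "\<And>z. g (z + 1) = - g z" and g\<tau>: "\<And>z. g (z + \<tau>) = - expi (- z - \<tau> / 2) * g z"
    and g0: "\<And>z. z \<in> lattice \<tau> \<Longrightarrow> g z = 0"
  obtains C where "\<And>z. z \<notin> lattice \<tau> \<Longrightarrow> appell_theta \<tau> z * g z = C"
proof -
  define f where "f = (\<lambda>z. appell_theta \<tau> z * g z)"
  have ga: "g analytic_on {z}" for z using hol by (auto simp: analytic_at)
  have an: "f analytic_on {z}" if "z \<notin> lattice \<tau>" for z
    unfolding f_def appell_theta_def
    by (intro analytic_intros ga appell_analytic \<tau> rapid_theta_coeff) (use that in \<open>auto simp: lattice_iff\<close>)
  have pol: "polar f z 0" for z
  proof (cases "z \<in> lattice \<tau>")
    case True
    then obtain k where "expi (z + of_int k * \<tau>) = 1" by (auto simp: lattice_iff)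
    hence "polar (\<lambda>z. (expi (z / 2) * g z) * appell (theta_coeff \<tau>) \<tau> z) z
        ((expi (z / 2) * g z) * (- theta_coeff \<tau> k / (2 * pi * \<i>)))"
      by (intro polar_mult appell_polar \<tau> rapid_theta_coeff analytic_intros ga) auto
    thus ?thesis by (simp add: f_def appell_theta_def mult_ac g0[OF True])
  qed (use an polar_analytic in blast)
  obtain C where C: "\<And>z. isCont f z \<Longrightarrow> f z = C"
  proof (rule quasi_periodic_constant[OF pol _ \<tau>, of 0 0])
    show "\<forall>\<^sub>F w in at z. norm (f (w + 1)) = norm (f w)" for z
      by (simp add: f_def g1 appell_theta_add_1)
    show "\<forall>\<^sub>F w in at z. norm (f (w + \<tau>)) = exp (0 - 0 * Im w) * norm (f w)" for z
      using appell_regular_near[OF \<tau>, of z]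
    proof eventually_elim
      case (elim w)
      hence "w \<notin> lattice \<tau>" by (simp add: lattice_iff)
      hence "f (w + \<tau>) = (expi (w + \<tau> / 2) * expi (- w - \<tau> / 2)) * f w"
        unfolding f_def g\<tau> by (subst appell_theta_add_tau[OF \<tau>]) auto
      also have "expi (w + \<tau> / 2) * expi (- w - \<tau> / 2) = 1" unfolding expi_add[symmetric] by simp
      finally show ?case by simp
    qed
  qed auto
  show ?thesis
  proof (rule that)
    fix z assume "z \<notin> lattice \<tau>"
    hence "isCont f z" by (intro analytic_at_imp_isCont an)
    from C[OF this] show "appell_theta \<tau> z * g z = C" by (simp add: f_def)
  qed
qed

lemma polar_nonzero:
  assumes "polar f z \<rho>" "\<rho> \<noteq> 0"
  shows "\<forall>\<^sub>F w in at z. f w \<noteq> 0"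
proof -
  obtain F where F: "F analytic_on {z}" "F z = \<rho>" "\<forall>\<^sub>F w in at z. f w = F w / (w - z)"
    using assms(1) unfolding polar_def by blast
  have "(F \<longlongrightarrow> F z) (at z)" using analytic_at_imp_isCont[OF F(1)] by (simp add: isCont_def)
  hence "\<forall>\<^sub>F w in at z. F w \<noteq> 0" by (rule tendsto_imp_eventually_ne) (use F(2) assms(2) in simp)
  moreover have "\<forall>\<^sub>F w in at z. w \<noteq> z" by (auto simp: eventually_at_filter)
  ultimately show ?thesis using F(3) by eventually_elim simp
qed

lemma vtheta_not_identically_zero:
  assumes "Im \<tau> > 0"
  obtains \<beta> where "vtheta \<beta> \<tau> \<noteq> 0"
proof -
  have "integral {0..1} (\<lambda>x::real. fseries (theta_coeff \<tau>) (1/2) (of_real x) * expi (- (of_int 0 + 1/2) * of_real x)) \<noteq> 0"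
    unfolding fseries_coeff[OF rapid_theta_coeff[OF assms]] by simp
  hence "\<not> (\<forall>x. vtheta x \<tau> = 0)" unfolding vtheta_eq_fseries[symmetric] by auto
  thus ?thesis using that by blast
qed

text \<open>If C were 0, one factor would vanish at each point near 0. But the Appell factor has
  nonzero residue at 0, and theta, having a nonzero Fourier coefficient, has isolated zeros.\<close>

lemma appell_theta_times_vtheta:
  assumes \<tau>: "Im \<tau> > 0"
  obtains C where "C \<noteq> 0" "\<And>z. z \<notin> lattice \<tau> \<Longrightarrow> appell_theta \<tau> z * vtheta z \<tau> = C"
proof -
  obtain C where C: "\<And>z. z \<notin> lattice \<tau> \<Longrightarrow> appell_theta \<tau> z * vtheta z \<tau> = C"
    using appell_theta_times_constant[OF \<tau> vtheta_holomorphic[OF \<tau>] vtheta_add_1 vtheta_add_tau vtheta_zero_on_lattice] by blast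
  have "polar (appell_theta \<tau>) 0 (expi (0 / 2) * (- theta_coeff \<tau> 0 / (2 * pi * \<i>)))"
    unfolding appell_theta_def[abs_def]
    by (intro polar_mult appell_polar \<tau> rapid_theta_coeff analytic_intros) auto
  hence 1: "\<forall>\<^sub>F z in at 0. appell_theta \<tau> z \<noteq> 0" by (rule polar_nonzero) simp
  obtain \<beta> where "vtheta \<beta> \<tau> \<noteq> 0" using vtheta_not_identically_zero[OF \<tau>] by blast
  hence 2: "\<forall>\<^sub>F z in at 0. vtheta z \<tau> \<noteq> 0"
    by (intro non_zero_neighbour_alt[of "\<lambda>z. vtheta z \<tau>" UNIV 0 \<beta>, THEN eventually_mono] vtheta_holomorphic \<tau>) auto
  have 3: "\<forall>\<^sub>F z in at 0. z \<notin> lattice \<tau>"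
    using appell_regular_near[OF \<tau>, of 0] by (simp add: lattice_iff)
  have "\<forall>\<^sub>F z in at (0::complex). C \<noteq> 0"
    using 1 2 3 by eventually_elim (use C in force)
  hence "C \<noteq> 0" by simp
  thus ?thesis using that C by blast
qed

lemma vtheta_nonzero:
  assumes "Im \<tau> > 0" "z \<notin> lattice \<tau>"
  shows "vtheta z \<tau> \<noteq> 0"
  using appell_theta_times_vtheta[OF assms(1)] assms(2) by (metis mult_zero_right)

lemma Im_minus_inverse: "Im \<tau> > 0 \<Longrightarrow> Im (- 1 / \<tau>) > 0"
  by (simp add: Im_divide power2_eq_square add_nonneg_pos divide_pos_pos)

text \<open>In the variable z/\<tau> the periods change roles: z + 1 is a step back by the dual
  period -1/\<tau>, and z + \<tau> is a step by 1. With the Gaussian factor the dual theta thus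
  acquires the multipliers of theta.\<close>

lemma vtheta_inversion:
  assumes \<tau>: "Im \<tau> > 0"
  obtains \<kappa> where "\<kappa> \<noteq> 0" "\<And>z. expi (- (z ^ 2) / (2 * \<tau>)) * vtheta (z / \<tau>) (- 1 / \<tau>) = \<kappa> * vtheta z \<tau>"
proof -
  define \<tau>' where "\<tau>' = - 1 / \<tau>"
  have \<tau>': "Im \<tau>' > 0" unfolding \<tau>'_def by (rule Im_minus_inverse[OF \<tau>])
  have nz: "\<tau> \<noteq> 0" using \<tau> by auto
  define g where "g = (\<lambda>z. expi (- (z ^ 2) / (2 * \<tau>)) * vtheta (z / \<tau>) \<tau>')"
  have hol: "g holomorphic_on UNIV" unfolding g_def
    by (intro holomorphic_intros holomorphic_on_compose_gen[OF _ vtheta_holomorphic[OF \<tau>'], unfolded o_def])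
      (use nz in auto)
  have g1: "g (z + 1) = - g z" for z
  proof -
    have a: "(z + 1) / \<tau> + \<tau>' = z / \<tau>" using nz by (simp add: \<tau>'_def field_simps)
    have "vtheta (z / \<tau>) \<tau>' = - expi (- ((z + 1) / \<tau>) - \<tau>' / 2) * vtheta ((z + 1) / \<tau>) \<tau>'"
      using vtheta_add_tau[of "(z + 1) / \<tau>" \<tau>'] unfolding a .
    hence "- g z = (expi (- (z ^ 2) / (2 * \<tau>)) * expi (- ((z + 1) / \<tau>) - \<tau>' / 2)) * vtheta ((z + 1) / \<tau>) \<tau>'"
      by (simp add: g_def)
    also have "expi (- (z ^ 2) / (2 * \<tau>)) * expi (- ((z + 1) / \<tau>) - \<tau>' / 2) = expi (- ((z + 1) ^ 2) / (2 * \<tau>))"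
      unfolding expi_add[symmetric] using nz by (intro expi_cong) (simp add: \<tau>'_def field_simps power2_eq_square)
    finally show ?thesis by (simp add: g_def)
  qed
  have g\<tau>: "g (z + \<tau>) = - expi (- z - \<tau> / 2) * g z" for z
  proof -
    have a: "(z + \<tau>) / \<tau> = z / \<tau> + 1" using nz by (simp add: field_simps)
    have "g (z + \<tau>) = - expi (- ((z + \<tau>) ^ 2) / (2 * \<tau>)) * vtheta (z / \<tau>) \<tau>'"
      unfolding g_def a vtheta_add_1 by simp
    also have "expi (- ((z + \<tau>) ^ 2) / (2 * \<tau>)) = expi (- z - \<tau> / 2) * expi (- (z ^ 2) / (2 * \<tau>))"
      unfolding expi_add[symmetric] using nz by (intro expi_cong) (simp add: field_simps power2_eq_square)
    finally show ?thesis by (simp add: g_def)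
  qed
  have g0: "g z = 0" if "z \<in> lattice \<tau>" for z
    using vtheta_zero_on_lattice[of "z / \<tau>"] lattice_scaled_iff[OF nz, of z] that by (simp add: g_def \<tau>'_def)
  obtain C' where C': "\<And>z. z \<notin> lattice \<tau> \<Longrightarrow> appell_theta \<tau> z * g z = C'"
    using appell_theta_times_constant[OF \<tau> hol g1 g\<tau> g0] by blast
  obtain C where C: "C \<noteq> 0" "\<And>z. z \<notin> lattice \<tau> \<Longrightarrow> appell_theta \<tau> z * vtheta z \<tau> = C"
    using appell_theta_times_vtheta[OF \<tau>] by blast
  have eq: "g z = C' / C * vtheta z \<tau>" for z
  proof (cases "z \<in> lattice \<tau>")
    case False
    have "appell_theta \<tau> z \<noteq> 0" using C(2)[OF False] C(1) by auto
    moreover have "appell_theta \<tau> z * (C * g z) = appell_theta \<tau> z * (C' * vtheta z \<tau>)"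
      using C(2)[OF False] C'[OF False] by (metis mult.commute mult.left_commute)
    ultimately show ?thesis using C(1) by (simp add: field_simps)
  qed (simp add: g0 vtheta_zero_on_lattice)
  \<comment> \<open>That the constant is nonzero is tested at one point where the dual theta does
    not vanish.\<close>
  obtain \<beta> where "vtheta \<beta> \<tau>' \<noteq> 0" using vtheta_not_identically_zero[OF \<tau>'] by blast
  hence "g (\<beta> * \<tau>) \<noteq> 0" using nz by (simp add: g_def)
  hence "C' / C \<noteq> 0" using eq[of "\<beta> * \<tau>"] by auto
  thus ?thesis using that eq unfolding g_def \<tau>'_def by blast
qed

lemma vtheta_quotient_inversion:
  assumes \<tau>: "Im \<tau> > 0"
  shows "vtheta (x - u) \<tau> / vtheta u \<tau> =
    expi (- (x ^ 2 - 2 * x * u) / (2 * \<tau>)) * (vtheta (x / \<tau> - u / \<tau>) (- 1 / \<tau>) / vtheta (u / \<tau>) (- 1 / \<tau>))"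
proof -
  have nz: "\<tau> \<noteq> 0" using \<tau> by auto
  obtain \<kappa> where \<kappa>: "\<kappa> \<noteq> 0" "\<And>z. expi (- (z ^ 2) / (2 * \<tau>)) * vtheta (z / \<tau>) (- 1 / \<tau>) = \<kappa> * vtheta z \<tau>"
    using vtheta_inversion[OF \<tau>] by blast
  have "vtheta (x - u) \<tau> / vtheta u \<tau> = (\<kappa> * vtheta (x - u) \<tau>) / (\<kappa> * vtheta u \<tau>)" using \<kappa>(1) by simp
  also have "\<dots> = (expi (- ((x - u) ^ 2) / (2 * \<tau>)) / expi (- (u ^ 2) / (2 * \<tau>))) * (vtheta ((x - u) / \<tau>) (- 1 / \<tau>) / vtheta (u / \<tau>) (- 1 / \<tau>))"
    unfolding \<kappa>(2)[symmetric] by simp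
  also have "expi (- ((x - u) ^ 2) / (2 * \<tau>)) / expi (- (u ^ 2) / (2 * \<tau>)) = expi (- (x ^ 2 - 2 * x * u) / (2 * \<tau>))"
    unfolding expi_diff[symmetric] using nz by (intro expi_cong) (simp add: field_simps power2_eq_square)
  finally show ?thesis by (simp add: diff_divide_distrib)
qed

subsection \<open>Fourier coefficients by unfolding\<close>

text \<open>The representatives -k are chosen non-positive so that k matches the shifts z - k in the
  inversion formula.\<close>

lemma bij_betw_residues:
  assumes "N > 0"
  shows "bij_betw (\<lambda>(t, k). int N * t - int k) (UNIV \<times> {..<N}) (UNIV :: int set)"
proof (rule bij_betwI[of _ _ _ "\<lambda>l. (- ((- l) div int N), nat ((- l) mod int N))"])
  let ?f = "\<lambda>l. (- ((- l) div int N), nat ((- l) mod int N))"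
  have pos: "int N > 0" using assms by simp
  show "?f \<in> UNIV \<rightarrow> UNIV \<times> {..<N}"
    using pos by (auto simp: nat_less_iff)
  fix x assume x: "x \<in> (UNIV :: int set) \<times> {..<N}"
  then obtain t k where tk: "x = (t, k)" "k < N" by auto
  have "(- (int N * t - int k)) div int N = (int k + int N * (- t)) div int N" by (simp add: algebra_simps)
  also have "\<dots> = - t" using tk pos by (subst div_mult_self2) auto
  finally have d: "(- (int N * t - int k)) div int N = - t" .
  have "(- (int N * t - int k)) mod int N = (int k + int N * (- t)) mod int N" by (simp add: algebra_simps)
  also have "\<dots> = int k" using tk by (subst mod_mult_self2) auto
  finally have m: "(- (int N * t - int k)) mod int N = int k" .
  show "?f ((\<lambda>(t, k). int N * t - int k) x) = x"
    unfolding tk(1) prod.case d m by simp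
next
  fix l :: int
  have pos: "int N > 0" using assms by simp
  have "int N * ((- l) div int N) + (- l) mod int N = - l" by simp
  moreover have "int (nat ((- l) mod int N)) = (- l) mod int N" using pos by simp
  ultimately show "(\<lambda>(t, k). int N * t - int k) (- ((- l) div int N), nat ((- l) mod int N)) = l"
    unfolding prod.case by (simp only: mult_minus_right)
qed auto

text \<open>The unit intervals [-t, 1 - t] with -n \<le> t \<le> n tile [-n, n + 1], which is not
  symmetric about 0.\<close>

lemma sum_unit_integrals:
  fixes g :: "real \<Rightarrow> complex"
  assumes "continuous_on UNIV g"
  shows "(\<Sum>t = - int n..int n. integral {0..1} (\<lambda>x. g (x - of_int t))) = integral {- real n..real n + 1} g"
proof -
  have int: "g integrable_on {a..b}" for a b
    by (intro integrable_continuous_interval continuous_on_subset[OF assms]) auto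
  have sh: "integral {0..1} (\<lambda>x. g (x - of_int t)) = integral {- of_int t..1 - of_int t} g" for t
    using integral_shift_Icc_real[of 0 1 g "- of_int t"] by (simp add: o_def add.commute)
  show ?thesis
  proof (induction n)
    case 0
    show ?case using sh[of 0] by simp
  next
    case (Suc n)
    have "{- int (Suc n)..int (Suc n)} = insert (- int (Suc n)) (insert (int (Suc n)) {- int n..int n})"
      by auto
    hence "(\<Sum>t = - int (Suc n)..int (Suc n). integral {0..1} (\<lambda>x. g (x - of_int t)))
      = integral {0..1} (\<lambda>x. g (x - of_int (- int (Suc n)))) + (integral {0..1} (\<lambda>x. g (x - of_int (int (Suc n)))) + integral {- real n..real n + 1} g)"
      by (simp add: Suc.IH)
    also have "integral {0..1} (\<lambda>x. g (x - of_int (- int (Suc n)))) = integral {real n + 1..real n + 2} g"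
      by (subst sh) (simp add: algebra_simps)
    also have "integral {0..1} (\<lambda>x. g (x - of_int (int (Suc n)))) = integral {- 1 - real n..- real n} g"
      by (subst sh) (simp add: algebra_simps)
    also have "integral {- 1 - real n..- real n} g + integral {- real n..real n + 1} g = integral {- 1 - real n..real n + 1} g"
      by (rule Henstock_Kurzweil_Integration.integral_combine) (auto intro: int)
    also have "integral {real n + 1..real n + 2} g + integral {- 1 - real n..real n + 1} g = integral {- 1 - real n..real n + 2} g"
      by (subst add.commute, rule Henstock_Kurzweil_Integration.integral_combine) (auto intro: int)
    finally show ?case by (simp add: algebra_simps)
  qed
qed

text \<open>Writing l = N t - k, the hypothesis \<open>shift\<close> moves the unit interval by -t,
  so each residue class modulo N tiles the line. Unconditional summability permits the limit along
  the boxes |t| \<le> n.\<close>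

lemma unfold_periodization:
  fixes T :: "int \<Rightarrow> real \<Rightarrow> complex"
  assumes N: "N > 0" and shift: "\<And>l x. T (l + int N) x = T l (x - 1)"
    and cont: "\<And>l. continuous_on UNIV (T l)"
    and dom: "\<And>l. (\<lambda>x. norm (T l x)) integrable_on UNIV"
    and sum: "((\<lambda>l. integral {0..1} (T l)) has_sum I) UNIV"
  shows "I = (\<Sum>k<N. integral UNIV (T (- int k)))"
proof -
  let ?s = "\<lambda>n. \<Sum>(t, k)\<in>{- int n..int n} \<times> {..<N}. integral {0..1} (T (int N * t - int k))"
  let ?r = "\<lambda>n. \<Sum>k<N. integral {- real n..real n + 1} (T (- int k))"
  have shift': "T (int N * t + l) x = T l (x - of_int t)" for t l x
  proof (induction t arbitrary: x rule: int_induct[of _ 0])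
    case (step1 t)
    have "int N * (t + 1) + l = int N * t + l + int N" by (simp add: algebra_simps)
    hence "T (int N * (t + 1) + l) x = T (int N * t + l) (x - 1)" by (simp only: shift)
    also have "\<dots> = T l (x - 1 - of_int t)" by (rule step1(2))
    finally show ?case by (simp add: algebra_simps)
  next
    case (step2 t)
    have "T (int N * (t - 1) + l) x = T (int N * (t - 1) + l + int N) (x + 1)" by (simp add: shift)
    also have "int N * (t - 1) + l + int N = int N * t + l" by (simp add: algebra_simps)
    also have "T (int N * t + l) (x + 1) = T l (x + 1 - of_int t)" by (rule step2(2))
    finally show ?case by (simp add: algebra_simps)
  qed auto
  have "((\<lambda>(t, k). integral {0..1} (T (int N * t - int k))) has_sum I) (UNIV \<times> {..<N})"
    using has_sum_reindex_bij_betw[OF bij_betw_residues[OF N], of "\<lambda>l. integral {0..1} (T l)" I] sum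
    by (simp add: case_prod_unfold)
  hence "((\<lambda>X. \<Sum>(t, k)\<in>X. integral {0..1} (T (int N * t - int k))) \<longlongrightarrow> I) (finite_subsets_at_top (UNIV \<times> {..<N}))"
    by (simp add: has_sum_def)
  moreover have "filterlim (\<lambda>n. {- int n..int n} \<times> {..<N}) (finite_subsets_at_top (UNIV \<times> {..<N})) sequentially"
    unfolding filterlim_finite_subsets_at_top
  proof (intro allI impI)
    fix X :: "(int \<times> nat) set" assume X: "finite X \<and> X \<subseteq> UNIV \<times> {..<N}"
    have "\<forall>\<^sub>F n in sequentially. \<forall>p\<in>X. p \<in> {- int n..int n} \<times> {..<N}"
    proof (intro eventually_ball_finite ballI)
      fix p assume "p \<in> X"
      hence "p \<in> {- int n..int n} \<times> {..<N}" if "n \<ge> nat \<bar>fst p\<bar>" for n using X that by (cases p) auto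
      thus "\<forall>\<^sub>F n in sequentially. p \<in> {- int n..int n} \<times> {..<N}" by (rule eventually_sequentiallyI)
    qed (use X in auto)
    thus "\<forall>\<^sub>F n in sequentially. finite ({- int n..int n} \<times> {..<N}) \<and> X \<subseteq> {- int n..int n} \<times> {..<N} \<and> {- int n..int n} \<times> {..<N} \<subseteq> UNIV \<times> {..<N}"
      by eventually_elim auto
  qed
  ultimately have "?s \<longlonglongrightarrow> I"
    by (rule filterlim_compose)
  moreover have "?s n
      = ?r n" for n
  proof -
    have "?s n
       = (\<Sum>k<N. \<Sum>t = - int n..int n. integral {0..1} (T (int N * t - int k)))"
      unfolding sum.cartesian_product[symmetric] by (rule sum.swap)
    also have "\<dots> = (\<Sum>k<N. \<Sum>t = - int n..int n. integral {0..1} (\<lambda>x. T (- int k) (x - of_int t)))"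
      using shift'[of _ "- int _"] by (intro sum.cong refl arg_cong[where f = "integral {0..1}"]) auto
    also have "\<dots> = ?r n"
      by (intro sum.cong refl sum_unit_integrals cont)
    finally show ?thesis .
  qed
  ultimately have "?r \<longlonglongrightarrow> I" by simp
  moreover have "?r \<longlonglongrightarrow> (\<Sum>k<N. integral UNIV (T (- int k)))"
  proof (intro tendsto_sum integral_UNIV_limit[OF continuous_dominated_integrable[OF cont dom] dom])
    show "filterlim (\<lambda>n. - real n) at_bot sequentially"
      using filterlim_real_sequentially by (simp add: filterlim_uminus_at_bot)
    show "filterlim (\<lambda>n. real n + 1) at_top sequentially"
      by (rule filterlim_at_top_mono[OF filterlim_real_sequentially]) auto
  qed auto
  ultimately show ?thesis by (rule LIMSEQ_unique)
qed

text \<open>The principal root of a number in the right half-plane has positive real part. This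
  survives positive scaling and inversion, and it characterizes the principal root among the
  two.\<close>

lemma csqrt_scale:
  fixes w :: complex
  assumes "Re w > 0" "N > 0"
  shows "csqrt (of_nat N * w) = of_real (sqrt (real N)) * csqrt w" (is ?A)
    "csqrt (of_nat N / w) = of_real (sqrt (real N)) / csqrt w" (is ?B)
proof -
  define c where "c = csqrt w"
  have c2: "c ^ 2 = w" by (simp add: c_def)
  have re: "Re c > 0"
  proof (rule ccontr)
    assume "\<not> ?thesis"
    hence "Re c = 0" using csqrt_principal[of w] by (auto simp: c_def)
    hence "Re (c ^ 2) \<le> 0" by (simp add: power2_eq_square)
    thus False using assms(1) by (simp add: c2)
  qed
  define r where "r = sqrt (real N)"
  have r: "r > 0" using assms(2) by (simp add: r_def)
  have r2: "(complex_of_real r)\<^sup>2 = of_nat N"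
    by (simp add: r_def flip: of_real_power)
  have "csqrt (of_nat N * w) = of_real r * c"
    by (rule csqrt_unique) (use re r in \<open>simp_all add: power_mult_distrib r2 c2\<close>)
  thus ?A by (simp add: r_def c_def)
  have "(Re c)\<^sup>2 + (Im c)\<^sup>2 > 0" using re by (intro add_pos_nonneg) auto
  hence "Re (of_real r / c) > 0" using re r by (simp add: Re_divide)
  hence "csqrt (of_nat N / w) = of_real r / c"
    by (intro csqrt_unique) (simp_all add: power_divide r2 c2)
  thus ?B by (simp add: r_def c_def)
qed

lemma gauss_eq_expi:
  assumes "\<tau> \<noteq> 0"
  shows "gauss (\<i> * of_nat N / \<tau>) (\<i> * \<sigma>) x = expi (- (of_nat N * of_real x ^ 2) / (2 * \<tau>) + \<sigma> * of_real x)"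
  unfolding gauss_def expi_def using assms by (intro arg_cong[where f = exp]) (simp add: field_simps)

text \<open>Shifting $l$ by $N$ in the $l$-th summand of the integrand amounts to shifting $x$ by $1$, so the
  integral over the unit interval becomes $N$ Gaussian integrals over the real line.\<close>

lemma fseries_inversion_coeff:
  fixes \<tau> S :: complex and b :: "int \<Rightarrow> complex"
  assumes \<tau>: "Im \<tau> > 0" and N: "N > 0" and b: "rapid b"
    and rec: "\<And>l. b (l + int N) = (-1) ^ N * expi (- S / \<tau>) * expi (of_int (l + int N) * (- 1 / \<tau>)) * b l"
  shows "integral {0..1} (\<lambda>x::real. fseries b (of_nat N / 2) (of_real x / \<tau>) *
      (expi (- (of_nat N * of_real x ^ 2 - 2 * of_real x * S) / (2 * \<tau>)) * expi (- (of_int m + of_nat N / 2) * of_real x)))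
    = csqrt (- \<i> * \<tau>) / of_real (sqrt (real N)) *
      (\<Sum>k<N. b (- int k) * expi ((S - of_nat k + of_nat N / 2 - (of_int m + of_nat N / 2) * \<tau>) ^ 2 / (2 * of_nat N * \<tau>)))"
proof -
  let ?n = "of_nat N :: complex"
  let ?g = "\<lambda>k::nat. expi ((S - of_nat k + ?n / 2 - (of_int m + ?n / 2) * \<tau>) ^ 2 / (2 * ?n * \<tau>))"
  have nz: "\<tau> \<noteq> 0" using \<tau> by auto
  define a where "a = \<i> * ?n / \<tau>"
  have w: "Re (- \<i> * \<tau>) > 0" using \<tau> by simp
  have a: "a = ?n / (- \<i> * \<tau>)" using nz by (simp add: a_def field_simps)
  have "Re a > 0"
    using \<tau> N by (simp add: a_def Re_divide Im_divide power2_eq_square add_nonneg_pos divide_pos_pos)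
  note a_pos = this
  \<comment> \<open>Everything linear in x: the l-th frequency divided by \<tau>, the S-term of the
    theta inversion, and the frequency whose coefficient is extracted.\<close>
  define \<sigma> where "\<sigma> = (\<lambda>l::int. (of_int l + ?n / 2 + S) / \<tau> - (of_int m + ?n / 2))"
  define W where "W = (\<lambda>x::real. expi (- (?n * of_real x ^ 2 - 2 * of_real x * S) / (2 * \<tau>)) * expi (- (of_int m + ?n / 2) * of_real x))"
  define T where "T = (\<lambda>l x. b l * gauss a (\<i> * \<sigma> l) x)"
  have T: "T l x = b l * expi (- (?n * of_real x ^ 2) / (2 * \<tau>) + \<sigma> l * of_real x)" for l x
    unfolding T_def a_def gauss_eq_expi[OF nz] ..
  have "((\<lambda>l. integral {0..1} (\<lambda>x. b l * expi ((of_int l + ?n / 2) * (of_real x * (1 / \<tau>))) *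
      W x)) has_sum
     integral {0..1} (\<lambda>x. fseries b (?n / 2) (of_real x * (1 / \<tau>)) *
      W x)) UNIV"
    by (rule fseries_times_has_sum_integral[OF b]) (use nz in \<open>auto simp: W_def intro!: continuous_intros\<close>)
  moreover have "b l * expi ((of_int l + ?n / 2) * (of_real x * (1 / \<tau>))) *
      W x = T l x" for l x
    unfolding T W_def mult.assoc expi_add[symmetric] using nz
    by (intro arg_cong[where f = "\<lambda>z. b l * expi z"]) (simp add: \<sigma>_def field_simps)
  ultimately have "((\<lambda>l. integral {0..1} (T l)) has_sum
     integral {0..1} (\<lambda>x. fseries b (?n / 2) (of_real x / \<tau>) *
      W x)) UNIV"
    by simp
  moreover have "T (l + int N) x = T l (x - 1)" for l x
  proof -
    have sg: "(-1) ^ N = expi (?n / 2)"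
      using expi_power[of "1/2" N] by (simp add: expi_half)
    have "T (l + int N) x = b l * expi (?n / 2 + - S / \<tau> + of_int (l + int N) * (- 1 / \<tau>) + (- (?n * of_real x ^ 2) / (2 * \<tau>) + \<sigma> (l + int N) * of_real x))"
      unfolding T rec sg expi_add by (simp only: mult_ac)
    also have "expi (?n / 2 + - S / \<tau> + of_int (l + int N) * (- 1 / \<tau>) + (- (?n * of_real x ^ 2) / (2 * \<tau>) + \<sigma> (l + int N) * of_real x))
       = expi (- (?n * of_real (x - 1) ^ 2) / (2 * \<tau>) + \<sigma> l * of_real (x - 1))"
    \<comment> \<open>The recursion supplies exactly the factor needed to pass from x to x - 1 in
      the Gaussian; the two exponents differ by the integer -m.\<close>
    by (rule expi_eq_of_int[of _ _ "- m"]) (use nz in \<open>simp add: \<sigma>_def field_simps power2_eq_square\<close>)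
    finally show ?thesis unfolding T .
  qed
  moreover have "continuous_on UNIV (T l)" for l unfolding T_def by (intro continuous_intros continuous_gauss)
  moreover have "(\<lambda>x. norm (T l x)) integrable_on UNIV" for l
    unfolding T_def norm_mult by (intro integrable_on_mult_right gauss_norm_integrable a_pos)
  ultimately have "integral {0..1} (\<lambda>x. fseries b (?n / 2) (of_real x / \<tau>) *
      W x)
     = (\<Sum>k<N. integral UNIV (T (- int k)))"
    using N by (intro unfold_periodization)
  also have "\<dots> = (\<Sum>k<N. csqrt (- \<i> * \<tau>) / of_real (sqrt (real N)) *
      (b (- int k) * ?g k))"
  proof (rule sum.cong[OF refl])
    fix k
    have \<sigma>: "\<sigma> (- int k) = (S - of_nat k + ?n / 2 - (of_int m + ?n / 2) * \<tau>) / \<tau>"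
      using nz by (simp add: \<sigma>_def field_simps)
    have "integral UNIV (T (- int k)) = b (- int k) * integral UNIV (gauss a (\<i> * \<sigma> (- int k)))"
      unfolding T_def by simp
    also have "integral UNIV (gauss a (\<i> * \<sigma> (- int k))) = exp (pi * (\<i> * \<sigma> (- int k)) ^ 2 / a) / csqrt a"
      by (rule gauss_integral[OF a_pos])
    also have "csqrt a = of_real (sqrt (real N)) / csqrt (- \<i> * \<tau>)"
      unfolding a by (rule csqrt_scale(2)[OF w N])
    also have "exp (pi * (\<i> * \<sigma> (- int k)) ^ 2 / a) = ?g k"
      unfolding \<sigma> expi_def a_def using nz N
      by (intro arg_cong[where f = exp]) (simp add: power_divide power_mult_distrib, simp add: field_simps power2_eq_square)
    finally show "integral UNIV (T (- int k)) = csqrt (- \<i> * \<tau>) / of_real (sqrt (real N)) *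
      (b (- int k) * ?g k)" by simp
  qed
  finally show ?thesis unfolding W_def sum_distrib_left .
qed

subsection \<open>Inversion of Appell sums\<close>

text \<open>The properties of the Fourier coefficients of $\prod_{j=1}^N \vartheta(x - u_j) / \vartheta(u_j)$ with
  $S = u_1 + \dots + u_N$ that determine the functional equations of the Appell sum; the last
  one is the value at $x = 0$.\<close>

definition quasi_theta_coeffs :: "nat \<Rightarrow> complex \<Rightarrow> complex \<Rightarrow> (int \<Rightarrow> complex) \<Rightarrow> bool" where
  "quasi_theta_coeffs N S \<tau> b \<longleftrightarrow> rapid b \<and>
     (\<forall>m. b (m + int N) = (-1) ^ N * expi (- S) * expi (of_int (m + int N) * \<tau>) * b m) \<and>
     (\<Sum>\<^sub>\<infinity>m. b m) = (-1) ^ N"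

text \<open>The prefactor of mu once its summands are written with theta coefficients: e(z/2) is the
  factor of u_0, and each u_j with j \<ge> 1 contributes e(-1/4 - \<tau>/8 + u_j/2).\<close>

definition appell_mu :: "nat \<Rightarrow> complex \<Rightarrow> complex \<Rightarrow> (int \<Rightarrow> complex) \<Rightarrow> complex \<Rightarrow> complex" where
  "appell_mu N S \<tau> b z = expi (- of_nat N / 4 - of_nat N * \<tau> / 8 + S / 2 + z / 2) * appell b \<tau> z"

lemma minus_1_power: "(-1) ^ N = expi (of_nat N / 2)"
  using expi_power[of "1/2" N] by (simp add: expi_half)

lemma minus_i_power: "(- \<i>) ^ N = expi (- of_nat N / 4)"
proof -
  have "- \<i> = expi (- (1/4))" by (simp add: expi_minus expi_quarter)
  thus ?thesis using expi_power[of "- (1/4)" N] by simp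
qed

lemma appell_mu_add_1: "appell_mu N S \<tau> b (z + 1) = - appell_mu N S \<tau> b z"
proof -
  have "expi (- of_nat N / 4 - of_nat N * \<tau> / 8 + S / 2 + (z + 1) / 2) = expi (- of_nat N / 4 - of_nat N * \<tau> / 8 + S / 2 + z / 2 + 1/2)"
    by (rule expi_cong) (simp add: field_simps)
  thus ?thesis unfolding appell_mu_def appell_add_1 by (simp add: expi_add[of _ "1/2"] expi_half)
qed

lemma appell_mu_add_of_nat: "appell_mu N S \<tau> b (z + of_nat n) = (-1) ^ n * appell_mu N S \<tau> b z"
proof (induction n)
  case (Suc n)
  thus ?case using appell_mu_add_1[of N S \<tau> b "z + of_nat n"] by (simp add: add_ac)
qed simp

lemma appell_mu_analytic:
  assumes "Im \<tau> > 0" "quasi_theta_coeffs N S \<tau> b" "z \<notin> lattice \<tau>"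
  shows "appell_mu N S \<tau> b analytic_on {z}"
  unfolding appell_mu_def[abs_def]
  by (intro analytic_intros appell_analytic) (use assms in \<open>auto simp: quasi_theta_coeffs_def lattice_iff\<close>)

lemma appell_mu_polar:
  assumes "Im \<tau> > 0" "quasi_theta_coeffs N S \<tau> b" "expi (z + of_int k * \<tau>) = 1"
  shows "polar (appell_mu N S \<tau> b) z
     (expi (- of_nat N / 4 - of_nat N * \<tau> / 8 + S / 2 + z / 2) * (- b k / (2 * pi * \<i>)))"
  unfolding appell_mu_def[abs_def]
  by (intro polar_mult appell_polar analytic_intros) (use assms in \<open>auto simp: quasi_theta_coeffs_def\<close>)

text \<open>The inhomogeneous term uses only the total (-1)^N of the coefficients; the Mordell
  integral has to cancel it.\<close>

lemma appell_mu_add_tau: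
  assumes \<tau>: "Im \<tau> > 0" and b: "quasi_theta_coeffs N S \<tau> b" and z: "z \<notin> lattice \<tau>"
  shows "appell_mu N S \<tau> b (z + of_nat N * \<tau>) =
     expi (of_nat N / 2 + of_nat N * \<tau> / 2 + z + S) * appell_mu N S \<tau> b z + expi (of_nat N / 4 + 3 * of_nat N * \<tau> / 8 + (z + S) / 2)"
proof -
  let ?n = "of_nat N :: complex"
  have "appell b \<tau> (z + of_int (int N) * \<tau>) = (\<Sum>\<^sub>\<infinity>m. b m) + inverse ((-1) ^ N * expi (- S)) * expi z * appell b \<tau> z"
    by (rule appell_quasi_periodic[OF \<tau>]) (use b z in \<open>auto simp: quasi_theta_coeffs_def lattice_iff mult_ac\<close>)
  also have "(\<Sum>\<^sub>\<infinity>m. b m) = expi (?n / 2)"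
    using b by (simp add: quasi_theta_coeffs_def minus_1_power)
  also have "inverse ((-1) ^ N * expi (- S)) * expi z = expi (?n / 2 + S + z)"
  proof -
    have "inverse ((-1) ^ N * expi (- S)) = (-1) ^ N * expi S" by (simp add: expi_minus field_simps)
    thus ?thesis by (simp add: minus_1_power expi_add)
  qed
  finally have A: "appell b \<tau> (z + ?n * \<tau>) = expi (?n / 2) + expi (?n / 2 + S + z) * appell b \<tau> z" by simp
  have 1: "expi (- ?n / 4 - ?n * \<tau> / 8 + S / 2 + (z + ?n * \<tau>) / 2) * expi (?n / 2) = expi (?n / 4 + 3 * ?n * \<tau> / 8 + (z + S) / 2)"
    unfolding expi_add[symmetric] by (rule expi_cong) (simp add: field_simps)
  have 2: "expi (- ?n / 4 - ?n * \<tau> / 8 + S / 2 + (z + ?n * \<tau>) / 2) * expi (?n / 2 + S + z)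
     = expi (?n / 2 + ?n * \<tau> / 2 + z + S) * expi (- ?n / 4 - ?n * \<tau> / 8 + S / 2 + z / 2)"
    unfolding expi_add[symmetric] by (rule expi_cong) (simp add: field_simps)
  show ?thesis unfolding appell_mu_def A distrib_left 1 mult.assoc[symmetric] 2 by simp
qed

lemma mordell_h_add_tau_expi:
  assumes "Im \<tau> > 0"
  shows "mordell_h (w + \<tau>) \<tau> = 2 * expi (w / 2 + 3 * \<tau> / 8) - expi (w + \<tau> / 2) * mordell_h w \<tau>"
proof -
  have "exp (- 2 * pi * \<i> * w - pi * \<i> * \<tau>) = expi (- (w + \<tau> / 2))"
    "exp (- pi * \<i> * \<tau> / 4 - pi * \<i> * w) = expi (- (\<tau> / 8 + w / 2))"
    unfolding expi_def by (rule arg_cong[where f = exp], simp add: field_simps)+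
  with mordell_h_add_tau[OF assms, of w]
  have *: "mordell_h w \<tau> + expi (- (w + \<tau> / 2)) * mordell_h (w + \<tau>) \<tau> = 2 * expi (- (\<tau> / 8 + w / 2))" by simp
  have "expi (w + \<tau> / 2) * (mordell_h w \<tau> + expi (- (w + \<tau> / 2)) * mordell_h (w + \<tau>) \<tau>)
     = expi (w + \<tau> / 2) * mordell_h w \<tau> + mordell_h (w + \<tau>) \<tau>"
    unfolding expi_minus[of "w + \<tau> / 2"] by (simp add: distrib_left)
  moreover have "expi (w + \<tau> / 2) * (2 * expi (- (\<tau> / 8 + w / 2))) = 2 * (expi (w + \<tau> / 2) * expi (- (\<tau> / 8 + w / 2)))" by simp
  moreover have "expi (w + \<tau> / 2) * expi (- (\<tau> / 8 + w / 2)) = expi (w / 2 + 3 * \<tau> / 8)"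
    unfolding expi_add[symmetric] by (rule expi_cong) (simp add: field_simps)
  ultimately show ?thesis unfolding * by (simp add: algebra_simps)
qed

text \<open>At the modulus N\<tau> the Gaussian integral produces the factors sqrt N and
  sqrt(-i\<tau>) of the inversion formula.\<close>

lemma mordell_h_add_1_expi:
  assumes \<tau>: "Im \<tau> > 0" and N: "N > 0"
  shows "mordell_h w (of_nat N * \<tau>) + mordell_h (w + 1) (of_nat N * \<tau>) =
    2 * expi ((w + 1/2) ^ 2 / (2 * of_nat N * \<tau>)) / (of_real (sqrt (real N)) * csqrt (- \<i> * \<tau>))"
proof -
  have "Im (of_nat N * \<tau>) > 0" using assms by simp
  from mordell_h_add_1[OF this, of w]
  have "mordell_h w (of_nat N * \<tau>) + mordell_h (w + 1) (of_nat N * \<tau>)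
     = 2 * exp (pi * \<i> * (w + 1/2) ^ 2 / (of_nat N * \<tau>)) / csqrt (- \<i> * (of_nat N * \<tau>))" .
  also have "- \<i> * (of_nat N * \<tau>) = of_nat N * (- \<i> * \<tau>)" by simp
  also have "csqrt (of_nat N * (- \<i> * \<tau>)) = of_real (sqrt (real N)) * csqrt (- \<i> * \<tau>)"
    by (rule csqrt_scale(1)) (use assms in auto)
  also have "exp (pi * \<i> * (w + 1/2) ^ 2 / (of_nat N * \<tau>)) = expi ((w + 1/2) ^ 2 / (2 * of_nat N * \<tau>))"
    unfolding expi_def by (rule arg_cong[where f = exp]) simp
  finally show ?thesis .
qed

text \<open>Transports the regularity of an anti-periodic function from one lattice point to its
  translates.\<close>

lemma polar_uminus_shift:
  assumes "polar f z \<rho>" "\<forall>\<^sub>F w in at (z + a). f w = - f (w - a)"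
  shows "polar f (z + a) (- \<rho>)"
proof -
  have "polar (\<lambda>w. f (1 * w + (- a))) (z + a) (\<rho> / 1)"
    by (rule polar_affine) (use assms(1) in auto)
  hence "polar (\<lambda>w. (- 1) * f (w - a)) (z + a) ((- 1) * \<rho>)"
    by (intro polar_mult[where g = "\<lambda>_. - 1"]) auto
  hence "polar (\<lambda>w. - f (w - a)) (z + a) (- \<rho>)" by simp
  thus ?thesis by (rule polar_cong) (use assms(2) in \<open>auto elim: eventually_mono\<close>)
qed

text \<open>With $U = z + S$ this is $e^{\pi i U^2/(N\tau)} \mu_N(z/\tau, \dots; -1/\tau)$. Absorbing the Gaussian into the
  function makes the right-hand side of (ii) an alternating sum over integer shifts of $z$.\<close>

definition appell_mu_transform :: "nat \<Rightarrow> complex \<Rightarrow> complex \<Rightarrow> (int \<Rightarrow> complex) \<Rightarrow> complex \<Rightarrow> complex" where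
  "appell_mu_transform N S \<tau> b z = expi ((z + S) ^ 2 / (2 * of_nat N * \<tau>)) * appell_mu N (S / \<tau>) (- 1 / \<tau>) b (z / \<tau>)"

text \<open>A shift of z by -N moves z/\<tau> by N times the dual period, so the quasi-period
  equation applies on the dual side. Completing the square merges its inhomogeneous term with the
  Gaussian.\<close>

lemma appell_mu_transform_diff_N:
  assumes \<tau>: "Im \<tau> > 0" and N: "N > 0" and b: "quasi_theta_coeffs N (S / \<tau>) (- 1 / \<tau>) b" and z: "z \<notin> lattice \<tau>"
  shows "appell_mu_transform N S \<tau> b (z - of_nat N) =
    (-1) ^ N * appell_mu_transform N S \<tau> b z + expi (of_nat N / 4 + (z + S - of_nat N / 2) ^ 2 / (2 * of_nat N * \<tau>))"
proof -
  let ?n = "of_nat N :: complex"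
  have nz: "\<tau> \<noteq> 0" "?n \<noteq> (0::complex)" using \<tau> N by auto
  have z': "z / \<tau> \<notin> lattice (- 1 / \<tau>)" using lattice_scaled_iff[OF nz(1)] z by blast
  have arg: "(z - ?n) / \<tau> = z / \<tau> + ?n * (- 1 / \<tau>)" using nz by (simp add: field_simps)
  have 1: "expi ((z - ?n + S) ^ 2 / (2 * ?n * \<tau>)) * expi (?n / 2 + ?n * (- 1 / \<tau>) / 2 + z / \<tau> + S / \<tau>)
     = expi (?n / 2) * expi ((z + S) ^ 2 / (2 * ?n * \<tau>))"
    unfolding expi_add[symmetric] using nz by (intro expi_cong) (simp add: field_simps power2_eq_square)
  have 2: "expi ((z - ?n + S) ^ 2 / (2 * ?n * \<tau>)) * expi (?n / 4 + 3 * ?n * (- 1 / \<tau>) / 8 + (z / \<tau> + S / \<tau>) / 2)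
     = expi (?n / 4 + (z + S - ?n / 2) ^ 2 / (2 * ?n * \<tau>))"
    unfolding expi_add[symmetric] using nz by (intro expi_cong) (simp add: field_simps power2_eq_square)
  show ?thesis
    unfolding appell_mu_transform_def arg appell_mu_add_tau[OF Im_minus_inverse[OF \<tau>] b z'] distrib_left mult.assoc[symmetric] 1 2
    by (simp add: minus_1_power)
qed

lemma appell_mu_transform_add_tau:
  assumes \<tau>: "Im \<tau> > 0" and N: "N > 0"
  shows "appell_mu_transform N S \<tau> b (z + of_nat N * \<tau>) =
    expi (of_nat N / 2 + of_nat N * \<tau> / 2 + z + S) * appell_mu_transform N S \<tau> b z"
proof -
  let ?n = "of_nat N :: complex"
  have nz: "\<tau> \<noteq> 0" "?n \<noteq> (0::complex)" using \<tau> N by auto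
  have arg: "(z + ?n * \<tau>) / \<tau> = z / \<tau> + ?n" using nz by (simp add: field_simps)
  have 1: "expi ((z + ?n * \<tau> + S) ^ 2 / (2 * ?n * \<tau>)) * expi (?n / 2)
     = expi (?n / 2 + ?n * \<tau> / 2 + z + S) * expi ((z + S) ^ 2 / (2 * ?n * \<tau>))"
    unfolding expi_add[symmetric] using nz by (intro expi_cong) (simp add: field_simps power2_eq_square)
  show ?thesis
    unfolding appell_mu_transform_def arg appell_mu_add_of_nat minus_1_power mult.assoc[symmetric] 1 by simp
qed

lemma appell_mu_transform_analytic:
  assumes \<tau>: "Im \<tau> > 0" and N: "N > 0" and b: "quasi_theta_coeffs N (S / \<tau>) (- 1 / \<tau>) b" and z: "z \<notin> lattice \<tau>"
  shows "appell_mu_transform N S \<tau> b analytic_on {z}"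
proof -
  have nz: "\<tau> \<noteq> 0" "of_nat N \<noteq> (0::complex)" using \<tau> N by auto
  have z': "z / \<tau> \<notin> lattice (- 1 / \<tau>)" using lattice_scaled_iff[OF nz(1)] z by blast
  have "(appell_mu N (S / \<tau>) (- 1 / \<tau>) b \<circ> (\<lambda>z. z / \<tau>)) analytic_on {z}"
    by (intro analytic_on_compose) (use appell_mu_analytic[OF Im_minus_inverse[OF \<tau>] b z'] nz in \<open>auto intro!: analytic_intros\<close>)
  thus ?thesis unfolding appell_mu_transform_def[abs_def] o_def
    using nz by (intro analytic_intros) auto
qed

text \<open>In the variable z/\<tau> the point is -m - k/\<tau>, and the singular index there is -k
  because -m - k/\<tau> + (-k)(-1/\<tau>) = -m. The factor \<tau> is the Jacobian of
  z/\<tau>.\<close>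

lemma appell_mu_transform_polar:
  assumes \<tau>: "Im \<tau> > 0" and N: "N > 0" and b: "quasi_theta_coeffs N (S / \<tau>) (- 1 / \<tau>) b"
  shows "polar (appell_mu_transform N S \<tau> b) (- of_int m * \<tau> - of_nat k)
    (expi ((- of_int m * \<tau> - of_nat k + S) ^ 2 / (2 * of_nat N * \<tau>)) *
      (expi (- of_nat N / 4 - of_nat N * (- 1 / \<tau>) / 8 + S / \<tau> / 2 + (- of_int m - of_nat k / \<tau>) / 2) * (- b (- int k) / (2 * pi * \<i>)) * \<tau>))"
proof -
  let ?n = "of_nat N :: complex"
  have nz: "\<tau> \<noteq> 0" "?n \<noteq> (0::complex)" using \<tau> N by auto
  let ?z = "- of_int m * \<tau> - of_nat k"
  have arg: "1 / \<tau> * ?z + 0 = - of_int m - of_nat k / \<tau>" using nz by (simp add: field_simps)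
  have "- of_int m - of_nat k / \<tau> + of_int (- int k) * (- 1 / \<tau>) = of_int (- m)" using nz by (simp add: field_simps)
  hence "expi (- of_int m - of_nat k / \<tau> + of_int (- int k) * (- 1 / \<tau>)) = 1" by (simp only: expi_of_int)
  from appell_mu_polar[OF Im_minus_inverse[OF \<tau>] b this]
  have "polar (\<lambda>z. appell_mu N (S / \<tau>) (- 1 / \<tau>) b (1 / \<tau> * z + 0)) ?z
     (expi (- ?n / 4 - ?n * (- 1 / \<tau>) / 8 + S / \<tau> / 2 + (- of_int m - of_nat k / \<tau>) / 2) * (- b (- int k) / (2 * pi * \<i>)) / (1 / \<tau>))"
    using nz by (intro polar_affine) (simp_all only: arg, auto)
  hence "polar (\<lambda>z. expi ((z + S) ^ 2 / (2 * ?n * \<tau>)) * appell_mu N (S / \<tau>) (- 1 / \<tau>) b (1 / \<tau> * z + 0)) ?z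
     (expi ((?z + S) ^ 2 / (2 * ?n * \<tau>)) * (expi (- ?n / 4 - ?n * (- 1 / \<tau>) / 8 + S / \<tau> / 2 + (- of_int m - of_nat k / \<tau>) / 2) * (- b (- int k) / (2 * pi * \<i>)) / (1 / \<tau>)))"
    using nz by (intro polar_mult[where g = "\<lambda>z. expi ((z + S) ^ 2 / (2 * ?n * \<tau>))"]) (auto intro!: analytic_intros)
  thus ?thesis unfolding appell_mu_transform_def[abs_def] by simp
qed

lemma appell_mu_inversion:
  fixes \<tau> S z :: complex and b b' :: "int \<Rightarrow> complex"
  assumes \<tau>: "Im \<tau> > 0" and N: "N > 0"
    and b: "quasi_theta_coeffs N S \<tau> b" and b': "quasi_theta_coeffs N (S / \<tau>) (- 1 / \<tau>) b'"
    and inv: "\<And>x::real. fseries b (of_nat N / 2) (of_real x) =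
       expi (- (of_nat N * of_real x ^ 2 - 2 * of_real x * S) / (2 * \<tau>)) * fseries b' (of_nat N / 2) (of_real x / \<tau>)"
    and z: "z \<notin> lattice \<tau>"
  shows "appell_mu N S \<tau> b z =
    (- \<i>) ^ (N + 1) / (of_real (sqrt (real N)) * csqrt (- \<i> * \<tau>)) * (\<Sum>k<N. (-1) ^ k * appell_mu_transform N S \<tau> b' (z - of_nat k))
    - (-1) ^ N * \<i> / 2 * mordell_h (z + S - (of_nat N - 1) / 2) (of_nat N * \<tau>)"
proof -
  let ?n = "of_nat N :: complex"
  let ?g = "\<lambda>(m::int) (k::nat). expi ((S - of_nat k + ?n / 2 - (of_int m + ?n / 2) * \<tau>) ^ 2 / (2 * ?n * \<tau>))"
  let ?Q = "\<lambda>w. (w + 1 + S - ?n / 2) ^ 2 / (2 * ?n * \<tau>)"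
  let ?m = "\<lambda>w. expi (?n / 2 + ?n * \<tau> / 2 + w + S)"
  let ?c = "\<lambda>(m::int) (k::nat). expi (- ?n / 4 - ?n * (- 1 / \<tau>) / 8 + S / \<tau> / 2 + (- of_int m - of_nat k / \<tau>) / 2)"
  let ?a = "\<lambda>z. expi (- ?n / 4 - ?n * \<tau> / 8 + S / 2 + z / 2)"
  let ?r = "\<lambda>w. expi ((w + S - (?n - 1) / 2) / 2 + 3 * (?n * \<tau>) / 8)"
  have nz: "\<tau> \<noteq> 0" "?n \<noteq> (0::complex)" using \<tau> N by auto
  define P where "P = appell_mu N S \<tau> b"
  define G where "G = appell_mu_transform N S \<tau> b'"
  define R where "R = (\<lambda>z. \<Sum>k<N. (-1) ^ k * G (z - of_nat k))"
  define H where "H = (\<lambda>z. mordell_h (z + S - (?n - 1) / 2) (?n * \<tau>))"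
  define s where "s = of_real (sqrt (real N)) * csqrt (- \<i> * \<tau>)"
  define C where "C = (- \<i>) ^ (N + 1) / s"
  define D where "D = (\<lambda>z. P z + ((- C) * R z + ((-1) ^ N * \<i> / 2) * H z))"
  have s: "s \<noteq> 0" using N nz by (simp add: s_def)
  have N\<tau>: "Im (?n * \<tau>) > 0" using \<tau> N by simp
  have lat: "w - of_nat k \<notin> lattice \<tau>" "w + 1 \<notin> lattice \<tau>" if "w \<notin> lattice \<tau>" for w k
    using that lattice_add_iff[of w "- int k" 0 \<tau>] lattice_add_iff[of w 1 0 \<tau>] by auto
  have reg: "\<forall>\<^sub>F w in at z0. w \<notin> lattice \<tau>" for z0
    using appell_regular_near[OF \<tau>, of z0] by (simp add: lattice_iff)

  have hol_H: "H holomorphic_on UNIV"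
    unfolding H_def
    by (intro holomorphic_on_compose_gen[OF _ mordell_h_holomorphic[OF N\<tau>], unfolded o_def] holomorphic_intros) auto
  hence an_H: "H analytic_on {w}" for w by (auto simp: analytic_at)
  have an_G: "(\<lambda>w. G (w - of_nat k)) analytic_on {w}" if "w \<notin> lattice \<tau>" for w k
  proof -
    have "(G \<circ> (\<lambda>w. w - of_nat k)) analytic_on {w}"
      unfolding G_def by (intro analytic_on_compose)
        (use appell_mu_transform_analytic[OF \<tau> N b' lat(1)[OF that, of k]] in \<open>auto intro!: analytic_intros\<close>)
    thus ?thesis by (simp add: o_def)
  qed
  have an_D: "D analytic_on {w}" if "w \<notin> lattice \<tau>" for w
    unfolding D_def R_def P_def by (intro analytic_intros an_H an_G that appell_mu_analytic \<tau> b)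

  \<comment> \<open>The alternating signs make R(w + 1) + R(w) telescope. The two end terms k = 0
    and k = N are related by the shift by N, so that only its inhomogeneous Gaussian
    survives.\<close>
  have R1: "R (w + 1) = - R w - expi (3 * ?n / 4 + ?Q w)" if w: "w \<notin> lattice \<tau>" for w
  proof -
    define f where "f = (\<lambda>k. (-1) ^ k * G (w + 1 - of_nat k))"
    have "R (w + 1) + R w = (\<Sum>k<N. f k - f (Suc k))"
      unfolding R_def f_def sum.distrib[symmetric] by (intro sum.cong) (auto simp: algebra_simps)
    also have "\<dots> = f 0 - f N" by (rule sum_lessThan_telescope')
    also have "f N = (-1) ^ N * ((-1) ^ N * G (w + 1) + expi (?n / 4 + ?Q w))"
      unfolding f_def G_def by (subst appell_mu_transform_diff_N[OF \<tau> N b' lat(2)[OF w]]) simp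
    also have "\<dots> = G (w + 1) + expi (?n / 2) * expi (?n / 4 + ?Q w)"
      by (simp add: distrib_left mult.assoc[symmetric] power_mult_distrib[symmetric] minus_1_power[symmetric])
    also have "expi (?n / 2) * expi (?n / 4 + ?Q w)
       = expi (3 * ?n / 4 + ?Q w)"
      unfolding expi_add[symmetric] by (rule expi_cong) simp
    finally have "R (w + 1) + R w = - expi (3 * ?n / 4 + ?Q w)"
      by (simp add: f_def)
    thus ?thesis by algebra
  qed
  have H1: "H (w + 1) = - H w + 2 * expi (?Q w) / s" for w
  proof -
    \<comment> \<open>Origin of the shift (N - 1)/2 in the Mordell argument: together with the 1/2
      of the functional equation it aligns this Gaussian with the one left over by
      \<open>R\<close>.\<close>
    have "w + S - (?n - 1) / 2 + 1/2 = w + 1 + S - ?n / 2" by (simp add: field_simps)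
    moreover have "w + 1 + S - (?n - 1) / 2 = w + S - (?n - 1) / 2 + 1" by simp
    ultimately show ?thesis
      using mordell_h_add_1_expi[OF \<tau> N, of "w + S - (?n - 1) / 2"] unfolding H_def s_def
      by (simp only: eq_diff_eq[symmetric] add.commute uminus_add_conv_diff) (simp add: algebra_simps)
  qed
  have D1: "D (w + 1) = - D w" if w: "w \<notin> lattice \<tau>" for w
  proof -
    define E where "E = expi (?Q w)"
    \<comment> \<open>The phases (-i)^N and e(3N/4) multiply to (-1)^N; so the Gaussians of
      \<open>R\<close> and \<open>H\<close> cancel for these constants.\<close>
    have "C * expi (3 * ?n / 4 + ?Q w) = - ((-1) ^ N * \<i> * E / s)"
    proof -
      have "(- \<i>) ^ (N + 1) * expi (3 * ?n / 4) = expi (- ?n / 4) * expi (3 * ?n / 4) * - \<i>"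
        by (simp add: minus_i_power)
      also have "expi (- ?n / 4) * expi (3 * ?n / 4) = (-1) ^ N"
        unfolding expi_add[symmetric] minus_1_power by (rule expi_cong) simp
      finally show ?thesis unfolding C_def E_def expi_add by simp
    qed
    hence "C * expi (3 * ?n / 4 + ?Q w) = - ((-1) ^ N * \<i> / 2 * (2 * E / s))"
      by simp
    moreover have "- p + (- c * (- r - e) + a * (- h + f)) = - (p + (- c * r + a * h))" if "c * e = - (a * f)"
      for p c r e a h f :: complex
      using that by (simp add: algebra_simps)
    ultimately show ?thesis unfolding D_def R1[OF w] H1 P_def appell_mu_add_1 E_def by blast
  qed

  \<comment> \<open>Under w + N\<tau> the inhomogeneous terms of \<open>P\<close> and of the scaled
    \<open>H\<close> are opposite, while \<open>R\<close> has none.\<close>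
  have lead: "(-1) ^ N * \<i> / 2 * (2 * ?r w) = - expi (?n / 4 + 3 * ?n * \<tau> / 8 + (w + S) / 2)" for w
  proof -
    have "(-1) ^ N * \<i> / 2 * (2 * ?r w)
      = expi (?n / 2) * expi (1/4) * ?r w"
      by (simp add: expi_quarter minus_1_power)
    also have "\<dots> = expi (?n / 4 + 3 * ?n * \<tau> / 8 + (w + S) / 2 + 1/2)"
      unfolding expi_add[symmetric] by (rule expi_cong) (simp add: field_simps)
    finally show ?thesis by (simp add: expi_add[of _ "1/2"] expi_half)
  qed
  have H\<tau>: "H (w + ?n * \<tau>) = 2 * ?r w
      + ?m w * H w" for w
  proof -
    have "expi (w + S - (?n - 1) / 2 + ?n * \<tau> / 2) = expi (?n / 2 + ?n * \<tau> / 2 + w + S + 1/2)"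
    by (rule expi_eq_of_int[of _ _ "- int N"]) (simp add: field_simps)
    hence e: "expi (w + S - (?n - 1) / 2 + ?n * \<tau> / 2) = - ?m w"
      by (simp add: expi_add[of _ "1/2"] expi_half)
    have arg: "w + ?n * \<tau> + S - (?n - 1) / 2 = w + S - (?n - 1) / 2 + ?n * \<tau>" by simp
    show ?thesis unfolding H_def arg mordell_h_add_tau_expi[OF N\<tau>] e by simp
  qed
  have R\<tau>: "R (w + ?n * \<tau>) = ?m w * R w" for w
  proof -
    have "G (w + ?n * \<tau> - of_nat k) = ?m w * G (w - of_nat k)" for k
    proof -
      have "G (w + ?n * \<tau> - of_nat k) = G (w - of_nat k + ?n * \<tau>)" by (simp add: algebra_simps)
      also have "\<dots> = expi (?n / 2 + ?n * \<tau> / 2 + (w - of_nat k) + S) * G (w - of_nat k)"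
        unfolding G_def by (rule appell_mu_transform_add_tau[OF \<tau> N])
      also have "expi (?n / 2 + ?n * \<tau> / 2 + (w - of_nat k) + S) = ?m w"
        by (rule expi_eqI) simp
      finally show ?thesis .
    qed
    note shift = this
    show ?thesis unfolding R_def shift sum_distrib_left by (intro sum.cong refl) (simp only: mult_ac)
  qed
  have D\<tau>: "D (w + ?n * \<tau>) = ?m w * D w" if w: "w \<notin> lattice \<tau>" for w
  proof -
    have "e * p + v + (- c * (e * r) + (- v + a * (e * h))) = e * (p + (- c * r + a * h))" for e p v c r a h :: complex
      by (simp add: algebra_simps)
    thus ?thesis
      unfolding D_def R\<tau> H\<tau> P_def appell_mu_add_tau[OF \<tau> b w] distrib_left[of "(-1) ^ N * \<i> / 2"] lead by blast
  qed

  \<comment> \<open>The Fourier integral for \<open>b m\<close>, with the inversion of the theta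
    product inserted and then unfolded.\<close>
  have coeff: "b m = csqrt (- \<i> * \<tau>) / of_real (sqrt (real N)) *
      (\<Sum>k<N. b' (- int k) * ?g m k)" for m
  proof -
    have "b m = integral {0..1} (\<lambda>x::real. fseries b (?n / 2) (of_real x) * expi (- (of_int m + ?n / 2) * of_real x))"
      by (rule fseries_coeff[symmetric]) (use b in \<open>simp add: quasi_theta_coeffs_def\<close>)
    also have "\<dots> = integral {0..1} (\<lambda>x::real. fseries b' (?n / 2) (of_real x / \<tau>) *
      (expi (- (?n * of_real x ^ 2 - 2 * of_real x * S) / (2 * \<tau>)) * expi (- (of_int m + ?n / 2) * of_real x)))"
      unfolding inv by (simp only: mult_ac)
    also have "\<dots> = csqrt (- \<i> * \<tau>) / of_real (sqrt (real N)) *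
      (\<Sum>k<N. b' (- int k) * ?g m k)"
      by (rule fseries_inversion_coeff[OF \<tau> N]) (use b' in \<open>simp_all add: quasi_theta_coeffs_def\<close>)
    finally show ?thesis .
  qed
  \<comment> \<open>A residue computation is done only at the points -m\<tau>, where the k-th term
    of \<open>R\<close> meets the pole -m\<tau> - k of \<open>G\<close>. The other lattice points
    follow by anti-periodicity.\<close>
  have pol0: "polar D (- of_int m * \<tau>) 0" for m
  proof -
    let ?z = "- of_int m * \<tau>"
    define \<rho> where "\<rho> = (\<lambda>k. expi ((?z - of_nat k + S) ^ 2 / (2 * ?n * \<tau>)) *
      (?c m k * (- b' (- int k) / (2 * pi * \<i>)) * \<tau>))"
    have "polar G (1 * ?z + (- of_nat k)) (\<rho> k)" for k
      using appell_mu_transform_polar[OF \<tau> N b', of m k] unfolding \<rho>_def G_def by simp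
    from polar_affine[OF this] have polG: "polar (\<lambda>w. G (w - of_nat k)) ?z (\<rho> k)" for k by simp
    have polR: "polar R ?z (\<Sum>k<N. (-1) ^ k * \<rho> k)"
      unfolding R_def by (intro polar_sum polar_mult[where g = "\<lambda>_. (-1) ^ _"] polG) auto
    have "expi (?z + of_int m * \<tau>) = 1" by simp
    from appell_mu_polar[OF \<tau> b this]
    have "polar D ?z (?a ?z * (- b m / (2 * pi * \<i>))
        + ((- C) * (\<Sum>k<N. (-1) ^ k * \<rho> k) + ((-1) ^ N * \<i> / 2) * 0))"
      unfolding D_def P_def
      by (intro polar_add polar_mult[where g = "\<lambda>_. - C"] polar_mult[where g = "\<lambda>_. (-1) ^ N * \<i> / 2"] polR polar_analytic an_H) auto
    moreover have "?a ?z * (- b m / (2 * pi * \<i>)) = C * (\<Sum>k<N. (-1) ^ k * \<rho> k)"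
    proof -
      define r where "r = csqrt (- \<i> * \<tau>) / of_real (sqrt (real N))"
      \<comment> \<open>The Jacobian \<tau> combines with -i/sqrt(-i\<tau>) to sqrt(-i\<tau>), the
        factor in the formula for \<open>b m\<close>.\<close>
      have C\<tau>: "C * \<tau> = expi (- ?n / 4) * r"
      proof -
        have sq: "csqrt (- \<i> * \<tau>) * csqrt (- \<i> * \<tau>) = - \<i> * \<tau>" by (metis power2_csqrt power2_eq_square)
        have c0: "csqrt (- \<i> * \<tau>) \<noteq> 0" using nz by simp
        have "C * \<tau> = expi (- ?n / 4) * ((- \<i> * \<tau>) / s)"
          unfolding C_def by (simp add: minus_i_power)
        also have "(- \<i> * \<tau>) / s = csqrt (- \<i> * \<tau>) * csqrt (- \<i> * \<tau>) / s" by (simp only: sq)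
        also have "\<dots> = r" unfolding s_def r_def using c0 by (simp del: csqrt.simps)
        finally show ?thesis .
      qed
      have "?a ?z * (- b m / (2 * pi * \<i>))
        = (\<Sum>k<N. r * (- b' (- int k) / (2 * pi * \<i>)) * (?a ?z *
            ?g m k))"
        unfolding coeff[of m] r_def[symmetric] by (simp add: sum_distrib_left sum_divide_distrib sum_negf mult_ac)
      also have "\<dots> = (\<Sum>k<N. C * ((-1) ^ k * \<rho> k))"
      proof (rule sum.cong[OF refl])
        fix k
        have e: "?a ?z *
            ?g m k
          = expi (- ?n / 4) * (expi (of_nat k / 2) * (expi ((?z - of_nat k + S) ^ 2 / (2 * ?n * \<tau>)) *
             ?c m k))"
          unfolding expi_add[symmetric] using nz
          by (intro expi_cong) (simp add: field_simps power2_eq_square)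
        have "C * ((-1) ^ k * \<rho> k) = (C * \<tau>) * (- b' (- int k) / (2 * pi * \<i>)) * (expi (of_nat k / 2) * (expi ((?z - of_nat k + S) ^ 2 / (2 * ?n * \<tau>)) *
             ?c m k))"
          unfolding \<rho>_def minus_1_power by (simp only: mult_ac)
        thus "r * (- b' (- int k) / (2 * pi * \<i>)) * (?a ?z *
            ?g m k)
          = C * ((-1) ^ k * \<rho> k)"
          unfolding e C\<tau> by (simp only: mult_ac)
      qed
      finally show ?thesis by (simp add: sum_distrib_left)
    qed
    ultimately show ?thesis by simp
  qed
  have up: "polar D (w + 1) 0" if "polar D w 0" for w
  proof -
    have "polar D (w + 1) (- 0)"
    proof (rule polar_uminus_shift[OF that])
      show "\<forall>\<^sub>F v in at (w + 1). D v = - D (v - 1)"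
        using eventually_at_shift[where P = "\<lambda>v. v \<notin> lattice \<tau>" and z = "w + 1" and b = "- 1", OF reg]
        by eventually_elim (use D1 in force)
    qed
    thus ?thesis by simp
  qed
  have down: "polar D (w - 1) 0" if "polar D w 0" for w
  proof -
    have "polar D (w + (- 1)) (- 0)"
    proof (rule polar_uminus_shift[OF that])
      show "\<forall>\<^sub>F v in at (w + - 1). D v = - D (v - - 1)"
        using reg by eventually_elim (use D1 in force)
    qed
    thus ?thesis by simp
  qed
  have pol1: "polar D (- of_int m * \<tau> + of_int l) 0" for m l
  proof (induction l rule: int_induct[of _ 0])
    case (step1 l)
    have "- of_int m * \<tau> + of_int (l + 1) = - of_int m * \<tau> + of_int l + 1" by simp
    thus ?case using up[OF step1(2)] by (simp only:)
  next
    case (step2 l)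
    have "- of_int m * \<tau> + of_int (l - 1) = - of_int m * \<tau> + of_int l - 1" by simp
    thus ?case using down[OF step2(2)] by (simp only:)
  qed (use pol0 in simp)
  have pol: "polar D w 0" for w
  proof (cases "w \<in> lattice \<tau>")
    case True
    then obtain l m :: int where "w = of_int l + of_int m * \<tau>" unfolding lattice_def by blast
    hence "w = - of_int (- m) * \<tau> + of_int l" by simp
    thus ?thesis using pol1 by blast
  qed (use an_D polar_analytic in blast)

  \<comment> \<open>The logarithm of the modulus of the multiplier is affine in Im w with slope -2
    pi.\<close>
  obtain K where K: "\<And>w. isCont D w \<Longrightarrow> D w = K"
  proof (rule quasi_periodic_constant[OF pol _ N\<tau>, of "2 * pi" "- 2 * pi * Im (?n / 2 + ?n * \<tau> / 2 + S)"])
    show "\<forall>\<^sub>F w in at v. norm (D (w + 1)) = norm (D w)" for v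
      using reg[of v] by eventually_elim (simp add: D1)
    show "\<forall>\<^sub>F w in at v. norm (D (w + ?n * \<tau>)) = exp (- 2 * pi * Im (?n / 2 + ?n * \<tau> / 2 + S) - 2 * pi * Im w) * norm (D w)" for v
      using reg[of v]
    proof eventually_elim
      case (elim w)
      have "- 2 * pi * Im (?n / 2 + ?n * \<tau> / 2 + w + S) = - 2 * pi * Im (?n / 2 + ?n * \<tau> / 2 + S) - 2 * pi * Im w"
        by (simp add: algebra_simps)
      thus ?case unfolding D\<tau>[OF elim] norm_mult norm_expi by (simp only:)
    qed
  qed auto
  \<comment> \<open>Both points lie off the lattice, where D is continuous; a constant that changes
    sign is 0.\<close>
  have "D z = K" "D (z + 1) = K" using an_D z lat(2)[OF z] by (auto intro!: K analytic_at_imp_isCont)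
  hence "D z = 0" using D1[OF z] by simp
  thus ?thesis unfolding D_def C_def R_def s_def P_def G_def H_def by (simp add: algebra_simps eq_neg_iff_add_eq_0)
qed

subsection \<open>Theta quotients and the multivariable mu-function\<close>

text \<open>Splitting off the last coordinate identifies \<open>ZN (Suc N)\<close> with pairs of an
  element of \<open>ZN N\<close> and an integer, to which Fubini applies. Summability and value
  share one induction since Fubini needs the former.\<close>

lemma summable_ZN_product:
  fixes f :: "nat \<Rightarrow> int \<Rightarrow> complex"
  assumes "\<And>j. j \<in> {1..N} \<Longrightarrow> (\<lambda>n. norm (f j n)) summable_on UNIV"
  shows "(\<lambda>n. norm (\<Prod>j\<in>{1..N}. f j (n j))) summable_on ZN N"
    and "(\<Sum>\<^sub>\<infinity>n\<in>ZN N. \<Prod>j\<in>{1..N}. f j (n j)) = (\<Prod>j\<in>{1..N}. \<Sum>\<^sub>\<infinity>n. f j n)"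
proof -
  let ?S = "\<lambda>N. (\<lambda>n. norm (\<Prod>j\<in>{1..N}. f j (n j))) summable_on ZN N"
  let ?I = "\<lambda>N. (\<Sum>\<^sub>\<infinity>n\<in>ZN N. \<Prod>j\<in>{1..N}. f j (n j)) = (\<Prod>j\<in>{1..N}. \<Sum>\<^sub>\<infinity>n. f j n)"
  have "?S N \<and> ?I N"
    using assms
  proof (induction N)
    case 0
    have "ZN 0 = {\<lambda>_. 0}" by (auto simp: ZN_def)
    thus ?case by simp
  next
    case (Suc N)
    define a where "a = (\<lambda>n. \<Prod>j\<in>{1..N}. f j (n j))"
    have a: "(\<lambda>n. norm (a n)) summable_on ZN N" "infsum a (ZN N) = (\<Prod>j\<in>{1..N}. infsum (f j) UNIV)"
      using Suc unfolding a_def by auto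
    have g: "(\<lambda>k. norm (f (Suc N) k)) summable_on UNIV" by (rule Suc.prems) auto
    define \<phi> where "\<phi> = (\<lambda>(n, k). n(Suc N := k) :: nat \<Rightarrow> int)"
    have bij: "bij_betw \<phi> (ZN N \<times> UNIV) (ZN (Suc N))"
      by (rule bij_betwI[of _ _ _ "\<lambda>n. (n(Suc N := 0), n (Suc N))"]) (auto simp: \<phi>_def ZN_def fun_eq_iff)
    have prod: "(\<Prod>j\<in>{1..Suc N}. f j (\<phi> p j)) = a (fst p) * f (Suc N) (snd p)" for p
    proof -
      have "(\<Prod>j\<in>{1..N}. f j (\<phi> p j)) = a (fst p)"
        unfolding a_def by (intro prod.cong) (auto simp: \<phi>_def case_prod_unfold)
      thus ?thesis by (simp add: \<phi>_def case_prod_unfold)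
    qed
    let ?g = "\<lambda>n k. norm (a (fst (n, k)) * f (Suc N) (snd (n, k)))"
    have 1: "(\<lambda>p. norm (a (fst p) * f (Suc N) (snd p))) summable_on (ZN N \<times> UNIV)"
    proof (subst Infinite_Sum.abs_summable_on_Sigma_iff, intro conjI ballI)
      show "(\<lambda>k. ?g n k) summable_on UNIV" for n
        by (simp add: norm_mult summable_on_cmult_right g)
      have "infsum (\<lambda>k. ?g n k) UNIV = norm (a n) * infsum (\<lambda>k. norm (f (Suc N) k)) UNIV" for n
        by (simp add: norm_mult infsum_cmult_right')
      moreover have "(\<lambda>n. norm (norm (a n) * infsum (\<lambda>k. norm (f (Suc N) k)) UNIV)) summable_on ZN N"
        unfolding norm_mult by (intro summable_on_cmult_left) (use a(1) in simp)
      ultimately show "(\<lambda>n. norm (infsum (\<lambda>k. ?g n k) UNIV)) summable_on ZN N"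
        by simp
    qed
    have "(\<lambda>p. norm (\<Prod>j\<in>{1..Suc N}. f j (\<phi> p j))) summable_on (ZN N \<times> UNIV)"
      unfolding prod by (rule 1)
    hence A: "(\<lambda>n. norm (\<Prod>j\<in>{1..Suc N}. f j (n j))) summable_on ZN (Suc N)"
      using summable_on_reindex_bij_betw[OF bij, of "\<lambda>n. norm (\<Prod>j\<in>{1..Suc N}. f j (n j))"] by blast
    have "(\<Sum>\<^sub>\<infinity>n\<in>ZN (Suc N). \<Prod>j\<in>{1..Suc N}. f j (n j)) = (\<Sum>\<^sub>\<infinity>p\<in>ZN N \<times> UNIV. a (fst p) * f (Suc N) (snd p))"
      unfolding infsum_reindex_bij_betw[OF bij, symmetric] prod ..
    also have "\<dots> = (\<Sum>\<^sub>\<infinity>n\<in>ZN N. \<Sum>\<^sub>\<infinity>k. a (fst (n, k)) * f (Suc N) (snd (n, k)))"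
      by (rule infsum_Sigma_banach[symmetric]) (rule abs_summable_summable[OF 1])
    also have "\<dots> = infsum a (ZN N) * infsum (f (Suc N)) UNIV"
      by (simp add: infsum_cmult_right' infsum_cmult_left')
    finally show ?case using A a(2) by simp
  qed
  thus "?S N" "?I N" by auto
qed

definition ZN_level :: "nat \<Rightarrow> int \<Rightarrow> (nat \<Rightarrow> int) set" where
  "ZN_level N m = {n \<in> ZN N. (\<Sum>j\<in>{1..N}. n j) = m}"

text \<open>Fubini along the fibres of n to |n|, which suits mu because its denominators depend on n
  only through |n|.\<close>

lemma ZN_sum_by_level:
  fixes F :: "(nat \<Rightarrow> int) \<Rightarrow> complex"
  assumes "(\<lambda>n. norm (F n)) summable_on ZN N"
  shows "(\<lambda>m. norm (infsum F (ZN_level N m))) summable_on UNIV" (is ?A)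
    and "infsum F (ZN N) = (\<Sum>\<^sub>\<infinity>m. infsum F (ZN_level N m))" (is ?B)
proof -
  have bij: "bij_betw snd (Sigma UNIV (ZN_level N)) (ZN N)"
    by (rule bij_betwI[of _ _ _ "\<lambda>n. (\<Sum>j\<in>{1..N}. n j, n)"]) (auto simp: ZN_level_def)
  have 1: "(\<lambda>p. norm (F (snd p))) summable_on Sigma UNIV (ZN_level N)"
    using summable_on_reindex_bij_betw[OF bij, of "\<lambda>n. norm (F n)"] assms by blast
  have 2: "\<And>m. (\<lambda>n. norm (F n)) summable_on ZN_level N m"
    and 3: "(\<lambda>m. norm (infsum (\<lambda>n. norm (F n)) (ZN_level N m))) summable_on UNIV"
    using Infinite_Sum.abs_summable_on_Sigma_iff[THEN iffD1, OF 1] by simp_all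
  show ?A
  proof (rule summable_on_comparison_test[OF 3])
    fix m
    have "norm (infsum F (ZN_level N m)) \<le> infsum (\<lambda>n. norm (F n)) (ZN_level N m)"
      by (rule norm_infsum_bound[OF 2])
    thus "norm (infsum F (ZN_level N m)) \<le> norm (infsum (\<lambda>n. norm (F n)) (ZN_level N m))"
      unfolding real_norm_def by linarith
  qed auto
  have "infsum F (ZN N) = (\<Sum>\<^sub>\<infinity>p\<in>Sigma UNIV (ZN_level N). F (snd p))"
    by (rule infsum_reindex_bij_betw[OF bij, symmetric])
  also have "\<dots> = (\<Sum>\<^sub>\<infinity>m. \<Sum>\<^sub>\<infinity>n\<in>ZN_level N m. F (snd (m, n)))"
    by (rule infsum_Sigma_banach[symmetric]) (rule abs_summable_summable[OF 1])
  finally show ?B by simp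
qed

text \<open>Fourier coefficients of theta(x - u)/theta(u) as a function of x.\<close>

definition quotient_coeff :: "complex \<Rightarrow> complex \<Rightarrow> int \<Rightarrow> complex" where
  "quotient_coeff \<tau> u n = theta_coeff \<tau> n * expi (- (of_int n + 1/2) * u) / vtheta u \<tau>"

text \<open>The convolution of N such sequences, hence the Fourier coefficients of the product of
  the quotients, at the frequencies m + N/2.\<close>

definition product_coeff :: "nat \<Rightarrow> (nat \<Rightarrow> complex) \<Rightarrow> complex \<Rightarrow> int \<Rightarrow> complex" where
  "product_coeff N u \<tau> m = (\<Sum>\<^sub>\<infinity>n\<in>ZN_level N m. \<Prod>j\<in>{1..N}. quotient_coeff \<tau> (u j) (n j))"

lemma quotient_coeff_has_sum:
  assumes "Im \<tau> > 0"
  shows "(\<lambda>n. norm (quotient_coeff \<tau> u n * expi ((of_int n + 1/2) * x))) summable_on UNIV" (is ?A)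
    and "(\<Sum>\<^sub>\<infinity>n. quotient_coeff \<tau> u n * expi ((of_int n + 1/2) * x)) = vtheta (x - u) \<tau> / vtheta u \<tau>" (is ?B)
proof -
  have eq: "quotient_coeff \<tau> u n * expi ((of_int n + 1/2) * x) = inverse (vtheta u \<tau>) * (theta_coeff \<tau> n * expi ((of_int n + 1/2) * (x - u)))" for n
  proof -
    have "expi (- (of_int n + 1/2) * u) * expi ((of_int n + 1/2) * x) = expi ((of_int n + 1/2) * (x - u))"
      unfolding expi_add[symmetric] by (rule expi_cong) (simp add: field_simps)
    thus ?thesis by (simp add: quotient_coeff_def field_simps)
  qed
  show ?A
    unfolding eq norm_mult[of "inverse _"]
    by (rule summable_on_cmult_right[OF fseries_abs_summable[OF rapid_theta_coeff[OF assms]]])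
  show ?B
    unfolding eq infsum_cmult_right' vtheta_eq_fseries[of "x - u"] fseries_def by (simp only: divide_inverse_commute)
qed

lemma quotient_coeff_Suc:
  "quotient_coeff \<tau> u (n + 1) = - expi (- u) * expi (of_int (n + 1) * \<tau>) * quotient_coeff \<tau> u n"
proof -
  have "expi (- (of_int (n + 1) + 1/2) * u) = expi (- u) * expi (- (of_int n + 1/2) * u)"
    unfolding expi_add[symmetric] by (rule expi_cong) (simp add: algebra_simps)
  thus ?thesis unfolding quotient_coeff_def theta_coeff_Suc by simp
qed

lemma expi_sum: "finite A \<Longrightarrow> expi (\<Sum>j\<in>A. f j) = (\<Prod>j\<in>A. expi (f j))"
  by (induction A rule: finite_induct) (auto simp: expi_add)

text \<open>On the level |n| = m the frequencies n_j + 1/2 add up to m + N/2, so the exponential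
  leaves the inner sum.\<close>

lemma product_coeff_weighted:
  assumes "Im \<tau> > 0"
  shows "(\<lambda>m. norm (product_coeff N u \<tau> m * expi ((of_int m + of_nat N / 2) * x))) summable_on UNIV" (is ?A)
    and "(\<Sum>\<^sub>\<infinity>m. product_coeff N u \<tau> m * expi ((of_int m + of_nat N / 2) * x)) = (\<Prod>j\<in>{1..N}. vtheta (x - u j) \<tau> / vtheta (u j) \<tau>)" (is ?B)
    and "(\<lambda>n. norm (\<Prod>j\<in>{1..N}. quotient_coeff \<tau> (u j) (n j) * expi ((of_int (n j) + 1/2) * x))) summable_on ZN N" (is ?C)
proof -
  let ?n = "of_nat N :: complex"
  define F where "F = (\<lambda>n. \<Prod>j\<in>{1..N}. quotient_coeff \<tau> (u j) (n j) * expi ((of_int (n j) + 1/2) * x))"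
  note P = summable_ZN_product[where N = N and f = "\<lambda>j k. quotient_coeff \<tau> (u j) k * expi ((of_int k + 1/2) * x)", OF quotient_coeff_has_sum(1)[OF assms]]
  show S: ?C
    by (rule P(1))
  have SF: "(\<lambda>n. norm (F n)) summable_on ZN N" unfolding F_def by (rule S)
  have level: "infsum F (ZN_level N m) = product_coeff N u \<tau> m * expi ((of_int m + ?n / 2) * x)" for m
  proof -
    have "F n = (\<Prod>j\<in>{1..N}. quotient_coeff \<tau> (u j) (n j)) * expi ((of_int m + ?n / 2) * x)" if "n \<in> ZN_level N m" for n
    proof -
      have "(\<Sum>j\<in>{1..N}. (of_int (n j) + 1/2) * x) = (of_int (\<Sum>j\<in>{1..N}. n j) + ?n / 2) * x"
        by (simp add: sum_distrib_right[symmetric] sum.distrib)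
      also have "(\<Sum>j\<in>{1..N}. n j) = m" using that by (simp add: ZN_level_def)
      finally have "expi ((of_int m + ?n / 2) * x) = (\<Prod>j\<in>{1..N}. expi ((of_int (n j) + 1/2) * x))"
        by (simp add: expi_sum[symmetric])
      thus ?thesis by (simp add: F_def prod.distrib)
    qed
    hence "infsum F (ZN_level N m) = (\<Sum>\<^sub>\<infinity>n\<in>ZN_level N m. (\<Prod>j\<in>{1..N}. quotient_coeff \<tau> (u j) (n j)) * expi ((of_int m + ?n / 2) * x))"
      by (rule infsum_cong)
    thus ?thesis by (simp add: infsum_cmult_left' product_coeff_def)
  qed
  note * = ZN_sum_by_level[OF SF, unfolded level]
  show ?A by (rule *(1))
  have "infsum F (ZN N) = (\<Prod>j\<in>{1..N}. vtheta (x - u j) \<tau> / vtheta (u j) \<tau>)"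
    unfolding F_def P(2) quotient_coeff_has_sum(2)[OF assms] ..
  with *(2) show ?B
    by simp
qed

lemma fseries_product_coeff:
  "Im \<tau> > 0 \<Longrightarrow> fseries (product_coeff N u \<tau>) (of_nat N / 2) x = (\<Prod>j\<in>{1..N}. vtheta (x - u j) \<tau> / vtheta (u j) \<tau>)"
  unfolding fseries_def by (rule product_coeff_weighted(2))

lemma product_coeff_rapid:
  assumes "Im \<tau> > 0"
  shows "rapid (product_coeff N u \<tau>)"
  unfolding rapid_def
proof
  fix t :: real
  \<comment> \<open>At this imaginary point e((m + N/2) x) has modulus exp(t m) up to a constant, so
    absolute convergence there is the weighted summability.\<close>
  define x where "x = - \<i> * of_real (t / (2 * pi))"
  have n: "norm (expi ((of_int m + of_nat N / 2) * x)) = exp (t * of_int m) * exp (t * real N / 2)" for m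
    unfolding norm_expi exp_add[symmetric] by (simp add: x_def field_simps)
  have "(\<lambda>m. norm (product_coeff N u \<tau> m) * exp (t * of_int m) * exp (t * real N / 2)) summable_on UNIV"
    using product_coeff_weighted(1)[OF assms, of N u x] by (simp add: norm_mult n mult.assoc)
  from summable_on_cmult_left[OF this, of "exp (- (t * real N / 2))"]
  show "(\<lambda>m. norm (product_coeff N u \<tau> m) * exp (t * of_int m)) summable_on UNIV"
    by (simp add: mult.assoc exp_add[symmetric])
qed

lemma product_coeff_add:
  "product_coeff N u \<tau> (m + int N) =
     (-1) ^ N * expi (- (\<Sum>j\<in>{1..N}. u j)) * expi (of_int (m + int N) * \<tau>) * product_coeff N u \<tau> m"
proof -
  let ?P = "\<lambda>n. \<Prod>j\<in>{1..N}. quotient_coeff \<tau> (u j) (n j)"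
  let ?e = "expi (- (\<Sum>j\<in>{1..N}. u j))"
  \<comment> \<open>Raises only the coordinates 1 to N, so that the image stays in
    \<open>ZN N\<close> while the level grows by N.\<close>
  define s where "s = (\<lambda>n j. n j + (if j \<in> {1..N} then 1 else 0) :: int)"
  have sum_s: "(\<Sum>j\<in>{1..N}. s n j) = (\<Sum>j\<in>{1..N}. n j) + int N" for n
    by (simp add: s_def sum.distrib)
  have bij: "bij_betw s (ZN_level N m) (ZN_level N (m + int N))"
  proof (rule bij_betwI[of _ _ _ "\<lambda>n j. n j - (if j \<in> {1..N} then 1 else 0)"])
    show "s \<in> ZN_level N m \<rightarrow> ZN_level N (m + int N)"
    proof
      fix n assume n: "n \<in> ZN_level N m"
      hence "s n \<in> ZN N" by (auto simp: ZN_level_def ZN_def s_def)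
      moreover have "(\<Sum>j\<in>{1..N}. s n j) = m + int N" using n sum_s[of n] by (simp only: ZN_level_def mem_Collect_eq)
      ultimately show "s n \<in> ZN_level N (m + int N)" unfolding ZN_level_def by blast
    qed
  qed (auto simp: ZN_level_def ZN_def s_def sum_subtractf)
  have "?P (s n) =
      (-1) ^ N * ?e * expi (of_int (m + int N) * \<tau>) * ?P n"
    if n: "n \<in> ZN_level N m" for n
  proof -
    have "?P (s n)
       = (\<Prod>j\<in>{1..N}. ((-1) * expi (- u j)) * expi (of_int (s n j) * \<tau>) * quotient_coeff \<tau> (u j) (n j))"
      using quotient_coeff_Suc by (intro prod.cong) (auto simp: s_def)
    also have "\<dots> = (-1) ^ N * (\<Prod>j\<in>{1..N}. expi (- u j)) * (\<Prod>j\<in>{1..N}. expi (of_int (s n j) * \<tau>)) * ?P n"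
      unfolding prod.distrib by simp
    also have "(\<Prod>j\<in>{1..N}. expi (- u j)) = ?e"
      by (simp add: expi_sum[symmetric] sum_negf)
    also have "(\<Prod>j\<in>{1..N}. expi (of_int (s n j) * \<tau>)) = expi (of_int (\<Sum>j\<in>{1..N}. s n j) * \<tau>)"
      by (simp add: expi_sum[symmetric] sum_distrib_right)
    also have "(\<Sum>j\<in>{1..N}. s n j) = m + int N" using n sum_s[of n] by (simp only: ZN_level_def mem_Collect_eq)
    finally show ?thesis .
  qed
  hence "(\<Sum>\<^sub>\<infinity>n\<in>ZN_level N m. ?P (s n))
    = (\<Sum>\<^sub>\<infinity>n\<in>ZN_level N m. (-1) ^ N * ?e * expi (of_int (m + int N) * \<tau>) * ?P n)"
    by (rule infsum_cong)
  thus ?thesis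
    unfolding product_coeff_def infsum_reindex_bij_betw[OF bij, symmetric, of "?P"]
    by (simp only: infsum_cmult_right')
qed

lemma product_coeff_quasi_theta:
  assumes \<tau>: "Im \<tau> > 0" and u: "\<And>j. j \<in> {1..N} \<Longrightarrow> u j \<notin> lattice \<tau>"
  shows "quasi_theta_coeffs N (\<Sum>j\<in>{1..N}. u j) \<tau> (product_coeff N u \<tau>)"
  unfolding quasi_theta_coeffs_def
proof (intro conjI allI product_coeff_rapid[OF \<tau>] product_coeff_add)
  have "(\<Sum>\<^sub>\<infinity>m. product_coeff N u \<tau> m) = (\<Prod>j\<in>{1..N}. vtheta (0 - u j) \<tau> / vtheta (u j) \<tau>)"
    using product_coeff_weighted(2)[OF \<tau>, of N u 0] by simp
  also have "\<dots> = (\<Prod>j\<in>{1..N}. - 1)"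
    using vtheta_nonzero[OF \<tau>] u by (intro prod.cong) (auto simp: vtheta_minus)
  finally show "(\<Sum>\<^sub>\<infinity>m. product_coeff N u \<tau> m) = (-1) ^ N" by simp
qed

text \<open>As n(n + 1)/2 = (n + 1/2)^2/2 - 1/8 and (-1)^n = e(n/2), the factors of mu are theta
  coefficients up to a factor independent of n.\<close>

lemma muN_term:
  "(-1) powi n * exp (- 2 * pi * \<i> * of_int n * u) * qpow \<tau> (of_int (n * (n + 1)) / 2) / vtheta u \<tau>
    = expi (- (1/4) - \<tau> / 8 + u / 2) * quotient_coeff \<tau> u n"
proof -
  have "(-1) powi n = expi (of_int n / 2)"
  proof -
    have "(-1) powi n = exp (pi * \<i>) powi n" by simp
    also have "\<dots> = exp (of_int n * (pi * \<i>))" by (simp only: exp_power_int)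
    also have "\<dots> = expi (of_int n / 2)" unfolding expi_def by (rule arg_cong[where f = exp]) simp
    finally show ?thesis .
  qed
  moreover have "exp (- 2 * pi * \<i> * of_int n * u) = expi (- of_int n * u)"
    unfolding expi_def by (rule arg_cong[where f = exp]) simp
  moreover have "expi (of_int n / 2) * expi (- of_int n * u) * expi (of_real (of_int (n * (n + 1)) / 2) * \<tau>)
     = expi (- (1/4) - \<tau> / 8 + u / 2) * (theta_coeff \<tau> n * expi (- (of_int n + 1/2) * u))"
    unfolding theta_coeff_def expi_add[symmetric]
    by (rule expi_cong) (simp add: field_simps power2_eq_square)
  ultimately show ?thesis unfolding quotient_coeff_def qpow_eq_expi by simp
qed

text \<open>Valid for every value of u_0: where a denominator vanishes, both sides take the
  corresponding terms to be 0.\<close>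

lemma muN_eq_appell_mu:
  assumes \<tau>: "Im \<tau> > 0"
  shows "muN N u \<tau> = appell_mu N (\<Sum>j\<in>{1..N}. u j) \<tau> (product_coeff N u \<tau>) (u 0)"
proof -
  let ?n = "of_nat N :: complex"
  define K where "K = expi (- ?n / 4 - ?n * \<tau> / 8 + (\<Sum>j\<in>{1..N}. u j) / 2 + u 0 / 2)"
  define Q where "Q = (\<lambda>n. \<Prod>j\<in>{1..N}. quotient_coeff \<tau> (u j) (n j))"
  define F where "F = (\<lambda>n. Q n / (1 - expi (u 0 + of_int (\<Sum>j\<in>{1..N}. n j) * \<tau>)))"
  have pref: "exp (pi * \<i> * u 0) * (\<Prod>j\<in>{1..N}. expi (- (1/4) - \<tau> / 8 + u j / 2)) = K"
  proof -
    have "(\<Sum>j\<in>{1..N}. - (1/4) - \<tau> / 8 + u j / 2) = - ?n / 4 - ?n * \<tau> / 8 + (\<Sum>j\<in>{1..N}. u j) / 2"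
      by (simp add: sum.distrib sum_subtractf sum_divide_distrib algebra_simps)
    moreover have "exp (pi * \<i> * u 0) = expi (u 0 / 2)"
      unfolding expi_def by (rule arg_cong[where f = exp]) simp
    ultimately show ?thesis by (simp add: K_def expi_sum[symmetric] expi_add[symmetric] add.commute)
  qed
  have "muN N u \<tau> = (\<Sum>\<^sub>\<infinity>n\<in>ZN N. K * F n)"
    unfolding muN_def
  proof (rule infsum_cong)
    fix n :: "nat \<Rightarrow> int"
    let ?m = "\<Sum>j\<in>{1..N}. n j"
    have "exp (2 * pi * \<i> * u 0) * qpow \<tau> (of_int ?m) = expi (u 0 + of_int ?m * \<tau>)"
      unfolding qpow_eq_expi expi_add by (simp add: expi_def)
    thus "exp (pi * \<i> * u 0) / (1 - exp (2 * pi * \<i> * u 0) * qpow \<tau> (of_int ?m)) *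
       (\<Prod>j = 1..N. (- 1) powi n j * exp (- 2 * pi * \<i> * of_int (n j) * u j) * qpow \<tau> (of_int (n j * (n j + 1)) / 2) / vtheta (u j) \<tau>) = K * F n"
      unfolding muN_term prod.distrib F_def Q_def pref[symmetric] by simp
  qed
  also have "\<dots> = K * infsum F (ZN N)" by (rule infsum_cmult_right')
  also have "infsum F (ZN N) = (\<Sum>\<^sub>\<infinity>m. infsum F (ZN_level N m))"
  proof (rule ZN_sum_by_level(2))
    obtain B where B: "\<And>m. norm (inverse (1 - expi (u 0 + of_int m * \<tau>))) \<le> B"
      using appell_bound[OF \<tau>] by blast
    have "(\<lambda>n. norm (Q n)) summable_on ZN N"
      using product_coeff_weighted(3)[OF \<tau>, where N = N and u = u and x = 0] by (simp add: Q_def)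
    hence "(\<lambda>n. norm (Q n) * B) summable_on ZN N" by (rule summable_on_cmult_left)
    thus "(\<lambda>n. norm (F n)) summable_on ZN N"
    proof (rule summable_on_comparison_test)
      fix n
      show "norm (F n) \<le> norm (Q n) * B"
        using mult_left_mono[OF B[of "\<Sum>j\<in>{1..N}. n j"], of "norm (Q n)"]
        by (simp add: F_def norm_mult divide_inverse del: norm_inverse)
    qed auto
  qed
  also have "(\<lambda>m. infsum F (ZN_level N m)) = (\<lambda>m. product_coeff N u \<tau> m / (1 - expi (u 0 + of_int m * \<tau>)))"
  proof
    fix m
    have "infsum F (ZN_level N m) = (\<Sum>\<^sub>\<infinity>n\<in>ZN_level N m. Q n * inverse (1 - expi (u 0 + of_int m * \<tau>)))"
      by (rule infsum_cong) (auto simp: F_def ZN_level_def divide_inverse)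
    thus "infsum F (ZN_level N m) = product_coeff N u \<tau> m / (1 - expi (u 0 + of_int m * \<tau>))"
      by (simp add: infsum_cmult_left' product_coeff_def Q_def divide_inverse)
  qed
  finally show ?thesis by (simp add: appell_mu_def appell_def K_def)
qed

lemma product_coeff_upd_0 [simp]: "product_coeff N (u(0 := z)) \<tau> = product_coeff N u \<tau>"
proof -
  have "(\<Prod>j\<in>{1..N}. quotient_coeff \<tau> ((u(0 := z)) j) (n j)) = (\<Prod>j\<in>{1..N}. quotient_coeff \<tau> (u j) (n j))" for n
    by (rule prod.cong) auto
  thus ?thesis unfolding product_coeff_def by (simp only:)
qed

lemma muN_upd_0:
  assumes "Im \<tau> > 0"
  shows "muN N (u(0 := z)) \<tau> = appell_mu N (\<Sum>j\<in>{1..N}. u j) \<tau> (product_coeff N u \<tau>) z"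
proof -
  have "(\<Sum>j\<in>{1..N}. (u(0 := z)) j) = (\<Sum>j\<in>{1..N}. u j)" by (rule sum.cong) auto
  thus ?thesis using muN_eq_appell_mu[OF assms, of N "u(0 := z)"] by (simp only: product_coeff_upd_0 fun_upd_same)
qed

section \<open>Behaviour under \<tau> to \<tau> + 1\<close>

lemma vtheta_tau_add_1: "vtheta u (\<tau> + 1) = expi (1/8) * vtheta u \<tau>"
proof -
  have "theta_coeff (\<tau> + 1) n = expi (1/8) * theta_coeff \<tau> n" for n
  proof -
    have "theta_coeff (\<tau> + 1) n = expi (1/8 + ((of_int n + 1/2) / 2 + (of_int n + 1/2) ^ 2 / 2 * \<tau>))"
      unfolding theta_coeff_def
    proof (rule expi_eqI)
      \<comment> \<open>Since n(n + 1)/2 is an integer, only the 1/8 in (n + 1/2)^2/2 = n(n + 1)/2 +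
        1/8 is felt.\<close>
      have "even (n * (n + 1))" by simp
      then obtain k where "n * (n + 1) = 2 * k" by blast
      hence k: "of_int n * (of_int n + 1) = 2 * (of_int k :: complex)" by (metis of_int_1 of_int_add of_int_mult of_int_numeral)
      have "(of_int n + 1/2) / 2 + (of_int n + 1/2)\<^sup>2 / 2 * (\<tau> + 1) - (1/8 + ((of_int n + 1/2) / 2 + (of_int n + 1/2)\<^sup>2 / 2 * \<tau>))
        = of_int n * (of_int n + 1) / 2" by (simp add: field_simps power2_eq_square)
      also have "\<dots> = of_int k" unfolding k by simp
      finally show "(of_int n + 1/2) / 2 + (of_int n + 1/2)\<^sup>2 / 2 * (\<tau> + 1) - (1/8 + ((of_int n + 1/2) / 2 + (of_int n + 1/2)\<^sup>2 / 2 * \<tau>)) \<in> \<int>"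
        by (simp only: Ints_of_int)
    qed
    thus ?thesis by (simp only: expi_add[of "1/8"] theta_coeff_def)
  qed
  thus ?thesis by (simp add: vtheta_eq_fseries fseries_def mult.assoc infsum_cmult_right')
qed

lemma qpow_tau_add_1: "c \<in> \<int> \<Longrightarrow> qpow (\<tau> + 1) c = qpow \<tau> c"
  unfolding qpow_eq_expi by (rule expi_eqI) (auto simp: algebra_simps elim: Ints_cases)

text \<open>All exponents of q in the sum are integers; only the N theta denominators change, each
  giving e(-1/8).\<close>

lemma muN_tau_add_1: "muN N u (\<tau> + 1) = expi (- of_nat N / 8) * muN N u \<tau>"
proof -
  have "(\<Prod>j\<in>{1..N}. (-1) powi (n j) * exp (- 2 * pi * \<i> * of_int (n j) * u j)
            * qpow (\<tau> + 1) (of_int (n j * (n j + 1)) / 2) / vtheta (u j) (\<tau> + 1))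
     = expi (- of_nat N / 8) * (\<Prod>j\<in>{1..N}. (-1) powi (n j) * exp (- 2 * pi * \<i> * of_int (n j) * u j)
            * qpow \<tau> (of_int (n j * (n j + 1)) / 2) / vtheta (u j) \<tau>)" for n
  proof -
    have q: "qpow (\<tau> + 1) (of_int (k * (k + 1)) / 2) = qpow \<tau> (of_int (k * (k + 1)) / 2)" for k
    proof (rule qpow_tau_add_1)
      have "even (k * (k + 1))" by simp
      then obtain l where "k * (k + 1) = 2 * l" by blast
      thus "of_int (k * (k + 1)) / 2 \<in> (\<int> :: real set)" by simp
    qed
    have "(\<Prod>j\<in>{1..N}. expi (- (1/8))) = expi (- of_nat N / 8)"
      by (simp add: expi_power)
    moreover have "a / vtheta v (\<tau> + 1) = expi (- (1/8)) * (a / vtheta v \<tau>)" for a v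
      unfolding vtheta_tau_add_1 expi_minus[of "1/8"] by (simp only: divide_inverse inverse_mult_distrib mult_ac)
    ultimately show ?thesis unfolding q by (simp only: prod.distrib)
  qed
  moreover have "qpow (\<tau> + 1) (of_int k) = qpow \<tau> (of_int k)" for k
    by (rule qpow_tau_add_1) simp
  ultimately show ?thesis
    unfolding muN_def by (simp only: mult.left_commute[of _ "expi (- of_nat N / 8)"] infsum_cmult_right')
qed

text \<open>Needed because u_0 + j(\<tau> + 1) and u_0 + j\<tau> differ by the integer j.\<close>

lemma muN_add_of_nat: "muN N (u(0 := z + of_nat k)) \<tau> = (-1) ^ k * muN N (u(0 := z)) \<tau>"
proof -
  have 1: "exp (pi * \<i> * (z + of_nat k)) = (-1) ^ k * exp (pi * \<i> * z)"
  proof -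
    have "(-1) ^ k = exp (of_nat k * (of_real pi * \<i>))" unfolding exp_of_nat_mult by simp
    thus ?thesis by (simp add: exp_add[symmetric] algebra_simps)
  qed
  have 2: "exp (2 * pi * \<i> * (z + of_nat k)) = exp (2 * pi * \<i> * z)"
    using expi_eqI[of "z + of_nat k" z] by (simp add: expi_def)
  have "exp (pi * \<i> * (u(0 := z + of_nat k)) 0) / (1 - exp (2 * pi * \<i> * (u(0 := z + of_nat k)) 0) * Q) * (\<Prod>j\<in>{1..N}. f j ((u(0 := z + of_nat k)) j))
     = (-1) ^ k * (exp (pi * \<i> * (u(0 := z)) 0) / (1 - exp (2 * pi * \<i> * (u(0 := z)) 0) * Q) * (\<Prod>j\<in>{1..N}. f j ((u(0 := z)) j)))" for Q and f :: "nat \<Rightarrow> complex \<Rightarrow> complex"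
  proof -
    have "(\<Prod>j\<in>{1..N}. f j ((u(0 := z + of_nat k)) j)) = (\<Prod>j\<in>{1..N}. f j ((u(0 := z)) j))"
      by (rule prod.cong) auto
    thus ?thesis by (simp only: fun_upd_same 1 2) simp
  qed
  note * = this
  show ?thesis
    unfolding muN_def
    by (subst *[where f = "\<lambda>j v. (-1) powi (_ j) * exp (- 2 * pi * \<i> * of_int (_ j) * v) * qpow \<tau> (of_int (_ j * (_ j + 1)) / 2) / vtheta v \<tau>"]) (rule infsum_cmult_right')
qed

text \<open>The phase e(N/8) undoes the theta factors and the power of zeta the change of the
  quadratic exponent. Of the three signs (-1)^j on the right, one belongs to the matrix, one to the
  vector and one to the integer shift of u_0.\<close>

lemma MN_tau_add_1:
  assumes "N > 0"
  shows "MN N u \<tau> j = exp (pi * \<i> * of_nat N / 4) * ((-1) ^ j * zeta (2 * N) ^ (j ^ 2) * MN N u (\<tau> + 1) j)"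
proof -
  define U where "U = (\<Sum>j\<in>{0..N}. u j)"
  let ?p = "\<lambda>t. expi (- of_nat j * U / of_nat N - of_nat (j ^ 2) * t / (2 * of_nat N))"
  let ?z = "expi (of_nat (j ^ 2) / (2 * of_nat N))"
  define M where "M = muN N (u(0 := u 0 + of_nat j * \<tau>)) \<tau>"
  have mu: "muN N (u(0 := u 0 + of_nat j * (\<tau> + 1))) (\<tau> + 1) = expi (- of_nat N / 8) * ((-1) ^ j * M)"
  proof -
    have "u 0 + of_nat j * (\<tau> + 1) = u 0 + of_nat j * \<tau> + of_nat j" by (simp add: algebra_simps)
    thus ?thesis unfolding M_def by (simp only: muN_tau_add_1 muN_add_of_nat)
  qed
  have z: "zeta (2 * N) ^ (j ^ 2) = ?z"
  proof -
    have "zeta (2 * N) = expi (1 / (2 * of_nat N))" by (simp add: zeta_def expi_def)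
    thus ?thesis by (simp add: expi_power)
  qed
  have p: "exp (- 2 * pi * \<i> * of_nat j * U / of_nat N - pi * \<i> * of_nat (j ^ 2) * t / of_nat N) = ?p t" for t
    unfolding expi_def by (rule arg_cong[where f = exp]) (simp add: algebra_simps)
  have n8: "exp (pi * \<i> * of_nat N / 4) = expi (of_nat N / 8)"
    unfolding expi_def by (rule arg_cong[where f = exp]) simp
  have e: "expi (of_nat N / 8) * (?z * (?p (\<tau> + 1) * expi (- of_nat N / 8)))
     = ?p \<tau>"
    unfolding expi_add[symmetric] using assms by (intro expi_cong) (simp add: field_simps)
  have m: "(-1) ^ j * ((-1) ^ j * ((-1) ^ j * x)) = (-1) ^ j * x" for x :: complex
    by (cases "even j") auto
  have "expi (of_nat N / 8) * ((-1) ^ j * ?z * ((-1) ^ j *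
      ?p (\<tau> + 1) * (expi (- of_nat N / 8) * ((-1) ^ j * M))))
    = (-1) ^ j * ((-1) ^ j * ((-1) ^ j * ((expi (of_nat N / 8) * (?z * (?p (\<tau> + 1) * expi (- of_nat N / 8)))) * M)))"
    by (simp only: mult_ac)
  thus ?thesis
    unfolding MN_def Let_def U_def[symmetric] mu M_def[symmetric] z p n8 e m by (simp only: mult.assoc)
qed

section \<open>The vector-valued inversion formula\<close>

lemma MN_inversion:
  fixes u :: "nat \<Rightarrow> complex"
  assumes \<tau>: "Im \<tau> > 0" and N: "N > 0" and u: "\<And>j. j \<le> N \<Longrightarrow> u j \<notin> lattice \<tau>"
  defines "U \<equiv> (\<Sum>j\<in>{0..N}. u j)"
  shows "MN N u \<tau> j =
           (- \<i>)^(N+1) * exp (pi * \<i> * U^2 / (of_nat N * \<tau>)) / (of_real (sqrt (real N)) * csqrt (- \<i> * \<tau>))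
             * (\<Sum>k<N. zeta N powi (- int j * int k) * MN N (\<lambda>i. u i / \<tau>) (- 1 / \<tau>) k)
           - (-1)^N * \<i> / 2 * ((-1)^j * exp (- 2 * pi * \<i> * of_nat j * U / of_nat N)
               * qpow \<tau> (- real (j^2) / (2 * real N))
               * mordell_h (U + of_nat j * \<tau> - (of_nat N - 1) / 2) (of_nat N * \<tau>))"
proof -
  let ?n = "of_nat N :: complex"
  let ?G = "\<lambda>k::nat. expi ((U + of_nat j * \<tau> - of_nat k) ^ 2 / (2 * ?n * \<tau>))"
  have nz: "\<tau> \<noteq> 0" "?n \<noteq> (0::complex)" using \<tau> N by auto
  define \<tau>' where "\<tau>' = - 1 / \<tau>"
  let ?h = "\<lambda>k::nat. expi (- of_nat k * (U / \<tau>) / ?n - of_nat (k ^ 2) * \<tau>' / (2 * ?n))"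
  have \<tau>': "Im \<tau>' > 0" unfolding \<tau>'_def by (rule Im_minus_inverse[OF \<tau>])
  define S where "S = (\<Sum>j\<in>{1..N}. u j)"
  have U: "U = u 0 + S" unfolding U_def S_def by (simp add: sum.atLeast_Suc_atMost)
  define u' where "u' = (\<lambda>i. u i / \<tau>)"
  have S': "(\<Sum>j\<in>{1..N}. u' j) = S / \<tau>" and U': "(\<Sum>j\<in>{0..N}. u' j) = U / \<tau>"
    unfolding u'_def S_def U_def by (simp_all add: sum_divide_distrib)
  have u'lat: "u' j \<notin> lattice \<tau>'" if "j \<le> N" for j
    using u[OF that] lattice_scaled_iff[OF nz(1)] unfolding u'_def \<tau>'_def by blast
  define b b' where "b = product_coeff N u \<tau>" and "b' = product_coeff N u' \<tau>'"
  have b: "quasi_theta_coeffs N S \<tau> b"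
    unfolding b_def S_def by (rule product_coeff_quasi_theta[OF \<tau>]) (use u in auto)
  have b': "quasi_theta_coeffs N (S / \<tau>) (- 1 / \<tau>) b'"
    using product_coeff_quasi_theta[OF \<tau>', of N u'] u'lat unfolding S' b'_def \<tau>'_def[symmetric] by simp
  have inv: "fseries b (?n / 2) (of_real x) =
       expi (- (?n * of_real x ^ 2 - 2 * of_real x * S) / (2 * \<tau>)) * fseries b' (?n / 2) (of_real x / \<tau>)" for x :: real
  proof -
    have "fseries b (?n / 2) (of_real x) = (\<Prod>j\<in>{1..N}. expi (- (of_real x ^ 2 - 2 * of_real x * u j) / (2 * \<tau>)) *
        (vtheta (of_real x / \<tau> - u' j) \<tau>' / vtheta (u' j) \<tau>'))"
      unfolding b_def fseries_product_coeff[OF \<tau>] vtheta_quotient_inversion[OF \<tau>] u'_def \<tau>'_def ..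
    also have "\<dots> = expi (\<Sum>j\<in>{1..N}. - (of_real x ^ 2 - 2 * of_real x * u j) / (2 * \<tau>)) * fseries b' (?n / 2) (of_real x / \<tau>)"
      unfolding prod.distrib b'_def fseries_product_coeff[OF \<tau>'] by (simp add: expi_sum)
    also have "(\<Sum>j\<in>{1..N}. - (of_real x ^ 2 - 2 * of_real x * u j) / (2 * \<tau>)) = - (?n * of_real x ^ 2 - 2 * of_real x * S) / (2 * \<tau>)"
      unfolding S_def sum_divide_distrib[symmetric] by (simp add: sum_subtractf sum_distrib_left)
    finally show ?thesis .
  qed
  have "u 0 + (of_int 0 + of_int (int j) * \<tau>) \<notin> lattice \<tau>" unfolding lattice_add_iff using u[of 0] by simp
  hence z: "u 0 + of_nat j * \<tau> \<notin> lattice \<tau>" by simp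
  define c where "c = (- \<i>) ^ (N + 1) / (of_real (sqrt (real N)) * csqrt (- \<i> * \<tau>))"
  define h where "h = mordell_h (U + of_nat j * \<tau> - (?n - 1) / 2) (?n * \<tau>)"
  define A where "A = (\<lambda>k. appell_mu N (S / \<tau>) \<tau>' b' (u 0 / \<tau> + of_nat k * \<tau>'))"
  define p where "p = expi (- of_nat j * U / ?n - of_nat (j ^ 2) * \<tau> / (2 * ?n))"
  \<comment> \<open>Dividing u_0 + j\<tau> - k by \<tau> gives u_0/\<tau> + k(-1/\<tau>) + j: the
    shift by k becomes the k-th component on the dual side, and the integer j costs only a
    sign.\<close>
  have trans: "appell_mu_transform N S \<tau> b' (u 0 + of_nat j * \<tau> - of_nat k) = (-1) ^ j * (?G k * A k)" for k
  proof -
    have "(u 0 + of_nat j * \<tau> - of_nat k) / \<tau> = u 0 / \<tau> + of_nat k * \<tau>' + of_nat j"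
      using nz by (simp add: \<tau>'_def field_simps)
    moreover have "u 0 + of_nat j * \<tau> - of_nat k + S = U + of_nat j * \<tau> - of_nat k" by (simp add: U)
    ultimately show ?thesis
      unfolding appell_mu_transform_def \<tau>'_def[symmetric] A_def by (simp only: appell_mu_add_of_nat mult.left_commute)
  qed
  have "muN N (u(0 := u 0 + of_nat j * \<tau>)) \<tau> = appell_mu N S \<tau> b (u 0 + of_nat j * \<tau>)"
    unfolding muN_upd_0[OF \<tau>] S_def b_def ..
  also have "\<dots> = c * (\<Sum>k<N. (-1) ^ k * appell_mu_transform N S \<tau> b' (u 0 + of_nat j * \<tau> - of_nat k)) - (-1) ^ N * \<i> / 2 * h"
  proof -
    have "u 0 + of_nat j * \<tau> + S - (?n - 1) / 2 = U + of_nat j * \<tau> - (?n - 1) / 2" by (simp add: U)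
    thus ?thesis using appell_mu_inversion[OF \<tau> N b b' inv z] unfolding c_def h_def by (simp only:)
  qed
  finally have mu: "muN N (u(0 := u 0 + of_nat j * \<tau>)) \<tau> =
      c * (\<Sum>k<N. (-1) ^ k * ((-1) ^ j * (?G k * A k))) - (-1) ^ N * \<i> / 2 * h"
    unfolding trans .
  have pref: "exp (- 2 * pi * \<i> * of_nat j * U / ?n - pi * \<i> * of_nat (j ^ 2) * \<tau> / ?n) = p"
    unfolding p_def expi_def by (rule arg_cong[where f = exp]) (simp add: algebra_simps)
  have pref': "exp (- 2 * pi * \<i> * of_nat j * U / ?n) * qpow \<tau> (- real (j^2) / (2 * real N)) = p"
    unfolding p_def qpow_def expi_def exp_add[symmetric] by (rule arg_cong[where f = exp]) (simp add: algebra_simps)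
  have gauss: "exp (pi * \<i> * U^2 / (?n * \<tau>)) = expi (U ^ 2 / (2 * ?n * \<tau>))"
    unfolding expi_def by (rule arg_cong[where f = exp]) simp
  have zeta: "zeta N powi (- int j * int k) = expi (- of_nat j * of_nat k / ?n)" for k
  proof -
    have "zeta N powi (- int j * int k) = exp (of_int (- int j * int k) * (2 * pi * \<i> / ?n))"
      unfolding zeta_def by (simp only: exp_power_int)
    thus ?thesis unfolding expi_def by (simp add: mult_ac)
  qed
  have MN': "MN N u' \<tau>' k = (-1) ^ k * (?h k * A k)" for k
  proof -
    have "exp (- 2 * pi * \<i> * of_nat k * (U / \<tau>) / ?n - pi * \<i> * of_nat (k ^ 2) * \<tau>' / ?n)
      = ?h k"
      unfolding expi_def by (rule arg_cong[where f = exp]) (simp add: algebra_simps)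
    moreover have "muN N (u'(0 := u' 0 + of_nat k * \<tau>')) \<tau>' = A k"
      unfolding muN_upd_0[OF \<tau>'] S' A_def b'_def by (simp add: u'_def)
    ultimately show ?thesis unfolding MN_def Let_def U' by (simp only: mult.assoc)
  qed
  \<comment> \<open>Expanding (U + j\<tau> - k)^2/(2N\<tau>): \<open>p\<close> cancels the terms
    jU/N and j^2\<tau>/(2N), and the cross term -jk/N is the source of the matrix entry.\<close>
  have summand: "p * ?G k
     = expi (U ^ 2 / (2 * ?n * \<tau>)) * (expi (- of_nat j * of_nat k / ?n) * ?h k)" for k
    unfolding p_def expi_add[symmetric] using nz
    by (intro expi_cong) (simp add: \<tau>'_def field_simps power2_eq_square)
  have j2: "(-1) ^ j * ((-1) ^ j * x) = x" for x :: complex by (cases "even j") auto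
  have "MN N u \<tau> j = (-1) ^ j * p * (c * (\<Sum>k<N. (-1) ^ k * ((-1) ^ j * (?G k * A k))) - (-1) ^ N * \<i> / 2 * h)"
    unfolding MN_def Let_def U_def[symmetric] pref mu by (rule refl)
  also have "\<dots> = c * (\<Sum>k<N. (-1) ^ j * ((-1) ^ j * ((-1) ^ k * (p * ?G k * A k)))) - (-1) ^ N * \<i> / 2 * ((-1) ^ j * p * h)"
    by (simp add: right_diff_distrib sum_distrib_left mult_ac)
  also have "(\<Sum>k<N. (-1) ^ j * ((-1) ^ j * ((-1) ^ k * (p * ?G k * A k))))
     = expi (U ^ 2 / (2 * ?n * \<tau>)) * (\<Sum>k<N. zeta N powi (- int j * int k) * MN N u' \<tau>' k)"
    unfolding j2 summand zeta MN' sum_distrib_left by (intro sum.cong refl) (simp only: mult_ac)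
  finally show ?thesis
    unfolding gauss mult.assoc[of "(-1) ^ j"] pref' c_def h_def u'_def \<tau>'_def by simp
qed

theorem theorem1p4:
  fixes N :: nat and u :: "nat \<Rightarrow> complex" and \<tau> :: complex
  assumes "Im \<tau> > 0" and "N \<ge> 1"
    and "\<And>j. j \<le> N \<Longrightarrow> u j \<notin> lattice \<tau>"
    and "\<And>j. j \<le> N \<Longrightarrow> u j / \<tau> \<notin> lattice (- 1 / \<tau>)"
  defines "U \<equiv> (\<Sum>j\<in>{0..N}. u j)"
  shows "(\<forall>j<N. MN N u \<tau> j =
           exp (pi * \<i> * of_nat N / 4) *
           (\<Sum>k<N. (if j = k then (-1)^k * zeta (2*N) ^ (k^2) else 0) * MN N u (\<tau> + 1) k)) \<and>
         (\<forall>j<N. MN N u \<tau> j =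
           (- \<i>)^(N+1) * exp (pi * \<i> * U^2 / (of_nat N * \<tau>)) / (of_real (sqrt (real N)) * csqrt (- \<i> * \<tau>))
             * (\<Sum>k<N. zeta N powi (- int j * int k) * MN N (\<lambda>i. u i / \<tau>) (- 1 / \<tau>) k)
           - (-1)^N * \<i> / 2 * ((-1)^j * exp (- 2 * pi * \<i> * of_nat j * U / of_nat N)
               * qpow \<tau> (- real (j^2) / (2 * real N))
               * mordell_h (U + of_nat j * \<tau> - (of_nat N - 1) / 2) (of_nat N * \<tau>)))"
proof (intro conjI allI impI, goal_cases)
  case (1 j)
  have N: "N > 0" using assms(2) by simp
  have "(\<Sum>k<N. (if j = k then (-1)^k * zeta (2*N) ^ (k^2) else 0) * MN N u (\<tau> + 1) k)
     = (\<Sum>k<N. if k = j then (-1)^j * zeta (2*N) ^ (j^2) * MN N u (\<tau> + 1) j else 0)"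
    by (intro sum.cong) auto
  also have "\<dots> = (-1)^j * zeta (2*N) ^ (j^2) * MN N u (\<tau> + 1) j" using 1 by simp
  finally have diag: "(\<Sum>k<N. (if j = k then (-1)^k * zeta (2*N) ^ (k^2) else 0) * MN N u (\<tau> + 1) k)
     = (-1)^j * zeta (2*N) ^ (j^2) * MN N u (\<tau> + 1) j" .
  show ?case unfolding diag by (rule MN_tau_add_1[OF N])
next
  case (2 j)
  show ?case unfolding U_def by (rule MN_inversion[OF assms(1) _ assms(3)]) (use assms(2) in auto)
qed

end
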